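(* Let $X,Y$ be real Banach spaces, $O\subset X$ an open neighborhood of the origin, and $\Lambda$ a connected finite CW-complex. Let $f\colon \Lambda\times O\to Y$ be a family of $C^1$-Fredholm maps of index $0$ parametrized by $\Lambda$, such that $f(\lambda,0)=0$ for all $\lambda\in\Lambda$, and let $L_\lambda=Df_\lambda(0)$. If the singular set $\Sigma(L)$ is a proper subset of $\Lambda$ and $\beta(f):=J(\operatorname{Ind} L)\neq 0$ in $J(\Lambda)$, then the family $f$ possesses at least one bifurcation point from the trivial branch.
   Context: A family of $C^1$-maps continuously parametrized by $\Lambda$ is a continuous map $f\colon\Lambda\times O\to Y$ such that each $f_\lambda=f(\lambda,\cdot)$ is $C^1$ and $D_xf\colon\Lambda\times O\to\mathcal L(X,Y)$ is continuous in the operator norm. It is a family of $C^1$-Fredholm maps of index $0$ if $Df_\lambda(x)$ is a Fredholm operator of index $0$ for all $(\lambda,x)$. $\Phi_0(X,Y)\subset\mathcal L(X,Y)$ denotes the Fredholm operators of index $0$ (norm topology). For a continuous family $L\colon\Lambda\to\Phi_0(X,Y)$, $\Sigma(L)=\{\lambda:\ker L_\lambda\neq 0\}$. A bifurcation point from the trivial branch is a point $\lambda_*\in\Lambda$ such that every neighborhood of $(\lambda_*,0)$ in $\Lambda\times O$ contains a solution $(\lambda,x)$ of $f(\lambda,x)=0$ with $x\neq 0$. Index bundle: $KO(\Lambda)$ is the Grothendieck group of real vector bundles over $\Lambda$ and $\widetilde{KO}(\Lambda)$ the kernel of the rank homomorphism. Given continuous $L\colon\Lambda\to\Phi_0(X,Y)$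 choose a finite dimensional subspace $V\subset Y$ with $\operatorname{Im}L_\lambda+V=Y$ for all $\lambda$ (it exists by compactness). Then $E=\{(\lambda,x):L_\lambda x\in V\}$ is a vector bundle over $\Lambda$ and $\operatorname{Ind}L=[E]-[\Lambda\times V]\in\widetilde{KO}(\Lambda)$, independently of $V$. $J$-group: write $\Theta^n=\Lambda\times\mathbb R^n$ and $S(E)$ for the unit sphere bundle of $E$. Vector bundles $E,F$ are stably fiberwise homotopy equivalent if, for some $n,m$, $S(E\oplus\Theta^n)$ and $S(F\oplus\Theta^m)$ are fiberwise homotopy equivalent. $T(\Lambda)\subset\widetilde{KO}(\Lambda)$ is the subgroup generated by the elements $[E]-[F]$ with $E,F$ stably fiberwise homotopy equivalent; $J(\Lambda)=\widetilde{KO}(\Lambda)/T(\Lambda)$, and $J\colon\widetilde{KO}(\Lambda)\to J(\Lambda)$ is the quotient projection. *)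

theory Defs
  imports
    "HOL-Analysis.Analysis"
    "HOL-Library.Function_Algebras"
    "HOL-Algebra.Product_Groups"
begin

section \<open>Finite CW-complexes\<close>

definition unit_disc :: "nat \<Rightarrow> (nat \<Rightarrow> real) set" where
  "unit_disc n = {x \<in> topspace (Euclidean_space n). (\<Sum>i<n. (x i)\<^sup>2) \<le> 1}"

definition open_unit_disc :: "nat \<Rightarrow> (nat \<Rightarrow> real) set" where
  "open_unit_disc n = {x \<in> topspace (Euclidean_space n). (\<Sum>i<n. (x i)\<^sup>2) < 1}"

definition boundary_sphere :: "nat \<Rightarrow> (nat \<Rightarrow> real) set" where
  "boundary_sphere n = {x \<in> topspace (Euclidean_space n). (\<Sum>i<n. (x i)\<^sup>2) = 1}"

text \<open>\<open>C\<close> is the set of open cells, \<open>d e\<close> the dimension and \<open>\<phi> e\<close> the characteristic map of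
  the cell \<open>e\<close>.  As there are finitely many cells, the closure-finiteness and weak-topology
  conditions are automatic: \<open>X\<close> is covered by the finitely many closed sets
  \<open>\<phi> e ` unit_disc (d e)\<close>.\<close>
definition finite_CW_complex :: "'l topology \<Rightarrow> bool" where
  "finite_CW_complex X \<longleftrightarrow> Hausdorff_space X \<and>
     (\<exists>(C :: 'l set set) (d :: 'l set \<Rightarrow> nat) (\<phi> :: 'l set \<Rightarrow> (nat \<Rightarrow> real) \<Rightarrow> 'l).
        finite C \<and> pairwise disjnt C \<and> \<Union>C = topspace X \<and>
        (\<forall>e\<in>C.
           continuous_map (subtopology (Euclidean_space (d e)) (unit_disc (d e))) X (\<phi> e) \<and>
           homeomorphic_map (subtopology (Euclidean_space (d e)) (open_unit_disc (d e)))
             (subtopology X e) (\<phi> e) \<and>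
           \<phi> e ` boundary_sphere (d e) \<subseteq> \<Union>{e'\<in>C. d e' < d e}))"


section \<open>Fredholm operators and families of \<open>C\<^sup>1\<close>-Fredholm maps\<close>

definition finite_dim :: "'v::real_vector set \<Rightarrow> bool" where
  "finite_dim S \<longleftrightarrow> subspace S \<and> (\<exists>B. finite B \<and> S = span B)"

definition finite_codim :: "'v::real_vector set \<Rightarrow> bool" where
  "finite_codim R \<longleftrightarrow> subspace R \<and> (\<exists>B. finite B \<and> span (R \<union> B) = UNIV)"

text \<open>The dimension of the quotient space by \<open>R\<close>: the least number of vectors that span modulo \<open>R\<close>.\<close>
definition codim :: "'v::real_vector set \<Rightarrow> nat" where
  "codim R = (LEAST n. \<exists>B. finite B \<and> card B = n \<and> span (R \<union> B) = UNIV)"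

definition op_kernel :: "('x::real_normed_vector \<Rightarrow>\<^sub>L 'y::real_normed_vector) \<Rightarrow> 'x set" where
  "op_kernel T = {x. blinfun_apply T x = 0}"

definition fredholm :: "('x::real_normed_vector \<Rightarrow>\<^sub>L 'y::real_normed_vector) \<Rightarrow> bool" where
  "fredholm T \<longleftrightarrow> finite_dim (op_kernel T) \<and> closed (range (blinfun_apply T)) \<and>
     finite_codim (range (blinfun_apply T))"

definition fredholm_index :: "('x::real_normed_vector \<Rightarrow>\<^sub>L 'y::real_normed_vector) \<Rightarrow> int" where
  "fredholm_index T = int (dim (op_kernel T)) - int (codim (range (blinfun_apply T)))"

definition fderiv ::
    "('l \<Rightarrow> 'x::real_normed_vector \<Rightarrow> 'y::real_normed_vector) \<Rightarrow> 'l \<Rightarrow> 'x \<Rightarrow> 'x \<Rightarrow>\<^sub>L 'y" where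
  "fderiv f l x = Blinfun (frechet_derivative (f l) (at x))"

definition C1_family ::
    "'l topology \<Rightarrow> 'x::real_normed_vector set \<Rightarrow> ('l \<Rightarrow> 'x \<Rightarrow> 'y::real_normed_vector) \<Rightarrow> bool" where
  "C1_family \<Lambda> U f \<longleftrightarrow>
     continuous_map (prod_topology \<Lambda> (top_of_set U)) euclidean (\<lambda>(l, x). f l x) \<and>
     (\<forall>l\<in>topspace \<Lambda>. \<forall>x\<in>U. f l differentiable (at x)) \<and>
     continuous_map (prod_topology \<Lambda> (top_of_set U)) euclidean (\<lambda>(l, x). fderiv f l x)"

definition C1_fredholm0_family ::
    "'l topology \<Rightarrow> 'x::real_normed_vector set \<Rightarrow> ('l \<Rightarrow> 'x \<Rightarrow> 'y::real_normed_vector) \<Rightarrow> bool" where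
  "C1_fredholm0_family \<Lambda> U f \<longleftrightarrow> C1_family \<Lambda> U f \<and>
     (\<forall>l\<in>topspace \<Lambda>. \<forall>x\<in>U. fredholm (fderiv f l x) \<and> fredholm_index (fderiv f l x) = 0)"

definition singular_set ::
    "'l topology \<Rightarrow> ('l \<Rightarrow> 'x::real_normed_vector \<Rightarrow>\<^sub>L 'y::real_normed_vector) \<Rightarrow> 'l set" where
  "singular_set \<Lambda> L = {l \<in> topspace \<Lambda>. op_kernel (L l) \<noteq> {0}}"

definition bifurcation_point ::
    "'l topology \<Rightarrow> 'x::real_normed_vector set \<Rightarrow> ('l \<Rightarrow> 'x \<Rightarrow> 'y::real_normed_vector) \<Rightarrow> 'l \<Rightarrow> bool" where
  "bifurcation_point \<Lambda> U f l0 \<longleftrightarrow> l0 \<in> topspace \<Lambda> \<and>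
     (\<forall>N. openin (prod_topology \<Lambda> (top_of_set U)) N \<and> (l0, 0) \<in> N \<longrightarrow>
        (\<exists>(l, x)\<in>N. f l x = 0 \<and> x \<noteq> 0))"


section \<open>Real vector bundles\<close>

text \<open>Pointwise scalar multiplication makes \<open>nat \<Rightarrow> real\<close>, and hence the underlying set of every
  \<open>Euclidean_space n\<close>, part of a real vector space.\<close>

instantiation "fun" :: (type, real_vector) real_vector
begin

definition scaleR_fun :: "real \<Rightarrow> ('a \<Rightarrow> 'b) \<Rightarrow> 'a \<Rightarrow> 'b" where
  "scaleR_fun c g = (\<lambda>x. c *\<^sub>R g x)"

instance
  by standard (auto simp: scaleR_fun_def plus_fun_def fun_eq_iff algebra_simps)

end

text \<open>A vector bundle is given by the topology of its total space.  The total space is a set of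
  pairs \<open>(l, v)\<close>, the projection is \<^const>\<open>fst\<close>, and the fibre over \<open>l\<close> is a linear subspace of the
  real vector space \<^typ>\<open>'w\<close>.  Only the linear structure of the fibres comes from \<^typ>\<open>'w\<close>; the
  topology of the total space is arbitrary, subject to local triviality.  So, by choosing linear
  coordinates in each fibre and transporting the topology, every real vector bundle of finite rank
  (over a base of type \<^typ>\<open>'l\<close>) is isomorphic to one with \<^typ>\<open>'w\<close> \<open>=\<close> \<^typ>\<open>nat \<Rightarrow> real\<close>.\<close>

type_synonym ('l, 'w) total_space = "('l \<times> 'w) topology"
type_synonym 'l std_total_space = "('l, nat \<Rightarrow> real) total_space"

definition fibre :: "('l, 'w) total_space \<Rightarrow> 'l \<Rightarrow> 'w set" where
  "fibre E l = {v. (l, v) \<in> topspace E}"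

definition fibre_preserving :: "('l, 'w) total_space \<Rightarrow> ('l \<times> 'w \<Rightarrow> 'l \<times> 'v) \<Rightarrow> bool" where
  "fibre_preserving E h \<longleftrightarrow> (\<forall>p\<in>topspace E. fst (h p) = fst p)"

definition fibrewise_linear ::
    "('l, 'w::real_vector) total_space \<Rightarrow> ('l \<times> 'w \<Rightarrow> 'l \<times> 'v::real_vector) \<Rightarrow> bool" where
  "fibrewise_linear E h \<longleftrightarrow>
     (\<forall>l. \<forall>v\<in>fibre E l. \<forall>w\<in>fibre E l. \<forall>a b.
        snd (h (l, a *\<^sub>R v + b *\<^sub>R w)) = a *\<^sub>R snd (h (l, v)) + b *\<^sub>R snd (h (l, w)))"

definition bundle_iso ::
    "('l, 'w::real_vector) total_space \<Rightarrow> ('l, 'v::real_vector) total_space \<Rightarrow> bool" where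
  "bundle_iso E F \<longleftrightarrow>
     (\<exists>h. homeomorphic_map E F h \<and> fibre_preserving E h \<and> fibrewise_linear E h)"

definition vector_bundle :: "'l topology \<Rightarrow> ('l, 'w::real_vector) total_space \<Rightarrow> bool" where
  "vector_bundle \<Lambda> E \<longleftrightarrow>
     continuous_map E \<Lambda> fst \<and>
     (\<forall>l\<in>topspace \<Lambda>. subspace (fibre E l)) \<and>
     (\<forall>l\<in>topspace \<Lambda>. \<exists>U n. openin \<Lambda> U \<and> l \<in> U \<and>
        bundle_iso (subtopology E (U \<times> UNIV)) (prod_topology (subtopology \<Lambda> U) (Euclidean_space n)))"

definition trivial_bundle :: "'l topology \<Rightarrow> nat \<Rightarrow> 'l std_total_space" where
  "trivial_bundle \<Lambda> n = prod_topology \<Lambda> (Euclidean_space n)"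

text \<open>The Whitney sum, topologized as the fibre product of the two total spaces.\<close>
definition whitney_sum ::
    "('l, 'w) total_space \<Rightarrow> ('l, 'v) total_space \<Rightarrow> ('l, 'w \<times> 'v) total_space" where
  "whitney_sum E F =
     pullback_topology {(l, (v, w)). (l, v) \<in> topspace E \<and> (l, w) \<in> topspace F}
       (\<lambda>(l, (v, w)). ((l, v), (l, w))) (prod_topology E F)"


section \<open>The Grothendieck group \<open>KO\<close> and its reduced version\<close>

definition bundle_class ::
    "'l topology \<Rightarrow> ('l, 'w::real_vector) total_space \<Rightarrow> 'l std_total_space set" where
  "bundle_class \<Lambda> E = {G. vector_bundle \<Lambda> G \<and> bundle_iso E G}"

text \<open>The monoid of isomorphism classes of real vector bundles under Whitney sum.\<close>
definition Vect :: "'l topology \<Rightarrow> 'l std_total_space set monoid" where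
  "Vect \<Lambda> = \<lparr>carrier = bundle_class \<Lambda> ` {E :: 'l std_total_space. vector_bundle \<Lambda> E},
            monoid.mult = (\<lambda>P Q. \<Union>E\<in>P. \<Union>F\<in>Q. bundle_class \<Lambda> (whitney_sum E F)),
            one = bundle_class \<Lambda> (trivial_bundle \<Lambda> 0)\<rparr>"

definition grothendieck_rel :: "('a, 'm) monoid_scheme \<Rightarrow> (('a \<times> 'a) \<times> ('a \<times> 'a)) set" where
  "grothendieck_rel M =
     {((a, b), (c, d)). a \<in> carrier M \<and> b \<in> carrier M \<and> c \<in> carrier M \<and> d \<in> carrier M \<and>
        (\<exists>k\<in>carrier M. a \<otimes>\<^bsub>M\<^esub> d \<otimes>\<^bsub>M\<^esub> k = c \<otimes>\<^bsub>M\<^esub> b \<otimes>\<^bsub>M\<^esub> k)}"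

definition formal_diff :: "('a, 'm) monoid_scheme \<Rightarrow> 'a \<Rightarrow> 'a \<Rightarrow> ('a \<times> 'a) set" where
  "formal_diff M a b = grothendieck_rel M `` {(a, b)}"

definition grothendieck_group :: "('a, 'm) monoid_scheme \<Rightarrow> ('a \<times> 'a) set monoid" where
  "grothendieck_group M =
     \<lparr>carrier = (carrier M \<times> carrier M) // grothendieck_rel M,
      monoid.mult = (\<lambda>p q. \<Union>(a, b)\<in>p. \<Union>(c, d)\<in>q. formal_diff M (a \<otimes>\<^bsub>M\<^esub> c) (b \<otimes>\<^bsub>M\<^esub> d)),
      one = formal_diff M \<one>\<^bsub>M\<^esub> \<one>\<^bsub>M\<^esub>\<rparr>"

type_synonym 'l ko_element = "('l std_total_space set \<times> 'l std_total_space set) set"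

definition KO :: "'l topology \<Rightarrow> 'l ko_element monoid" where
  "KO \<Lambda> = grothendieck_group (Vect \<Lambda>)"

definition ko_diff ::
    "'l topology \<Rightarrow> ('l, 'w::real_vector) total_space \<Rightarrow> ('l, 'v::real_vector) total_space
      \<Rightarrow> 'l ko_element" where
  "ko_diff \<Lambda> E F = formal_diff (Vect \<Lambda>) (bundle_class \<Lambda> E) (bundle_class \<Lambda> F)"

text \<open>The virtual rank, as a function of the base point; it is constant when the base is connected.\<close>
definition ko_rank :: "'l topology \<Rightarrow> 'l ko_element \<Rightarrow> 'l \<Rightarrow> int" where
  "ko_rank \<Lambda> c = (\<lambda>l\<in>topspace \<Lambda>.
     THE k. \<exists>(P, Q)\<in>c. \<exists>E\<in>P. \<exists>F\<in>Q. k = int (dim (fibre E l)) - int (dim (fibre F l)))"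

definition KO_reduced :: "'l topology \<Rightarrow> 'l ko_element monoid" where
  "KO_reduced \<Lambda> = (KO \<Lambda>)\<lparr>carrier :=
     kernel (KO \<Lambda>) (product_group (topspace \<Lambda>) (\<lambda>_. integer_group)) (ko_rank \<Lambda>)\<rparr>"


section \<open>The index bundle\<close>

definition index_subspace ::
    "'l topology \<Rightarrow> ('l \<Rightarrow> 'x::real_normed_vector \<Rightarrow>\<^sub>L 'y::real_normed_vector) \<Rightarrow> 'y set \<Rightarrow> bool" where
  "index_subspace \<Lambda> L V \<longleftrightarrow> finite_dim V \<and>
     (\<forall>l\<in>topspace \<Lambda>. {blinfun_apply (L l) x + v |x v. v \<in> V} = UNIV)"

definition index_bundle_total ::
    "'l topology \<Rightarrow> ('l \<Rightarrow> 'x::real_normed_vector \<Rightarrow>\<^sub>L 'y::real_normed_vector) \<Rightarrow> 'y set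
      \<Rightarrow> ('l, 'x) total_space" where
  "index_bundle_total \<Lambda> L V =
     subtopology (prod_topology \<Lambda> euclidean) {(l, x). blinfun_apply (L l) x \<in> V}"

definition Ind ::
    "'l topology \<Rightarrow> ('l \<Rightarrow> 'x::real_normed_vector \<Rightarrow>\<^sub>L 'y::real_normed_vector) \<Rightarrow> 'l ko_element" where
  "Ind \<Lambda> L = (let V = (SOME V. index_subspace \<Lambda> L V)
     in ko_diff \<Lambda> (index_bundle_total \<Lambda> L V) (prod_topology \<Lambda> (top_of_set V)))"


section \<open>Stable fibrewise homotopy equivalence and the group \<open>J\<close>\<close>

definition fibre_metric ::
    "'l topology \<Rightarrow> ('l, 'w::real_vector) total_space \<Rightarrow> ('l \<Rightarrow> 'w \<Rightarrow> 'w \<Rightarrow> real) \<Rightarrow> bool" where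
  "fibre_metric \<Lambda> E g \<longleftrightarrow>
     continuous_map (whitney_sum E E) euclideanreal (\<lambda>(l, (v, w)). g l v w) \<and>
     (\<forall>l\<in>topspace \<Lambda>. \<forall>u\<in>fibre E l. \<forall>v\<in>fibre E l. \<forall>w\<in>fibre E l. \<forall>a b.
        g l (a *\<^sub>R u + b *\<^sub>R v) w = a * g l u w + b * g l v w \<and> g l v w = g l w v) \<and>
     (\<forall>l\<in>topspace \<Lambda>. \<forall>v\<in>fibre E l. v \<noteq> 0 \<longrightarrow> g l v v > 0)"

definition sphere_bundle ::
    "('l, 'w) total_space \<Rightarrow> ('l \<Rightarrow> 'w \<Rightarrow> 'w \<Rightarrow> real) \<Rightarrow> ('l, 'w) total_space" where
  "sphere_bundle E g = subtopology E {(l, v). g l v v = 1}"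

definition fibre_homotopy_equivalent :: "('l, 'w) total_space \<Rightarrow> ('l, 'v) total_space \<Rightarrow> bool" where
  "fibre_homotopy_equivalent P Q \<longleftrightarrow>
     (\<exists>\<phi> \<psi>. continuous_map P Q \<phi> \<and> fibre_preserving P \<phi> \<and>
            continuous_map Q P \<psi> \<and> fibre_preserving Q \<psi> \<and>
            homotopic_with (fibre_preserving P) P P (\<psi> \<circ> \<phi>) id \<and>
            homotopic_with (fibre_preserving Q) Q Q (\<phi> \<circ> \<psi>) id)"

text \<open>Over a compact Hausdorff base every bundle has a fibre metric, and the sphere bundles for two
  metrics are fibrewise homeomorphic, so the choice of metrics is immaterial.\<close>
definition stably_fibre_homotopy_equivalent ::
    "'l topology \<Rightarrow> ('l, 'w::real_vector) total_space \<Rightarrow> ('l, 'v::real_vector) total_space \<Rightarrow> bool" where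
  "stably_fibre_homotopy_equivalent \<Lambda> E F \<longleftrightarrow>
     (\<exists>n m g h. fibre_metric \<Lambda> (whitney_sum E (trivial_bundle \<Lambda> n)) g \<and>
        fibre_metric \<Lambda> (whitney_sum F (trivial_bundle \<Lambda> m)) h \<and>
        fibre_homotopy_equivalent
          (sphere_bundle (whitney_sum E (trivial_bundle \<Lambda> n)) g)
          (sphere_bundle (whitney_sum F (trivial_bundle \<Lambda> m)) h))"

text \<open>Stably fibrewise homotopy equivalent bundles may have different ranks; only the differences of
  rank zero lie in the reduced group, and these are the generators.\<close>
definition T_group :: "'l topology \<Rightarrow> 'l ko_element set" where
  "T_group \<Lambda> = generate (KO_reduced \<Lambda>)
     ({ko_diff \<Lambda> E F |(E :: 'l std_total_space) (F :: 'l std_total_space).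
         vector_bundle \<Lambda> E \<and> vector_bundle \<Lambda> F \<and>
         stably_fibre_homotopy_equivalent \<Lambda> E F} \<inter> carrier (KO_reduced \<Lambda>))"

definition J_group :: "'l topology \<Rightarrow> 'l ko_element set monoid" where
  "J_group \<Lambda> = KO_reduced \<Lambda> Mod T_group \<Lambda>"

definition J_proj :: "'l topology \<Rightarrow> 'l ko_element \<Rightarrow> 'l ko_element set" where
  "J_proj \<Lambda> c = T_group \<Lambda> #>\<^bsub>KO_reduced \<Lambda>\<^esub> c"

definition bifurcation_index ::
    "'l topology \<Rightarrow> ('l \<Rightarrow> 'x::real_normed_vector \<Rightarrow> 'y::real_normed_vector) \<Rightarrow> 'l ko_element set" where
  "bifurcation_index \<Lambda> f = J_proj \<Lambda> (Ind \<Lambda> (\<lambda>l. fderiv f l 0))"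

end

theory Submission
  imports Defs
begin

text \<open>Suppose that \<open>f\<close> has no bifurcation point.  By compactness of \<open>\<Lambda>\<close> the equation
  \<open>f l x = 0\<close> has only the trivial solution on a uniform ball around \<open>0\<close>.  Let \<open>V\<close> be a finite
  dimensional subspace transversal to all \<open>L l\<close>, so that the index bundle is \<open>E - V\<close> with
  \<open>E l = {x. L l x \<in> V}\<close>.  If \<open>R l\<close> is a right inverse of \<open>L l\<close> modulo \<open>V\<close> and \<open>h l = f l - L l\<close>, then
  the equation \<open>z = - h l (e + R l z)\<close> has a unique small solution \<open>z\<close>, and \<open>e \<mapsto> f l (e + R l z)\<close>
  maps \<open>E l\<close> to \<open>V\<close> with no zero near \<open>0\<close> besides \<open>0\<close> itself.  Normalization yields a fibre
  preserving map of sphere bundles \<open>\<phi> : S(E) \<rightarrow> \<Lambda> \<times> S(V)\<close>.  Where \<open>L l\<close> is invertible, \<open>\<phi>\<close> is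
  homotopic on the fibre to the homeomorphism induced by \<open>L l\<close>.  Since nearby maps into a sphere are
  homotopic, the set of points over which \<open>\<phi>\<close> is homotopic to a homeomorphism is open and closed,
  hence all of \<open>\<Lambda>\<close>, and no degree theory is needed.  A map that is locally fibre homotopic to
  homeomorphisms is a fibre homotopy equivalence (an elementary case of Dold's theorem), so the
  index bundle lies in the subgroup \<open>T\<close>, contrary to the assumption.\<close>


section \<open>Fibrewise homotopy equivalences\<close>

text \<open>The definitions shape the argument in two ways. \<open>Ind\<close> takes
  \<open>V\<close> by choice, so everything is carried out for an arbitrary index subspace. The
  generators of \<open>T_group\<close> have fibres in \<open>nat \<Rightarrow> real\<close>, whereas
  the index bundle has its fibres in a Banach space, so bundles must be moved to standard fibres.
  The delicate step leads from single fibres to neighbourhoods, since homotopies on the fibres one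
  by one need not fit together. In a local trivialization \<phi> is homotopic, over a neighbourhood
  of \<open>b\<close>, to the map frozen at \<open>b\<close>. Being homotopic to a homeomorphism
  thus becomes a property of one self-map of the sphere \<open>S\<close>: it is the same for all
  nearby points, and a homotopy of that self-map spreads over the neighbourhood as a product. For
  Dold's theorem only right inverses up to homotopy are glued, because a single homotopy can be
  stopped by a cut-off function. The right inverse so found is again locally homotopic to
  homeomorphisms, hence has a right inverse itself, and the rest is formal.\<close>

abbreviation over :: "('l, 'w) total_space \<Rightarrow> 'l set \<Rightarrow> ('l, 'w) total_space" where
  "over P W \<equiv> subtopology P (W \<times> UNIV)"

abbreviation fibre_homotopic ::
    "('l, 'w) total_space \<Rightarrow> ('l, 'v) total_space \<Rightarrow> ('l \<times> 'w \<Rightarrow> 'l \<times> 'v) \<Rightarrow> ('l \<times> 'w \<Rightarrow> 'l \<times> 'v) \<Rightarrow> bool" where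
  "fibre_homotopic P Q \<equiv> homotopic_with (fibre_preserving P) P Q"

lemma fibre_preserving_cong:
  "(\<And>x. x \<in> topspace P \<Longrightarrow> h x = k x) \<Longrightarrow> fibre_preserving P h \<longleftrightarrow> fibre_preserving P k"
  by (auto simp: fibre_preserving_def)

lemma fibre_homotopic_iff:
  "fibre_homotopic P Q p q \<longleftrightarrow>
     (\<exists>h. continuous_map (prod_topology (top_of_set {0..1::real}) P) Q h \<and>
       (\<forall>x\<in>topspace P. h (0, x) = p x) \<and> (\<forall>x\<in>topspace P. h (1, x) = q x) \<and>
       (\<forall>t\<in>{0..1}. \<forall>x\<in>topspace P. fst (h (t, x)) = fst x))"
  by (subst homotopic_with) (auto simp: fibre_preserving_def)

lemma continuous_map_paste2:
  assumes "openin X A" "openin X B" "topspace X \<subseteq> A \<union> B"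
    and "continuous_map (subtopology X A) Y f" "continuous_map (subtopology X B) Y g"
    and "\<And>x. x \<in> topspace X \<Longrightarrow> x \<in> A \<Longrightarrow> h x = f x"
    and "\<And>x. x \<in> topspace X \<Longrightarrow> x \<in> B \<Longrightarrow> h x = g x"
  shows "continuous_map X Y h"
proof (rule pasting_lemma[where I = UNIV and T = "\<lambda>i. if i then A else B" and f = "\<lambda>i. if i then f else g"])
  show "\<exists>j. j \<in> UNIV \<and> x \<in> (if j then A else B) \<and> h x = (if j then f else g) x"
    if "x \<in> topspace X" for x
    using assms(3,6,7) that by (cases "x \<in> A") (auto intro: exI[of _ True] exI[of _ False])
  show "(if i then f else g) x = (if j then f else g) x"
    if "x \<in> topspace X \<inter> (if i then A else B) \<inter> (if j then A else B)" for i j x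
    using assms(6,7)[of x] that by (cases i; cases j) auto
qed (use assms in auto)

lemma over_eq: "over P W = subtopology P {p \<in> topspace P. fst p \<in> W}"
proof -
  have "topspace P \<inter> W \<times> UNIV = {p \<in> topspace P. fst p \<in> W}" by (auto simp: mem_Times_iff)
  then show ?thesis by (metis subtopology_restrict)
qed

lemma prod_over:
  "prod_topology X (over P W) = subtopology (prod_topology X P) (UNIV \<times> (W \<times> UNIV))"
proof -
  have "topspace X \<times> topspace P \<inter> topspace X \<times> (W \<times> UNIV) = topspace X \<times> topspace P \<inter> UNIV \<times> (W \<times> UNIV)"
    by auto
  then have "subtopology (prod_topology X P) (topspace X \<times> (W \<times> UNIV)) = subtopology (prod_topology X P) (UNIV \<times> (W \<times> UNIV))"
    by (metis subtopology_restrict topspace_prod_topology)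
  then show ?thesis by (simp add: prod_topology_subtopology)
qed

lemma fibre_homotopic_over:
  assumes "fibre_homotopic P Q f g"
  shows "fibre_homotopic (over P W) (over Q W) f g"
proof -
  obtain h where h: "continuous_map (prod_topology (top_of_set {0..1::real}) P) Q h"
     "\<forall>x\<in>topspace P. h (0, x) = f x" "\<forall>x\<in>topspace P. h (1, x) = g x"
     "\<forall>t\<in>{0..1}. \<forall>x\<in>topspace P. fst (h (t, x)) = fst x"
    using assms unfolding fibre_homotopic_iff by blast
  have "continuous_map (prod_topology (top_of_set {0..1::real}) (over P W)) (over Q W) h"
    unfolding continuous_map_in_subtopology prod_over
    using h by (auto simp: continuous_map_from_subtopology mem_Times_iff)
  then show ?thesis unfolding fibre_homotopic_iff using h by auto
qed

lemma fibre_homotopic_compose_left: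
  assumes "fibre_homotopic P Q f g" "continuous_map Q R k" "fibre_preserving Q k"
  shows "fibre_homotopic P R (k \<circ> f) (k \<circ> g)"
proof -
  obtain h where h: "continuous_map (prod_topology (top_of_set {0..1::real}) P) Q h"
     "\<forall>x\<in>topspace P. h (0, x) = f x" "\<forall>x\<in>topspace P. h (1, x) = g x"
     "\<forall>t\<in>{0..1}. \<forall>x\<in>topspace P. fst (h (t, x)) = fst x"
    using assms unfolding fibre_homotopic_iff by blast
  have "h (t,x) \<in> topspace Q" if "t \<in> {0..1}" "x \<in> topspace P" for t x
    using continuous_map_image_subset_topspace[OF h(1)] that by auto
  then show ?thesis unfolding fibre_homotopic_iff
    using h assms(3) continuous_map_compose[OF h(1) assms(2)]
    by (intro exI[of _ "k \<circ> h"]) (auto simp: fibre_preserving_def)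
qed

lemma fibre_homotopic_compose_right:
  assumes "fibre_homotopic Q R f g" "continuous_map P Q k" "fibre_preserving P k"
  shows "fibre_homotopic P R (f \<circ> k) (g \<circ> k)"
  using assms(1,2)
  by (rule homotopic_with_compose_continuous_map_right)
     (use continuous_map_image_subset_topspace[OF assms(2)] assms(3) in \<open>auto simp: fibre_preserving_def\<close>)

text \<open>Applied to a Urysohn function \<open>s\<close>, the clamp vanishes wherever
  \<open>s\<close> is at most 1/3 and is 1 wherever \<open>s\<close> is at least 2/3. It is thus
  constant on open neighbourhoods of the two closed sets, as pasting along open sets
  requires.\<close>

lemma clamp_continuous:
  fixes s :: "'l \<Rightarrow> real"
  assumes "continuous_map B euclideanreal s"
  shows "continuous_map B (top_of_set {0..1}) (\<lambda>b. max 0 (min 1 (3 * s b - 1)))"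
  unfolding continuous_map_in_subtopology
  by (auto intro!: continuous_intros continuous_map_real_max continuous_map_real_min assms)

section \<open>Cut-off of homotopies and gluing of right inverses over a normal base\<close>

lemma Urysohn_real:
  assumes "normal_space B" "closedin B S" "closedin B T" "disjnt S T"
  obtains f where "continuous_map B euclideanreal f" "\<And>x. x \<in> topspace B \<Longrightarrow> 0 \<le> f x \<and> f x \<le> 1"
    "\<And>x. x \<in> S \<Longrightarrow> f x = 0" "\<And>x. x \<in> T \<Longrightarrow> f x = (1::real)"
proof -
  obtain f where "continuous_map B (top_of_set {0..1::real}) f" "f ` S \<subseteq> {0}" "f ` T \<subseteq> {1}"
    using Urysohn_lemma[OF assms, of 0 1] by auto
  then show ?thesis
    by (intro that[of f]) (auto simp: continuous_map_in_subtopology)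
qed

text \<open>At the base point \<open>b\<close> the homotopy \<open>K\<close> over \<open>U\<close>
  is run only up to time \<open>\<sigma> b\<close>. The cut-off \<sigma> is 1 near \<open>C\<close>,
  where the end map \<open>l\<close> is reached, and 0 near the complement of \<open>U\<close>,
  where \<phi> is left alone. So \<phi> may be replaced by a globally homotopic map that is exactly
  \<open>l\<close> near \<open>C\<close>.\<close>

lemma homotopy_to_local_model:
  assumes nB: "normal_space B" and cP: "continuous_map P B fst"
    and \<phi>: "continuous_map P Q \<phi>" "fibre_preserving P \<phi>"
    and U: "openin B U" and C: "closedin B C" "C \<subseteq> U"
    and hom: "fibre_homotopic (over P U) (over Q U) \<phi> l"
  obtains \<phi>' V where "fibre_homotopic P Q \<phi> \<phi>'" "openin B V" "C \<subseteq> V" "V \<subseteq> U"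
    "\<And>p. p \<in> topspace P \<Longrightarrow> fst p \<in> V \<Longrightarrow> \<phi>' p = l p"
proof -
  obtain K where K: "continuous_map (prod_topology (top_of_set {0..1::real}) (over P U)) (over Q U) K"
     "\<And>x. x \<in> topspace P \<Longrightarrow> fst x \<in> U \<Longrightarrow> K (0, x) = \<phi> x"
     "\<And>x. x \<in> topspace P \<Longrightarrow> fst x \<in> U \<Longrightarrow> K (1, x) = l x"
     "\<And>t x. t\<in>{0..1} \<Longrightarrow> x \<in> topspace P \<Longrightarrow> fst x \<in> U \<Longrightarrow> fst (K (t, x)) = fst x"
    using hom unfolding fibre_homotopic_iff by (auto simp: mem_Times_iff)
  obtain s where s: "continuous_map B euclideanreal s"
     "\<And>x. x \<in> topspace B - U \<Longrightarrow> s x = (0::real)" "\<And>x. x \<in> C \<Longrightarrow> s x = 1"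
  proof (rule Urysohn_real[OF nB _ C(1), of "topspace B - U"])
    show "closedin B (topspace B - U)" using U by blast
    show "disjnt (topspace B - U) C" using C by (auto simp: disjnt_iff)
  qed blast
  define \<sigma> where "\<sigma> b = max 0 (min 1 (3 * s b - 1))" for b
  have \<sigma>: "continuous_map B (top_of_set {0..1}) \<sigma>" unfolding \<sigma>_def by (rule clamp_continuous[OF s(1)])
  have \<sigma>': "continuous_map B euclideanreal \<sigma>" using \<sigma> by (simp add: continuous_map_in_subtopology)
  have \<sigma>01: "0 \<le> \<sigma> b" "\<sigma> b \<le> 1" for b by (auto simp: \<sigma>_def)
  define Z where "Z = {b \<in> topspace B. s b < 1/3}"
  define V where "V = {b \<in> topspace B. 2/3 < s b}"
  have oZ: "openin B Z" unfolding Z_def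
    using continuous_map_upper_lower_semicontinuous_lt s(1) by (metis)
  have oV: "openin B V" unfolding V_def
    using continuous_map_upper_lower_semicontinuous_lt s(1) by (metis)
  let ?X = "prod_topology (top_of_set {0..1::real}) P"
  define H where "H = (\<lambda>(t, p). if fst p \<in> U then K (t * \<sigma> (fst p), p) else \<phi> p)"
  have cfst: "continuous_map ?X B (\<lambda>x. fst (snd x))"
    using continuous_map_compose[OF continuous_map_snd cP] by (simp add: o_def)
  have "continuous_map ?X Q H"
  proof (rule continuous_map_paste2)
    let ?A = "{x \<in> topspace ?X. fst (snd x) \<in> U}"
    let ?B = "{x \<in> topspace ?X. fst (snd x) \<in> Z}"
    show "openin ?X ?A" "openin ?X ?B"
      using openin_continuous_map_preimage[OF cfst] U oZ by auto
    show "topspace ?X \<subseteq> ?A \<union> ?B"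
      using continuous_map_image_subset_topspace[OF cP] s(2) by (fastforce simp: Z_def)
    show "continuous_map (subtopology ?X ?A) Q (K \<circ> (\<lambda>x. (fst x * \<sigma> (fst (snd x)), snd x)))"
    proof (rule continuous_map_compose)
      show "continuous_map (subtopology ?X ?A) (prod_topology (top_of_set {0..1}) (over P U))
          (\<lambda>x. (fst x * \<sigma> (fst (snd x)), snd x))"
        unfolding continuous_map_pairwise o_def continuous_map_in_subtopology
      proof (intro conjI)
        have 1: "continuous_map ?X euclideanreal fst"
          using continuous_map_fst[of "top_of_set {0..1::real}" P] by (simp add: continuous_map_in_subtopology)
        have 2: "continuous_map ?X euclideanreal (\<lambda>x. \<sigma> (fst (snd x)))"
          using continuous_map_compose[OF cfst \<sigma>'] by (simp add: o_def)
        show "continuous_map (subtopology ?X ?A) euclideanreal (\<lambda>x. fst (fst x * \<sigma> (fst (snd x)), snd x))"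
          using continuous_map_from_subtopology[OF continuous_map_real_mult[OF 1 2]] by simp
      qed (use \<sigma>01 in \<open>auto simp: continuous_map_from_subtopology continuous_map_snd mult_le_one\<close>)
      show "continuous_map (prod_topology (top_of_set {0..1}) (over P U)) Q K"
        using K(1) by (simp add: continuous_map_in_subtopology)
    qed
    show "continuous_map (subtopology ?X ?B) Q (\<phi> \<circ> snd)"
      by (intro continuous_map_from_subtopology continuous_map_compose[OF continuous_map_snd \<phi>(1)])
    show "H x = (\<phi> \<circ> snd) x" if "x \<in> topspace ?X" "x \<in> ?B" for x
      using that K(2) by (auto simp: H_def Z_def \<sigma>_def split: prod.splits)
  qed (auto simp: H_def)
  then have hom: "fibre_homotopic P Q \<phi> (\<lambda>p. H (1, p))"
    unfolding fibre_homotopic_iff using K \<phi>(2)  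
    by (intro exI[of _ H]) (auto simp: H_def fibre_preserving_def \<sigma>01 mult_le_one)
  show ?thesis
  proof (rule that[OF hom oV])
    show "C \<subseteq> V" using s(3) C closedin_subset[OF C(1)] by (auto simp: V_def)
    show "V \<subseteq> U" using s(2) unfolding V_def by force
    then show "H (1, p) = l p" if "p \<in> topspace P" "fst p \<in> V" for p
      using that K(3)[of p] by (auto simp: H_def V_def \<sigma>_def)
  qed
qed

text \<open>Only one composite is controlled. Gluing two-sided inverses would require a second
  homotopy to match as well; the other side is recovered later by applying the result to
  \<open>\<psi>\<close> itself.\<close>

definition fibre_right_invertible ::
    "('l, 'w) total_space \<Rightarrow> ('l, 'v) total_space \<Rightarrow> ('l \<times> 'w \<Rightarrow> 'l \<times> 'v) \<Rightarrow> bool" where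
  "fibre_right_invertible P Q \<phi> \<longleftrightarrow>
     (\<exists>\<psi>. continuous_map Q P \<psi> \<and> fibre_preserving Q \<psi> \<and> fibre_homotopic Q Q (\<phi> \<circ> \<psi>) id)"

lemma fibre_right_invertible_homotopic:
  assumes "fibre_right_invertible P Q \<phi>" "fibre_homotopic P Q \<phi>' \<phi>"
  shows "fibre_right_invertible P Q \<phi>'"
proof -
  obtain \<psi> where \<psi>: "continuous_map Q P \<psi>" "fibre_preserving Q \<psi>" "fibre_homotopic Q Q (\<phi> \<circ> \<psi>) id"
    using assms unfolding fibre_right_invertible_def by blast
  have "fibre_homotopic Q Q (\<phi>' \<circ> \<psi>) id"
    using homotopic_with_trans[OF fibre_homotopic_compose_right[OF assms(2) \<psi>(1,2)] \<psi>(3)] .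
  then show ?thesis using \<psi> unfolding fibre_right_invertible_def by blast
qed

definition fibre_homeo ::
    "('l, 'w) total_space \<Rightarrow> ('l, 'v) total_space \<Rightarrow> ('l \<times> 'w \<Rightarrow> 'l \<times> 'v) \<Rightarrow> bool" where
  "fibre_homeo P Q h \<longleftrightarrow> homeomorphic_map P Q h \<and> fibre_preserving P h"

lemma fibre_homeo_inverse:
  assumes "fibre_homeo P Q h"
  obtains k where "fibre_homeo Q P k" "\<And>x. x \<in> topspace P \<Longrightarrow> k (h x) = x"
    "\<And>y. y \<in> topspace Q \<Longrightarrow> h (k y) = y"
proof -
  obtain k where k: "homeomorphic_maps P Q h k"
    using assms homeomorphic_map_maps unfolding fibre_homeo_def by blast
  have "fibre_preserving Q k"
    using k assms continuous_map_image_subset_topspace unfolding fibre_preserving_def fibre_homeo_def homeomorphic_maps_def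
    by (metis image_subset_iff)
  then show ?thesis using k that[of k]
    unfolding fibre_homeo_def using homeomorphic_maps_map homeomorphic_maps_sym 
    by (metis homeomorphic_maps_def)
qed

lemma fibre_homeo_over:
  assumes h: "fibre_homeo (over P U) (over Q U) h" and "V \<subseteq> U"
  shows "fibre_homeo (over P V) (over Q V) h"
proof -
  have *: "over (over P U) V = over P V" "over (over Q U) V = over Q V"
    using assms(2) by (auto simp: subtopology_subtopology Times_Int_Times Int_absorb1)
  obtain k where k: "homeomorphic_maps (over P U) (over Q U) h k"
    using h homeomorphic_map_maps unfolding fibre_homeo_def by blast
  have fp: "fibre_preserving (over P U) h" using h by (simp add: fibre_homeo_def)
  have "k y \<in> topspace (over P U) \<and> h (k y) = y" if "y \<in> topspace (over Q U)" for y
    using k that continuous_map_image_subset_topspace unfolding homeomorphic_maps_def by blast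
  then have fk: "fst (k y) = fst y" if "y \<in> topspace (over Q U)" for y
    using fp that unfolding fibre_preserving_def by metis
  have "h ` (topspace (over P U) \<inter> V \<times> UNIV) \<subseteq> V \<times> UNIV"
    using fp by (intro image_subsetI) (simp add: fibre_preserving_def mem_Times_iff)
  moreover have "k ` (topspace (over Q U) \<inter> V \<times> UNIV) \<subseteq> V \<times> UNIV"
    using fk by (intro image_subsetI) (simp add: mem_Times_iff)
  ultimately have "homeomorphic_maps (over (over P U) V) (over (over Q U) V) h k"
    by (intro homeomorphic_maps_subtopologies_alt[OF k]) blast+
  then show ?thesis
    unfolding * fibre_homeo_def using fp assms(2)
    by (auto simp: homeomorphic_maps_map fibre_preserving_def mem_Times_iff)
qed

text \<open>If \<open>H\<close> is a homotopy from \<open>\<phi> \<circ> \<psi>\<close> to the identity over \<open>W\<close>, and \<open>\<phi> = l\<close> over \<open>V\<close>, then \<open>\<psi>\<close> is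
  joined to \<open>l\<^sup>-\<^sup>1\<close> over \<open>W \<inter> V\<close> by the maps \<open>l\<^sup>-\<^sup>1 \<circ> H\<^sub>t\<close>.\<close>

lemma fibre_right_invertible_glue:
  assumes nB: "normal_space B" and cP: "continuous_map P B fst" and cQ: "continuous_map Q B fst"
    and \<phi>: "continuous_map P Q \<phi>" "fibre_preserving P \<phi>"
    and W: "openin B W" "fibre_right_invertible (over P W) (over Q W) \<phi>"
    and A: "closedin B A" "A \<subseteq> W" and V: "openin B V"
    and l: "fibre_homeo (over P V) (over Q V) l"
    and \<phi>l: "\<And>p. p \<in> topspace P \<Longrightarrow> fst p \<in> V \<Longrightarrow> \<phi> p = l p"
  obtains W' where "openin B W'" "A \<union> V \<subseteq> W'" "fibre_right_invertible (over P W') (over Q W') \<phi>"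
proof -
  obtain \<psi> where \<psi>: "continuous_map (over Q W) (over P W) \<psi>" "fibre_preserving (over Q W) \<psi>"
     "fibre_homotopic (over Q W) (over Q W) (\<phi> \<circ> \<psi>) id"
    using W(2) unfolding fibre_right_invertible_def by blast
  then obtain K where K: "continuous_map (prod_topology (top_of_set {0..1::real}) (over Q W)) (over Q W) K"
     "\<And>x. x \<in> topspace Q \<Longrightarrow> fst x \<in> W \<Longrightarrow> K (0, x) = \<phi> (\<psi> x)"
     "\<And>x. x \<in> topspace Q \<Longrightarrow> fst x \<in> W \<Longrightarrow> K (1, x) = x"
     "\<And>t x. t\<in>{0..1} \<Longrightarrow> x \<in> topspace Q \<Longrightarrow> fst x \<in> W \<Longrightarrow> fst (K (t, x)) = fst x"
    unfolding fibre_homotopic_iff by (auto simp: mem_Times_iff)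
  obtain m where m: "fibre_homeo (over Q V) (over P V) m" "\<And>x. x \<in> topspace (over P V) \<Longrightarrow> m (l x) = x"
    "\<And>y. y \<in> topspace (over Q V) \<Longrightarrow> l (m y) = y"
    using fibre_homeo_inverse[OF l] by metis
  have VB: "V \<subseteq> topspace B" using V openin_subset by blast
  obtain s where s: "continuous_map B euclideanreal s"
     "\<And>x. x \<in> A \<Longrightarrow> s x = (0::real)" "\<And>x. x \<in> topspace B - W \<Longrightarrow> s x = 1"
  proof (rule Urysohn_real[OF nB A(1), of "topspace B - W"])
    show "closedin B (topspace B - W)" using W by blast
    show "disjnt A (topspace B - W)" using A by (auto simp: disjnt_iff)
  qed blast
  define \<tau> where "\<tau> b = max 0 (min 1 (3 * s b - 1))" for b
  have \<tau>: "continuous_map B (top_of_set {0..1}) \<tau>" unfolding \<tau>_def by (rule clamp_continuous[OF s(1)])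
  have \<tau>': "continuous_map B euclideanreal \<tau>" using \<tau> by (simp add: continuous_map_in_subtopology)
  have \<tau>01: "0 \<le> \<tau> b" "\<tau> b \<le> 1" for b by (auto simp: \<tau>_def)
  define Z where "Z = {b \<in> topspace B. s b < 1/3}"
  define Y where "Y = {b \<in> topspace B. 2/3 < s b}"
  have oZ: "openin B Z" and oY: "openin B Y" unfolding Z_def Y_def
    using continuous_map_upper_lower_semicontinuous_lt s(1) by metis+
  have ZW: "Z \<subseteq> W" using s(3) unfolding Z_def by force
  let ?X = "prod_topology (top_of_set {0..1::real}) Q"
  \<comment> \<open>\<open>H\<close> enters \<open>K\<close> at time \<tau>: over \<open>Z\<close>
    it begins with \<open>\<phi> \<circ> \<psi>\<close>, near and beyond the edge of
    \<open>W\<close> it is the identity, and it ends in the identity everywhere. So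
    \<open>H (0, _)\<close> is defined on all of \<open>Q\<close>, is fibre homotopic to the
    identity, and equals \<open>\<phi> \<circ> \<psi>\<close> over \<open>Z\<close>.\<close>
  define H where "H = (\<lambda>(t, p). if fst p \<in> W then K (max t (\<tau> (fst p)), p) else p)"
  have cfst: "continuous_map ?X B (\<lambda>x. fst (snd x))"
    using continuous_map_compose[OF continuous_map_snd cQ] by (simp add: o_def)
  have cH: "continuous_map ?X Q H"
  proof (rule continuous_map_paste2)
    let ?A = "{x \<in> topspace ?X. fst (snd x) \<in> W}"
    let ?B = "{x \<in> topspace ?X. fst (snd x) \<in> Y}"
    show "openin ?X ?A" "openin ?X ?B"
      using openin_continuous_map_preimage[OF cfst] W(1) oY by auto
    show "topspace ?X \<subseteq> ?A \<union> ?B"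
      using continuous_map_image_subset_topspace[OF cQ] s(3) by (fastforce simp: Y_def)
    show "continuous_map (subtopology ?X ?A) Q (K \<circ> (\<lambda>x. (max (fst x) (\<tau> (fst (snd x))), snd x)))"
    proof (rule continuous_map_compose)
      show "continuous_map (subtopology ?X ?A) (prod_topology (top_of_set {0..1}) (over Q W))
          (\<lambda>x. (max (fst x) (\<tau> (fst (snd x))), snd x))"
        unfolding continuous_map_pairwise o_def continuous_map_in_subtopology
      proof (intro conjI)
        have 1: "continuous_map ?X euclideanreal fst"
          using continuous_map_fst[of "top_of_set {0..1::real}" Q] by (simp add: continuous_map_in_subtopology)
        have 2: "continuous_map ?X euclideanreal (\<lambda>x. \<tau> (fst (snd x)))"
          using continuous_map_compose[OF cfst \<tau>'] by (simp add: o_def)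
        show "continuous_map (subtopology ?X ?A) euclideanreal (\<lambda>x. fst (max (fst x) (\<tau> (fst (snd x))), snd x))"
          using continuous_map_from_subtopology[OF continuous_map_real_max[OF 1 2]] by simp
      qed (use \<tau>01 in \<open>auto simp: continuous_map_from_subtopology continuous_map_snd max_def\<close>)
      show "continuous_map (prod_topology (top_of_set {0..1}) (over Q W)) Q K"
        using K(1) by (simp add: continuous_map_in_subtopology)
    qed
    show "continuous_map (subtopology ?X ?B) Q snd"
      by (intro continuous_map_from_subtopology continuous_map_snd)
    show "H x = snd x" if "x \<in> topspace ?X" "x \<in> ?B" for x
      using that K(3) by (auto simp: H_def Y_def \<tau>_def max_def split: prod.splits)
  qed (auto simp: H_def)
  have fH: "fst (H (t, q)) = fst q" if "t \<in> {0..1}" "q \<in> topspace Q" for t q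
    using that K(4) \<tau>01 by (auto simp: H_def max_def)
  have HQ: "H (t, q) \<in> topspace Q" if "t \<in> {0..1}" "q \<in> topspace Q" for t q
    using continuous_map_image_subset_topspace[OF cH] that by auto
  have H1: "H (1, q) = q" if "q \<in> topspace Q" for q
    using that K(3)[of q] \<tau>01[of "fst q"] by (cases "\<tau> (fst q) = 1") (auto simp: H_def max_def)
  have cH0: "continuous_map Q Q (\<lambda>q. H (0, q))"
    using continuous_map_o_Pair[OF cH, of 0] by (simp add: o_def)
  define W' where "W' = Z \<union> V"
  \<comment> \<open>Both branches lift \<open>H (0, _)\<close> through \<phi>: over \<open>V\<close>
    because there \<phi> is \<open>l\<close> with inverse \<open>m\<close>, over \<open>Z\<close>
    because there \<open>H (0, _)\<close> is \<open>\<phi> \<circ> \<psi>\<close>. Where both apply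
    they agree, since \<open>l\<close> is injective.\<close>
  define \<psi>' where "\<psi>' q = (if fst q \<in> V then m (H (0, q)) else \<psi> q)" for q
  have \<psi>in: "\<psi> q \<in> topspace P \<and> fst (\<psi> q) = fst q" if "q \<in> topspace Q" "fst q \<in> W" for q
    using continuous_map_image_subset_topspace[OF \<psi>(1)] \<psi>(2) that
    by (auto simp: fibre_preserving_def image_subset_iff mem_Times_iff)
  have min: "m q \<in> topspace P \<and> fst (m q) = fst q \<and> l (m q) = q" if "q \<in> topspace Q" "fst q \<in> V" for q
  proof -
    have q: "q \<in> topspace (over Q V)" using that by (simp add: mem_Times_iff)
    have "m q \<in> topspace (over P V)"
      using m(1) q homeomorphic_imp_surjective_map unfolding fibre_homeo_def by blast
    moreover have "fst (m q) = fst q" using m(1) q by (simp add: fibre_homeo_def fibre_preserving_def)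
    ultimately show ?thesis using m(3)[OF q] by simp
  qed
  have \<psi>eq: "m (H (0, q)) = \<psi> q" if "q \<in> topspace Q" "fst q \<in> V" "fst q \<in> Z" for q
  proof -
    have "fst q \<in> W" "\<tau> (fst q) = 0" using ZW that by (auto simp: Z_def \<tau>_def)
    then have "H (0, q) = l (\<psi> q)" using K(2)[of q] that \<phi>l[of "\<psi> q"] \<psi>in[of q] by (simp add: H_def)
    then show ?thesis using m(2)[of "\<psi> q"] \<psi>in[of q] that \<open>fst q \<in> W\<close> by (simp add: mem_Times_iff)
  qed
  have c\<psi>': "continuous_map (over Q W') P \<psi>'"
  proof (rule continuous_map_paste2)
    let ?A = "{q \<in> topspace (over Q W'). fst q \<in> V}"
    let ?B = "{q \<in> topspace (over Q W'). fst q \<in> Z}"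
    have cf: "continuous_map (over Q W') B fst" using cQ by (rule continuous_map_from_subtopology)
    show "openin (over Q W') ?A" "openin (over Q W') ?B"
      using openin_continuous_map_preimage[OF cf] V oZ by auto
    show "topspace (over Q W') \<subseteq> ?A \<union> ?B" by (auto simp: W'_def)
    have eqA: "subtopology (over Q W') ?A = over Q V"
      unfolding over_eq subtopology_subtopology by (rule arg_cong[where f = "subtopology Q"]) (auto simp: W'_def)
    have eqB: "subtopology (over Q W') ?B = over Q Z"
      unfolding over_eq subtopology_subtopology by (rule arg_cong[where f = "subtopology Q"]) (auto simp: W'_def)
    have "continuous_map (over Q V) (over Q V) (\<lambda>q. H (0, q))"
      unfolding continuous_map_in_subtopology using cH0 fH by (auto simp: continuous_map_from_subtopology mem_Times_iff)
    moreover have "continuous_map (over Q V) P m"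
      using m(1) homeomorphic_imp_continuous_map unfolding fibre_homeo_def by (metis continuous_map_in_subtopology)
    ultimately show "continuous_map (subtopology (over Q W') ?A) P (\<lambda>q. m (H (0, q)))"
      unfolding eqA using continuous_map_compose[of _ _ "\<lambda>q. H (0, q)" _ m] by (simp add: o_def)
    have "over (over Q W) Z = over Q Z" using ZW by (auto simp: subtopology_subtopology Times_Int_Times Int_absorb1)
    then show "continuous_map (subtopology (over Q W') ?B) P \<psi>"
      unfolding eqB using \<psi>(1) by (metis continuous_map_from_subtopology continuous_map_in_subtopology)
  qed (auto simp: \<psi>'_def \<psi>eq)
  have f\<psi>': "\<psi>' q \<in> topspace P \<and> fst (\<psi>' q) = fst q \<and> \<phi> (\<psi>' q) = H (0, q)" if "q \<in> topspace Q" "fst q \<in> W'" for q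
  proof (cases "fst q \<in> V")
    case True
    then show ?thesis using min[of "H (0, q)"] fH[of 0 q] HQ[of 0 q] that \<phi>l[of "m (H (0, q))"]
      by (simp add: \<psi>'_def)
  next
    case False
    then have "fst q \<in> Z" "fst q \<in> W" "\<tau> (fst q) = 0" using ZW that by (auto simp: W'_def Z_def \<tau>_def)
    then show ?thesis using False \<psi>in[of q] that K(2)[of q] by (simp add: \<psi>'_def H_def)
  qed
  have 1: "fibre_right_invertible (over P W') (over Q W') \<phi>"
    unfolding fibre_right_invertible_def
  proof (intro exI[of _ \<psi>'] conjI)
    show "continuous_map (over Q W') (over P W') \<psi>'"
      unfolding continuous_map_in_subtopology using c\<psi>' f\<psi>' by (auto simp: mem_Times_iff)
    show "fibre_preserving (over Q W') \<psi>'" using f\<psi>' by (auto simp: fibre_preserving_def)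
    have "fibre_homotopic Q Q (\<lambda>q. H (0, q)) id"
      unfolding fibre_homotopic_iff using cH fH H1 by (intro exI[of _ H]) auto
    then have "fibre_homotopic (over Q W') (over Q W') (\<lambda>q. H (0, q)) id"
      by (rule fibre_homotopic_over)
    then show "fibre_homotopic (over Q W') (over Q W') (\<phi> \<circ> \<psi>') id"
      by (rule homotopic_with_eq) (use f\<psi>' in \<open>auto intro!: fibre_preserving_cong\<close>)
  qed
  have 2: "A \<union> V \<subseteq> W'" using s(2) closedin_subset[OF A(1)] by (auto simp: W'_def Z_def)
  have 3: "openin B W'" using V oZ by (auto simp: W'_def)
  show ?thesis by (rule that[OF 3 2 1])
qed

definition locally_fibre_homeo ::
    "'l topology \<Rightarrow> ('l, 'w) total_space \<Rightarrow> ('l, 'v) total_space \<Rightarrow> ('l \<times> 'w \<Rightarrow> 'l \<times> 'v) \<Rightarrow> bool" where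
  "locally_fibre_homeo B P Q \<phi> \<longleftrightarrow>
     (\<forall>b\<in>topspace B. \<exists>U l. openin B U \<and> b \<in> U \<and> fibre_homeo (over P U) (over Q U) l \<and>
        fibre_homotopic (over P U) (over Q U) \<phi> l)"

text \<open>Induction over a finite cover by closed sets \<open>C b\<close>, each inside an open set
  with a local model. In each step \<phi> is first deformed to coincide with the model near the new
  closed set, so that the gluing applies; homotopy invariance leads back to \<phi>. The right
  inverse lives on an open neighbourhood of the closed sets treated so far, which leaves room for
  the next cut-off.\<close>

lemma locally_fibre_homeo_right_invertible:
  assumes cB: "compact_space B" and hB: "Hausdorff_space B"
    and cP: "continuous_map P B fst" and cQ: "continuous_map Q B fst"
    and \<phi>: "continuous_map P Q \<phi>" "fibre_preserving P \<phi>"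
    and loc: "locally_fibre_homeo B P Q \<phi>"
  shows "fibre_right_invertible P Q \<phi>"
proof -
  have nB: "normal_space B" using cB hB compact_Hausdorff_or_regular_imp_normal_space by blast
  have "\<exists>N C. openin B N \<and> b \<in> N \<and> N \<subseteq> C \<and> closedin B C \<and>
      (\<exists>U l. openin B U \<and> C \<subseteq> U \<and> fibre_homeo (over P U) (over Q U) l \<and>
        fibre_homotopic (over P U) (over Q U) \<phi> l)" if b: "b \<in> topspace B" for b
  proof -
    obtain U l where U: "openin B U" "b \<in> U" "fibre_homeo (over P U) (over Q U) l"
        "fibre_homotopic (over P U) (over Q U) \<phi> l"
      using loc b unfolding locally_fibre_homeo_def by blast
    have "regular_space B" using cB hB compact_Hausdorff_imp_regular_space by blast
    then have "neighbourhood_base_of (closedin B) B" by (simp add: neighbourhood_base_of_closedin)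
    then have "\<exists>N C. openin B N \<and> closedin B C \<and> b \<in> N \<and> N \<subseteq> C \<and> C \<subseteq> U"
      using U(1,2) unfolding neighbourhood_base_of by blast
    then obtain N C where "openin B N" "closedin B C" "b \<in> N" "N \<subseteq> C" "C \<subseteq> U"
      by blast
    then show ?thesis using U by blast
  qed
  then obtain N C where NC: "\<And>b. b \<in> topspace B \<Longrightarrow> openin B (N b) \<and> b \<in> N b \<and> N b \<subseteq> C b \<and> closedin B (C b) \<and>
      (\<exists>U l. openin B U \<and> C b \<subseteq> U \<and> fibre_homeo (over P U) (over Q U) l \<and>
        fibre_homotopic (over P U) (over Q U) \<phi> l)"
    by metis
  obtain F where F: "finite F" "F \<subseteq> topspace B" "topspace B \<subseteq> (\<Union>b\<in>F. N b)"
  proof -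
    have "compactin B (topspace B)" using cB by (simp add: compact_space_def)
    then have "\<exists>F. finite F \<and> F \<subseteq> N ` topspace B \<and> topspace B \<subseteq> \<Union>F"
      by (rule compactinD) (use NC in blast)+
    then show ?thesis using that by (metis finite_subset_image)
  qed
  have "\<exists>W. openin B W \<and> (\<Union>b\<in>G. C b) \<subseteq> W \<and> fibre_right_invertible (over P W) (over Q W) \<phi>"
    if "finite G" "G \<subseteq> topspace B" for G
    using that
  proof (induction G)
    case empty
    \<comment> \<open>The bundles have no points over the empty set, so any map will do.\<close>
    have "fibre_right_invertible (over P {}) (over Q {}) \<phi>"
      unfolding fibre_right_invertible_def fibre_homotopic_iff
      by (rule exI[of _ undefined]) (auto simp: continuous_map_on_empty fibre_preserving_def intro!: exI)
    then show ?case by (intro exI[of _ "{}"]) auto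
  next
    case (insert b G)
    then obtain W where W: "openin B W" "(\<Union>b\<in>G. C b) \<subseteq> W" "fibre_right_invertible (over P W) (over Q W) \<phi>"
      by auto
    obtain U l where U: "openin B U" "C b \<subseteq> U" "fibre_homeo (over P U) (over Q U) l"
        "fibre_homotopic (over P U) (over Q U) \<phi> l" and Cb: "closedin B (C b)"
      using NC[of b] insert.prems by blast
    obtain \<phi>' V where V: "fibre_homotopic P Q \<phi> \<phi>'" "openin B V" "C b \<subseteq> V" "V \<subseteq> U"
      "\<And>p. p \<in> topspace P \<Longrightarrow> fst p \<in> V \<Longrightarrow> \<phi>' p = l p"
      using homotopy_to_local_model[OF nB cP \<phi> U(1) Cb U(2,4)] by metis
    have s: "fibre_homotopic P Q \<phi>' \<phi>" using V(1) by (simp add: homotopic_with_sym)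
    have \<phi>': "continuous_map P Q \<phi>'" "fibre_preserving P \<phi>'"
      using homotopic_with_imp_continuous_maps[OF V(1)] homotopic_with_imp_property[OF V(1)] by auto
    have W': "fibre_right_invertible (over P W) (over Q W) \<phi>'"
      using fibre_right_invertible_homotopic[OF W(3) fibre_homotopic_over[OF s]] .
    have cG: "closedin B (\<Union>b\<in>G. C b)" using insert NC by (intro closedin_Union) auto
    obtain W'' where W'': "openin B W''" "(\<Union>b\<in>G. C b) \<union> V \<subseteq> W''" "fibre_right_invertible (over P W'') (over Q W'') \<phi>'"
      using fibre_right_invertible_glue[OF nB cP cQ \<phi>' W(1) W' cG W(2) V(2) fibre_homeo_over[OF U(3) V(4)] V(5)]
      by blast
    have "fibre_right_invertible (over P W'') (over Q W'') \<phi>"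
      using fibre_right_invertible_homotopic[OF W''(3) fibre_homotopic_over[OF V(1)]] .
    moreover have "(\<Union>b\<in>insert b G. C b) \<subseteq> W''" using V(3) W''(2) by blast
    ultimately show ?case using W''(1) by blast
  qed
  from this[OF F(1,2)] obtain W where W: "openin B W" "(\<Union>b\<in>F. C b) \<subseteq> W" "fibre_right_invertible (over P W) (over Q W) \<phi>"
    by blast
  have "N b \<subseteq> C b" if "b \<in> F" for b using NC[of b] F(2) that by blast
  then have "(\<Union>b\<in>F. N b) \<subseteq> (\<Union>b\<in>F. C b)" by (intro UN_mono) auto
  then have "topspace B \<subseteq> W" using W(2) F(3) by (meson order_trans)
  then have "W = topspace B" using openin_subset[OF W(1)] by simp
  then have "over P W = P" "over Q W = Q"
    using continuous_map_image_subset_topspace[OF cP] continuous_map_image_subset_topspace[OF cQ]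
    by (auto intro!: subtopology_superset simp: mem_Times_iff image_subset_iff)
  then show ?thesis using W(3) by simp
qed

text \<open>Let \<open>\<psi>\<close> be a right inverse and \<open>m\<close> the inverse of a local
  model \<open>l\<close>. Over \<open>U\<close> the map
  \<open>m \<circ> \<phi> \<circ> \<psi>\<close> is homotopic to \<open>m\<close>, and also to
  \<open>m \<circ> l \<circ> \<psi>\<close>, which is \<open>\<psi>\<close>. So
  \<open>\<psi>\<close> is locally homotopic to homeomorphisms and has a right inverse
  \<open>\<omega>\<close>. Then \<phi> is homotopic to
  \<open>\<phi> \<circ> \<psi> \<circ> \<omega>\<close>, hence to \<omega>, and
  \<open>\<psi> \<circ> \<phi>\<close> to \<open>\<psi> \<circ> \<omega>\<close>, hence to the
  identity.\<close>

theorem locally_fibre_homeo_imp_equivalence: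
  assumes cB: "compact_space B" and hB: "Hausdorff_space B"
    and cP: "continuous_map P B fst" and cQ: "continuous_map Q B fst"
    and \<phi>: "continuous_map P Q \<phi>" "fibre_preserving P \<phi>"
    and loc: "locally_fibre_homeo B P Q \<phi>"
  shows "fibre_homotopy_equivalent P Q"
proof -
  obtain \<psi> where \<psi>: "continuous_map Q P \<psi>" "fibre_preserving Q \<psi>" "fibre_homotopic Q Q (\<phi> \<circ> \<psi>) id"
    using locally_fibre_homeo_right_invertible[OF assms] unfolding fibre_right_invertible_def by blast
  have "locally_fibre_homeo B Q P \<psi>"
    unfolding locally_fibre_homeo_def
  proof
    fix b assume "b \<in> topspace B"
    then obtain U l where U: "openin B U" "b \<in> U" "fibre_homeo (over P U) (over Q U) l"
        "fibre_homotopic (over P U) (over Q U) \<phi> l"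
      using loc unfolding locally_fibre_homeo_def by blast
    obtain m where m: "fibre_homeo (over Q U) (over P U) m" "\<And>x. x \<in> topspace (over P U) \<Longrightarrow> m (l x) = x"
      using fibre_homeo_inverse[OF U(3)] by metis
    have cm: "continuous_map (over Q U) (over P U) m" "fibre_preserving (over Q U) m"
      using m(1) homeomorphic_imp_continuous_map by (auto simp: fibre_homeo_def)
    have c\<psi>: "continuous_map (over Q U) (over P U) \<psi>" "fibre_preserving (over Q U) \<psi>"
      using \<psi>(1,2) continuous_map_image_subset_topspace[OF \<psi>(1)]
      by (auto simp: continuous_map_in_subtopology continuous_map_from_subtopology fibre_preserving_def mem_Times_iff)
    have 1: "fibre_homotopic (over Q U) (over P U) (m \<circ> (\<phi> \<circ> \<psi>)) (m \<circ> id)"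
      using fibre_homotopic_compose_left[OF fibre_homotopic_over[OF \<psi>(3)] cm] .
    have 2: "fibre_homotopic (over Q U) (over P U) ((m \<circ> \<phi>) \<circ> \<psi>) ((m \<circ> l) \<circ> \<psi>)"
      using fibre_homotopic_compose_right[OF fibre_homotopic_compose_left[OF U(4) cm] c\<psi>] .
    have 3: "fibre_homotopic (over Q U) (over P U) ((m \<circ> \<phi>) \<circ> \<psi>) \<psi>"
      using 2 by (rule homotopic_with_eq)
        (use m(2) continuous_map_image_subset_topspace[OF c\<psi>(1)] in \<open>force intro!: fibre_preserving_cong\<close>)+
    have "fibre_homotopic (over Q U) (over P U) \<psi> m"
      using homotopic_with_trans[OF homotopic_with_symD[OF 3]] 1 by (simp add: o_assoc)
    then show "\<exists>U l. openin B U \<and> b \<in> U \<and> fibre_homeo (over Q U) (over P U) l \<and> fibre_homotopic (over Q U) (over P U) \<psi> l"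
      using U m by blast
  qed
  then obtain \<omega> where \<omega>: "continuous_map P Q \<omega>" "fibre_preserving P \<omega>" "fibre_homotopic P P (\<psi> \<circ> \<omega>) id"
    using locally_fibre_homeo_right_invertible[OF cB hB cQ cP \<psi>(1,2)] unfolding fibre_right_invertible_def by blast
  have 1: "fibre_homotopic P Q (\<phi> \<circ> (\<psi> \<circ> \<omega>)) (\<phi> \<circ> id)"
    using fibre_homotopic_compose_left[OF \<omega>(3) \<phi>] .
  have 2: "fibre_homotopic P Q ((\<phi> \<circ> \<psi>) \<circ> \<omega>) (id \<circ> \<omega>)"
    using fibre_homotopic_compose_right[OF \<psi>(3) \<omega>(1,2)] .
  have "fibre_homotopic P Q \<phi> \<omega>"
    using homotopic_with_trans[OF homotopic_with_symD[OF 1]] 2 by (simp add: o_assoc)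
  then have "fibre_homotopic P P (\<psi> \<circ> \<phi>) id"
    using homotopic_with_trans[OF fibre_homotopic_compose_left[OF _ \<psi>(1,2)] \<omega>(3)] by blast
  then show ?thesis unfolding fibre_homotopy_equivalent_def using \<phi> \<psi> by blast
qed

section \<open>The Grothendieck group of a commutative monoid\<close>

context comm_monoid begin

lemma grothendieck_rel_iff:
  "((a, b), (c, d)) \<in> grothendieck_rel G \<longleftrightarrow>
     a \<in> carrier G \<and> b \<in> carrier G \<and> c \<in> carrier G \<and> d \<in> carrier G \<and>
     (\<exists>k\<in>carrier G. a \<otimes> d \<otimes> k = c \<otimes> b \<otimes> k)"
  by (simp add: grothendieck_rel_def)

lemma equiv_grothendieck_rel: "equiv (carrier G \<times> carrier G) (grothendieck_rel G)"
proof (rule equivI)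
  show "grothendieck_rel G \<subseteq> (carrier G \<times> carrier G) \<times> (carrier G \<times> carrier G)"
    by (auto simp: grothendieck_rel_def)
  show "refl_on (carrier G \<times> carrier G) (grothendieck_rel G)"
    by (rule refl_onI) (auto simp: grothendieck_rel_def)
  show "sym (grothendieck_rel G)"
    by (rule symI) (auto simp: grothendieck_rel_def intro: sym)
  show "trans (grothendieck_rel G)"
  proof (rule transI)
    fix p q r assume pq: "(p, q) \<in> grothendieck_rel G" "(q, r) \<in> grothendieck_rel G"
    obtain a b c d e f where e: "p = (a, b)" "q = (c, d)" "r = (e, f)" by (metis prod.exhaust)
    obtain k k' where c: "a \<in> carrier G" "b \<in> carrier G" "c \<in> carrier G" "d \<in> carrier G" "e \<in> carrier G" "f \<in> carrier G"
        "k \<in> carrier G" "k' \<in> carrier G"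
      and k: "a \<otimes> d \<otimes> k = c \<otimes> b \<otimes> k" and k': "c \<otimes> f \<otimes> k' = e \<otimes> d \<otimes> k'"
      using pq by (auto simp: e grothendieck_rel_iff)
    \<comment> \<open>The monoid need not be cancellative, so the middle entry \<open>d\<close>
      cannot be removed; it joins the stabilizing factor.\<close>
    let ?k = "d \<otimes> k \<otimes> k'"
    have "a \<otimes> f \<otimes> ?k = (a \<otimes> d \<otimes> k) \<otimes> (f \<otimes> k')" using c by (simp add: m_ac)
    also have "\<dots> = (c \<otimes> f \<otimes> k') \<otimes> (b \<otimes> k)" unfolding k using c by (simp add: m_ac)
    also have "\<dots> = e \<otimes> b \<otimes> ?k" unfolding k' using c by (simp add: m_ac)
    finally show "(p, r) \<in> grothendieck_rel G"
      using c by (auto simp: e grothendieck_rel_iff intro!: bexI[of _ ?k])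
  qed
qed

lemma formal_diff_eq_iff:
  assumes "a \<in> carrier G" "b \<in> carrier G" "c \<in> carrier G" "d \<in> carrier G"
  shows "formal_diff G a b = formal_diff G c d \<longleftrightarrow> ((a, b), (c, d)) \<in> grothendieck_rel G"
  unfolding formal_diff_def using eq_equiv_class_iff[OF equiv_grothendieck_rel, of "(a, b)" "(c, d)"] assms by simp

lemma formal_diff_in_carrier:
  "a \<in> carrier G \<Longrightarrow> b \<in> carrier G \<Longrightarrow> formal_diff G a b \<in> carrier (grothendieck_group G)"
  by (simp add: grothendieck_group_def formal_diff_def quotientI)

lemma grothendieck_group_carrierE:
  assumes "p \<in> carrier (grothendieck_group G)"
  obtains a b where "a \<in> carrier G" "b \<in> carrier G" "p = formal_diff G a b"
  using assms by (auto simp: grothendieck_group_def formal_diff_def elim!: quotientE)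

text \<open>The product is a union over all pairs of representatives. All pairs yield the same class
  and the classes are non-empty, so the union collapses to that class.\<close>

lemma formal_diff_mult:
  assumes "a \<in> carrier G" "b \<in> carrier G" "c \<in> carrier G" "d \<in> carrier G"
  shows "formal_diff G a b \<otimes>\<^bsub>grothendieck_group G\<^esub> formal_diff G c d = formal_diff G (a \<otimes> c) (b \<otimes> d)"
proof -
  have *: "formal_diff G (a' \<otimes> c') (b' \<otimes> d') = formal_diff G (a \<otimes> c) (b \<otimes> d)"
    if p: "(a', b') \<in> formal_diff G a b" and q: "(c', d') \<in> formal_diff G c d" for a' b' c' d'
  proof -
    obtain k k' where c: "a' \<in> carrier G" "b' \<in> carrier G" "c' \<in> carrier G" "d' \<in> carrier G"
        "k \<in> carrier G" "k' \<in> carrier G"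
      and k: "a \<otimes> b' \<otimes> k = a' \<otimes> b \<otimes> k" and k': "c \<otimes> d' \<otimes> k' = c' \<otimes> d \<otimes> k'"
      using p q by (auto simp: formal_diff_def grothendieck_rel_iff)
    have "(a \<otimes> c) \<otimes> (b' \<otimes> d') \<otimes> (k \<otimes> k') = (a \<otimes> b' \<otimes> k) \<otimes> (c \<otimes> d' \<otimes> k')"
      using c assms by (simp add: m_ac)
    also have "\<dots> = (a' \<otimes> c') \<otimes> (b \<otimes> d) \<otimes> (k \<otimes> k')"
      unfolding k k' using c assms by (simp add: m_ac)
    finally have "((a \<otimes> c, b \<otimes> d), (a' \<otimes> c', b' \<otimes> d')) \<in> grothendieck_rel G"
      using c assms by (auto simp: grothendieck_rel_iff intro!: bexI[of _ "k \<otimes> k'"])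
    then show ?thesis using c assms by (subst eq_commute, subst formal_diff_eq_iff) auto
  qed
  have mem: "(a, b) \<in> formal_diff G a b" "(c, d) \<in> formal_diff G c d"
    using assms by (auto simp: formal_diff_def grothendieck_rel_iff)
  let ?f = "\<lambda>p q. formal_diff G (fst p \<otimes> fst q) (snd p \<otimes> snd q)"
  have all: "?f p q = formal_diff G (a \<otimes> c) (b \<otimes> d)"
    if "p \<in> formal_diff G a b" "q \<in> formal_diff G c d" for p q
    using *[of "fst p" "snd p" "fst q" "snd q"] that by simp
  have "(\<Union>p\<in>formal_diff G a b. \<Union>q\<in>formal_diff G c d. ?f p q)
      = (\<Union>p\<in>formal_diff G a b. \<Union>q\<in>formal_diff G c d. formal_diff G (a \<otimes> c) (b \<otimes> d))"
    by (intro SUP_cong refl all)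
  also have "\<dots> = formal_diff G (a \<otimes> c) (b \<otimes> d)"
  proof -
    have "formal_diff G a b \<noteq> {}" "formal_diff G c d \<noteq> {}" using mem by (metis empty_iff)+
    then show ?thesis by (simp only: UN_constant if_False)
  qed
  finally show ?thesis by (simp add: grothendieck_group_def case_prod_beta)
qed

lemma comm_group_grothendieck_group: "comm_group (grothendieck_group G)"
proof (rule comm_groupI)
  let ?K = "grothendieck_group G"
  have one: "\<one>\<^bsub>?K\<^esub> = formal_diff G \<one> \<one>" by (simp add: grothendieck_group_def)
  show "\<one>\<^bsub>?K\<^esub> \<in> carrier ?K" unfolding one by (simp add: formal_diff_in_carrier)
  fix x assume "x \<in> carrier ?K"
  then obtain a b where x: "a \<in> carrier G" "b \<in> carrier G" "x = formal_diff G a b"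
    by (rule grothendieck_group_carrierE)
  show "\<one>\<^bsub>?K\<^esub> \<otimes>\<^bsub>?K\<^esub> x = x" using x by (simp add: one formal_diff_mult)
  show "\<exists>y\<in>carrier ?K. y \<otimes>\<^bsub>?K\<^esub> x = \<one>\<^bsub>?K\<^esub>"
  proof (rule bexI[of _ "formal_diff G b a"])
    have "formal_diff G (b \<otimes> a) (a \<otimes> b) = formal_diff G \<one> \<one>"
      using x(1,2) by (subst formal_diff_eq_iff) (auto simp: grothendieck_rel_iff m_ac intro!: bexI[of _ \<one>])
    then show "formal_diff G b a \<otimes>\<^bsub>?K\<^esub> x = \<one>\<^bsub>?K\<^esub>" using x by (simp add: one formal_diff_mult)
  qed (use x in \<open>simp add: formal_diff_in_carrier\<close>)
  fix y assume "y \<in> carrier ?K"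
  then obtain c d where y: "c \<in> carrier G" "d \<in> carrier G" "y = formal_diff G c d"
    by (rule grothendieck_group_carrierE)
  show "x \<otimes>\<^bsub>?K\<^esub> y \<in> carrier ?K" using x y by (simp add: formal_diff_mult formal_diff_in_carrier)
  show "x \<otimes>\<^bsub>?K\<^esub> y = y \<otimes>\<^bsub>?K\<^esub> x" using x y by (simp add: formal_diff_mult m_comm)
  fix z assume "z \<in> carrier ?K"
  then obtain e f where z: "e \<in> carrier G" "f \<in> carrier G" "z = formal_diff G e f"
    by (rule grothendieck_group_carrierE)
  show "x \<otimes>\<^bsub>?K\<^esub> y \<otimes>\<^bsub>?K\<^esub> z = x \<otimes>\<^bsub>?K\<^esub> (y \<otimes>\<^bsub>?K\<^esub> z)" using x y z by (simp add: formal_diff_mult m_assoc)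
qed

end

section \<open>Bounded inverses and finite rank corrections\<close>

text \<open>First half of the open mapping theorem. By Baire's theorem the closure of the image of
  some ball has interior; differences of its points fill a ball about 0, and scaling gives
  solvability up to an error of half the norm.\<close>

lemma approximately_onto:
  fixes T :: "'x::banach \<Rightarrow>\<^sub>L 'y::banach"
  assumes "surj (blinfun_apply T)"
  obtains C where "0 \<le> C" "\<And>y. \<exists>x. norm x \<le> C * norm y \<and> norm (y - T x) \<le> norm y / 2"
proof -
  define A where "A n = closure (blinfun_apply T ` ball 0 (real n))" for n
  have un: "(\<Union>n. A n) = UNIV"
  proof -
    have "y \<in> (\<Union>n. A n)" for y
    proof -
      obtain x where "y = T x" using assms by blast
      moreover obtain n where "norm x < real n" using reals_Archimedean2 by blast
      ultimately have "y \<in> A n" unfolding A_def by (intro closure_subset[THEN subsetD]) auto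
      then show ?thesis by blast
    qed
    then show ?thesis by blast
  qed
  have "\<exists>n. interior (A n) \<noteq> {}"
  proof (rule ccontr)
    assume "\<nexists>n. interior (A n) \<noteq> {}"
    then have "Met_TC.mtopology interior_of \<Union>(range A) = {}"
      by (intro Met_TC.metric_Baire_category_alt)
         (auto simp: Met_TC.mcomplete_def A_def mtopology_is_euclidean complete_UNIV)
    then show False using un by (simp add: )
  qed
  then obtain n y0 r where r: "r > 0" "ball y0 r \<subseteq> A n"
    by (metis equals0I open_contains_ball open_interior interior_subset order_trans)
  \<comment> \<open>\<open>z\<close> is the difference of \<open>y0 + z\<close> and
    \<open>y0\<close>. Each is approximated within \<open>r/8\<close> by the image of a vector of
    norm below \<open>n\<close>; hence the error \<open>r/4\<close> and the factor 2.\<close>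
  have half: "\<exists>x. norm x \<le> 2 * real n \<and> norm (z - T x) \<le> r / 4" if z: "norm z < r" for z
  proof -
    have "y0 \<in> A n" "y0 + z \<in> A n" using r z by (auto simp: subset_iff dist_norm)
    then obtain y1 y2 where "y1 \<in> T ` ball 0 (real n)" "dist y1 y0 < r/8"
       "y2 \<in> T ` ball 0 (real n)" "dist y2 (y0 + z) < r/8"
      unfolding A_def closure_approachable using r(1) by (metis divide_pos_pos zero_less_numeral)
    then obtain x1 x2 where x: "norm x1 < real n" "norm x2 < real n" "dist (T x1) y0 < r/8" "dist (T x2) (y0 + z) < r/8"
      by auto
    have "z - T (x2 - x1) = (T x1 - y0) + ((y0 + z) - T x2)" by (simp add: blinfun.diff_right)
    then have "norm (z - T (x2 - x1)) \<le> dist (T x1) y0 + dist (T x2) (y0 + z)"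
      using norm_triangle_ineq[of "T x1 - y0" "(y0 + z) - T x2"]
      by (simp only: dist_norm norm_minus_commute[of "T x2"])
    moreover have "norm (x2 - x1) \<le> 2 * real n" using norm_triangle_ineq4[of x2 x1] x by simp
    ultimately show ?thesis using x by (intro exI[of _ "x2 - x1"]) auto
  qed
  show ?thesis
  proof (rule that[of "4 * real n / r"])
    show "0 \<le> 4 * real n / r" using r by simp
    show "\<exists>x. norm x \<le> 4 * real n / r * norm y \<and> norm (y - T x) \<le> norm y / 2" for y
    proof (cases "y = 0")
      case True then show ?thesis by (intro exI[of _ 0]) auto
    next
      case False
      \<comment> \<open>\<open>y\<close> is scaled to norm \<open>r/2\<close>, which is below
        \<open>r\<close>; scaling back turns the error \<open>r/4\<close> into
        \<open>norm y / 2\<close>.\<close>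
      define s where "s = r / (2 * norm y)"
      have s: "s > 0" using False r by (simp add: s_def)
      have "norm (s *\<^sub>R y) < r" using False r by (simp add: s_def)
      from half[OF this] obtain x where x: "norm x \<le> 2 * real n" "norm (s *\<^sub>R y - T x) \<le> r / 4" by blast
      have "s *\<^sub>R (y - T (x /\<^sub>R s)) = s *\<^sub>R y - T x"
        using s by (simp add: blinfun.scaleR_right scaleR_diff_right)
      then have "s * norm (y - T (x /\<^sub>R s)) \<le> r / 4" using x(2) s
        by (metis abs_of_pos norm_scaleR)
      then have "norm (y - T (x /\<^sub>R s)) \<le> r / 4 / s" using s by (simp add: field_simps)
      moreover have "r / 4 / s = norm y / 2" using r False by (simp add: s_def field_simps)
      moreover have "norm (x /\<^sub>R s) \<le> 4 * real n / r * norm y"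
      proof -
        have "norm (x /\<^sub>R s) = norm x / s" using s by (simp add: divide_inverse mult.commute)
        also have "\<dots> \<le> 2 * real n / s" using x s by (intro divide_right_mono) auto
        also have "\<dots> = 4 * real n / r * norm y" using r False by (simp add: s_def field_simps)
        finally show ?thesis .
      qed
      ultimately have "norm (y - T (x /\<^sub>R s)) \<le> norm y / 2" "norm (x /\<^sub>R s) \<le> 4 * real n / r * norm y"
        by linarith+
      then show ?thesis by blast
    qed
  qed
qed

text \<open>Second half: the error is corrected again and again. The remainders \<open>Y k\<close>
  decrease like \<open>(1/2) ^ k\<close>, so by completeness the corrections \<open>g (Y k)\<close>
  sum to an exact preimage, and the geometric series costs the factor 2.\<close>

lemma bounded_preimages:
  fixes T :: "'x::banach \<Rightarrow>\<^sub>L 'y::banach"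
  assumes "surj (blinfun_apply T)"
  obtains C where "0 \<le> C" "\<And>y. \<exists>x. T x = y \<and> norm x \<le> C * norm y"
proof -
  obtain C where C: "0 \<le> C" "\<And>y. \<exists>x. norm x \<le> C * norm y \<and> norm (y - T x) \<le> norm y / 2"
    using approximately_onto[OF assms] by blast
  then obtain g where g: "\<And>y. norm (g y) \<le> C * norm y" "\<And>y. norm (y - T (g y)) \<le> norm y / 2"
    by metis
  show ?thesis
  proof (rule that[of "2 * C"])
    show "0 \<le> 2 * C" using C by simp
    fix y :: 'y
    define Y where "Y k = ((\<lambda>y. y - T (g y)) ^^ k) y" for k
    have Y0: "Y 0 = y" and YS: "Y (Suc k) = Y k - T (g (Y k))" for k by (simp_all add: Y_def)
    have nY: "norm (Y k) \<le> norm y * (1/2) ^ k" for k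
    proof (induction k)
      case (Suc k) then show ?case using g(2)[of "Y k"] by (simp add: YS)
    qed (simp add: Y0)
    have ng: "norm (g (Y k)) \<le> C * norm y * (1/2) ^ k" for k
      using order_trans[OF g(1)[of "Y k"] mult_left_mono[OF nY C(1)]] by (simp add: mult.assoc)
    have sgeo: "(\<lambda>k. C * norm y * (1/2) ^ k) sums (C * norm y * 2)"
      using sums_mult[OF geometric_sums[of "1/2::real"]] by simp
    have sg: "summable (\<lambda>k. g (Y k))"
      by (rule summable_comparison_test'[OF sums_summable[OF sgeo], of 0]) (use ng in simp)
    have "Y \<longlonglongrightarrow> 0"
    proof (rule Lim_null_comparison)
      show "\<forall>\<^sub>F k in sequentially. norm (Y k) \<le> norm y * (1/2) ^ k" using nY by simp
      show "(\<lambda>k. norm y * (1/2) ^ k) \<longlonglongrightarrow> 0"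
        by (intro tendsto_mult_right_zero LIMSEQ_power_zero) simp
    qed
    then have "(\<lambda>k. Y k - Y (Suc k)) sums (Y 0 - 0)" by (rule telescope_sums')
    moreover have "(\<lambda>k. T (g (Y k))) sums T (\<Sum>k. g (Y k))"
      using bounded_linear.sums[OF blinfun.bounded_linear_right summable_sums[OF sg]] .
    ultimately have "T (\<Sum>k. g (Y k)) = y" by (simp add: YS Y0 sums_unique2)
    moreover have "norm (\<Sum>k. g (Y k)) \<le> 2 * C * norm y"
    proof -
      have "summable (\<lambda>k. norm (g (Y k)))"
        by (rule summable_comparison_test'[OF sums_summable[OF sgeo], of 0]) (use ng in simp)
      then have "norm (\<Sum>k. g (Y k)) \<le> (\<Sum>k. norm (g (Y k)))" by (rule summable_norm)
      also have "\<dots> \<le> C * norm y * 2"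
        using suminf_le[OF ng] \<open>summable (\<lambda>k. norm (g (Y k)))\<close> sums_summable[OF sgeo] sums_unique[OF sgeo] by simp
      finally show ?thesis by simp
    qed
    ultimately show "\<exists>x. T x = y \<and> norm x \<le> 2 * C * norm y" by blast
  qed
qed

section \<open>Inverses of bijective operators: stability and continuity\<close>

text \<open>Meaningful only for bijective operators between Banach spaces.\<close>

definition binv :: "('x::real_normed_vector \<Rightarrow>\<^sub>L 'y::real_normed_vector) \<Rightarrow> 'y \<Rightarrow>\<^sub>L 'x" where
  "binv T = Blinfun (inv_into UNIV (blinfun_apply T))"

lemma binv_apply:
  fixes T :: "'x::banach \<Rightarrow>\<^sub>L 'y::banach"
  assumes T: "bij (blinfun_apply T)"
  shows "blinfun_apply (binv T) = inv_into UNIV (blinfun_apply T)"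
proof -
  obtain C where C: "\<And>y. \<exists>x. T x = y \<and> norm x \<le> C * norm y"
    using bounded_preimages[of T] bij_is_surj[OF T] by metis
  let ?S = "inv_into UNIV (blinfun_apply T)"
  have TS: "T (?S y) = y" for y using T by (simp add: bij_is_surj surj_f_inv_f)
  have ST: "?S (T x) = x" for x using T by (simp add: bij_is_inj)
  have "bounded_linear ?S"
  proof
    show "?S (x + y) = ?S x + ?S y" for x y
      using ST[of "?S x + ?S y"] by (simp add: blinfun.add_right TS)
    show "?S (r *\<^sub>R x) = r *\<^sub>R ?S x" for r x
      using ST[of "r *\<^sub>R ?S x"] by (simp add: blinfun.scaleR_right TS)
    have "norm (?S y) \<le> norm y * C" for y using C[of y] ST by (auto simp: mult.commute)
    then show "\<exists>K. \<forall>x. norm (?S x) \<le> norm x * K" by blast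
  qed
  then show ?thesis unfolding binv_def by (rule bounded_linear_Blinfun_apply)
qed

lemma binv:
  fixes T :: "'x::banach \<Rightarrow>\<^sub>L 'y::banach"
  assumes T: "bij (blinfun_apply T)"
  shows "T (binv T y) = y" "binv T (T x) = x"
  using T by (simp_all add: binv_apply bij_is_surj surj_f_inv_f bij_is_inj)

text \<open>\<open>T' x = y\<close> is equivalent to the fixed point equation
  \<open>x = binv T (y - (T' - T) x)\<close>, and closeness makes its right side a contraction in
  \<open>x\<close>. Unique solvability for every \<open>y\<close> is bijectivity.\<close>

lemma bij_perturb:
  fixes T T' :: "'x::banach \<Rightarrow>\<^sub>L 'y::banach"
  assumes T: "bij (blinfun_apply T)" and close: "norm (binv T) * norm (T' - T) < 1"
  shows "bij (blinfun_apply T')"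
proof -
  have *: "\<exists>!x. T' x = y" for y
  proof -
    let ?c = "norm (binv T) * norm (T' - T)"
    have "\<exists>!x. (\<lambda>x. binv T (y - (T' - T) x)) x = x"
    proof (rule banach_fix_type)
      show "0 \<le> ?c" by simp
      show "?c < 1" by (fact close)
      show "\<forall>x z. dist (binv T (y - (T' - T) x)) (binv T (y - (T' - T) z)) \<le> ?c * dist x z"
      proof (intro allI)
        fix x z
        have "(y - (T' - T) x) - (y - (T' - T) z) = (T' - T) (z - x)" by (simp add: blinfun.diff_right)
        then have "binv T (y - (T' - T) x) - binv T (y - (T' - T) z) = binv T ((T' - T) (z - x))"
          by (metis blinfun.diff_right)
        then have "dist (binv T (y - (T' - T) x)) (binv T (y - (T' - T) z)) = norm (binv T ((T' - T) (z - x)))"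
          by (simp add: dist_norm)
        also have "\<dots> \<le> norm (binv T) * (norm (T' - T) * norm (z - x))"
          by (meson mult_left_mono norm_blinfun norm_ge_zero order_trans)
        finally show "dist (binv T (y - (T' - T) x)) (binv T (y - (T' - T) z)) \<le> ?c * dist x z"
          by (simp add: dist_norm norm_minus_commute mult.assoc)
      qed
    qed
    moreover have "binv T (y - (T' - T) x) = x \<longleftrightarrow> T' x = y" for x
    proof
      assume "binv T (y - (T' - T) x) = x"
      then have "y - (T' - T) x = T x" using binv(1)[OF T] by metis
      then show "T' x = y" by (simp add: blinfun.diff_left algebra_simps)
    next
      assume "T' x = y"
      then have "y - (T' - T) x = T x" by (simp add: blinfun.diff_left algebra_simps)
      then show "binv T (y - (T' - T) x) = x" using binv(2)[OF T] by simp
    qed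
    ultimately show ?thesis by simp
  qed
  then show ?thesis unfolding bij_iff by simp
qed

lemma open_bij_blinfun: "open {T :: 'x::banach \<Rightarrow>\<^sub>L 'y::banach. bij (blinfun_apply T)}"
  unfolding open_dist
proof (intro ballI)
  fix T :: "'x \<Rightarrow>\<^sub>L 'y" assume "T \<in> {T. bij (blinfun_apply T)}"
  then have T: "bij (blinfun_apply T)" by simp
  show "\<exists>e>0. \<forall>T'. dist T' T < e \<longrightarrow> T' \<in> {T. bij (blinfun_apply T)}"
  proof (intro exI[of _ "1 / (1 + norm (binv T))"] conjI allI impI)
    show "0 < 1 / (1 + norm (binv T))" by (simp add: add_pos_nonneg)
    fix T' assume "dist T' T < 1 / (1 + norm (binv T))"
    then have d: "norm (T' - T) * (1 + norm (binv T)) < 1"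
      by (simp add: dist_norm pos_less_divide_eq add_pos_nonneg)
    have "norm (binv T) * norm (T' - T) \<le> norm (T' - T) * (1 + norm (binv T))"
      by (simp add: algebra_simps)
    then show "T' \<in> {T. bij (blinfun_apply T)}" using bij_perturb[OF T] d by simp
  qed
qed

lemma continuous_on_binv:
  "continuous_on {T :: 'x::banach \<Rightarrow>\<^sub>L 'y::banach. bij (blinfun_apply T)} binv"
  unfolding continuous_on_iff
proof (intro ballI allI impI)
  fix T :: "'x \<Rightarrow>\<^sub>L 'y" and e :: real
  assume "T \<in> {T. bij (blinfun_apply T)}" and e: "e > 0"
  then have T: "bij (blinfun_apply T)" by simp
  define b where "b = 1 + norm (binv T)"
  have b: "b > 0" "norm (binv T) \<le> b" by (simp_all add: b_def add_pos_nonneg)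
  \<comment> \<open>The first bound allows half of \<open>norm (binv T')\<close> to be absorbed in
    the resolvent identity below, so that \<open>binv T'\<close> has norm at most
    \<open>2 * b\<close>; the second then bounds the difference of the inverses by
    \<open>2 * e / 3\<close>.\<close>
  define d where "d = min (1 / (2 * b)) (e / (3 * b * b))"
  have d: "d > 0" using b e by (simp add: d_def)
  show "\<exists>d>0. \<forall>T'\<in>{T. bij (blinfun_apply T)}. dist T' T < d \<longrightarrow> dist (binv T') (binv T) < e"
  proof (intro exI[of _ d] conjI d ballI impI)
    fix T' :: "'x \<Rightarrow>\<^sub>L 'y" assume "T' \<in> {T. bij (blinfun_apply T)}" and dd: "dist T' T < d"
    then have T': "bij (blinfun_apply T')" by simp
    have eq: "binv T' - binv T = binv T' o\<^sub>L ((T - T') o\<^sub>L binv T)"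
      by (rule blinfun_eqI) (simp add: blinfun.diff_left blinfun.diff_right binv[OF T] binv[OF T'])
    have n: "norm (binv T' - binv T) \<le> norm (binv T') * (norm (T' - T) * norm (binv T))"
      unfolding eq
      by (metis (no_types, lifting) norm_blinfun_compose mult_left_mono norm_ge_zero norm_minus_commute order_trans)
    have t: "norm (T' - T) \<le> d" using dd by (simp add: dist_norm)
    have Tb: "norm (T' - T) * norm (binv T) \<le> d * b" using t b d by (intro mult_mono) auto
    note Tb
    also have "d * b \<le> 1 / (2 * b) * b" using b by (intro mult_right_mono) (auto simp: d_def)
    also have "\<dots> = 1 / 2" using b by simp
    finally have "norm (binv T') * (norm (T' - T) * norm (binv T)) \<le> norm (binv T') * (1/2)"
      by (intro mult_left_mono) auto
    then have "norm (binv T' - binv T) \<le> norm (binv T') / 2" using n by simp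
    then have nb: "norm (binv T') \<le> 2 * b" using b(2) norm_triangle_sub[of "binv T'" "binv T"] by simp
    have "norm (binv T' - binv T) \<le> (2 * b) * (d * b)"
      using n order_trans[OF _ mult_mono[OF nb Tb]] b d by auto
    also have "\<dots> \<le> (2 * b) * (e / (3 * b * b) * b)" using b by (intro mult_left_mono mult_right_mono) (auto simp: d_def)
    also have "\<dots> = 2 * e / 3" using b by (simp add: field_simps)
    also have "\<dots> < e" using e by simp
    finally show "dist (binv T') (binv T) < e" by (simp add: dist_norm)
  qed
qed


section \<open>The Hahn-Banach theorem and biorthogonal functionals\<close>

text \<open>Partially defined linear functionals, in the proof of the Hahn-Banach theorem, are represented by
  their graphs; the bound makes the graph single valued.\<close>

definition dominated_graph :: "real \<Rightarrow> ('x::real_normed_vector \<times> real) set \<Rightarrow> bool" where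
  "dominated_graph c G \<longleftrightarrow> subspace G \<and> (\<forall>(x, a)\<in>G. a \<le> c * norm x)"

text \<open>One Hahn-Banach step. The value \<open>a\<close> at \<open>x0\<close> must lie above all
  \<open>b - c * norm (x - x0)\<close> and below all \<open>c * norm (x + x0) - b\<close>. The
  triangle inequality separates the two families, and \<open>a\<close> is the supremum of the first.
  A multiple \<open>t\<close> of \<open>x0\<close> is reduced to these cases by dividing by the
  absolute value of \<open>t\<close>. If \<open>x0\<close> is already in the domain, the bounds
  force \<open>a\<close> to be its old value.\<close>

lemma dominated_graph_extend:
  assumes G: "dominated_graph c G" and c: "0 \<le> c"
  obtains a where "dominated_graph c {(x + t *\<^sub>R x0, b + t * a) |x b t. (x, b) \<in> G}"
proof -
  have sG: "subspace G" and bG: "\<And>x a. (x, a) \<in> G \<Longrightarrow> a \<le> c * norm x"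
    using G by (auto simp: dominated_graph_def)
  have G0: "(0, 0) \<in> G" using subspace_0[OF sG] by (simp add: zero_prod_def)
  let ?A = "{b - c * norm (x - x0) |x b. (x, b) \<in> G}"
  have le: "b - c * norm (x - x0) \<le> c * norm (x' + x0) - b'" if "(x, b) \<in> G" "(x', b') \<in> G" for x b x' b'
  proof -
    have "(x + x', b + b') \<in> G" using subspace_add[OF sG that] by simp
    then have "b + b' \<le> c * norm (x + x')" by (rule bG)
    also have "\<dots> \<le> c * (norm (x - x0) + norm (x' + x0))"
      using norm_triangle_ineq[of "x - x0" "x' + x0"] c by (intro mult_left_mono) auto
    finally show ?thesis by (simp add: algebra_simps)
  qed
  have bdd: "bdd_above ?A"
    by (rule bdd_aboveI[of _ "c * norm (0 + x0) - 0"]) (use le[OF _ G0] in blast)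
  have ne: "?A \<noteq> {}" using G0 by blast
  define a where "a = Sup ?A"
  have a1: "b - c * norm (x - x0) \<le> a" if "(x, b) \<in> G" for x b
    unfolding a_def by (rule cSup_upper[OF _ bdd]) (use that in blast)
  have a2: "a \<le> c * norm (x + x0) - b" if "(x, b) \<in> G" for x b
    unfolding a_def by (rule cSup_least[OF ne]) (use le that in blast)
  have dom: "b + t * a \<le> c * norm (x + t *\<^sub>R x0)" if xb: "(x, b) \<in> G" for x b t
  proof (cases t "0::real" rule: linorder_cases)
    case equal then show ?thesis using bG[OF xb] by simp
  next
    case greater
    have "(x /\<^sub>R t, b / t) \<in> G" using subspace_scale[OF sG xb, of "inverse t"] by (simp add: divide_inverse mult.commute)
    from a2[OF this] have "t * a \<le> t * (c * norm (x /\<^sub>R t + x0) - b / t)" using greater by (intro mult_left_mono) auto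
    also have "\<dots> = c * (t * norm (x /\<^sub>R t + x0)) - b" using greater by (simp add: algebra_simps)
    also have "t * norm (x /\<^sub>R t + x0) = norm (t *\<^sub>R (x /\<^sub>R t + x0))" using greater by simp
    also have "t *\<^sub>R (x /\<^sub>R t + x0) = x + t *\<^sub>R x0" using greater by (simp add: scaleR_add_right)
    finally show ?thesis by simp
  next
    case less
    have "(x /\<^sub>R (- t), b / (- t)) \<in> G" using subspace_scale[OF sG xb, of "inverse (- t)"] by (simp add: divide_inverse mult.commute)
    from a1[OF this] have "(- t) * (b / (- t) - c * norm (x /\<^sub>R (- t) - x0)) \<le> (- t) * a" using less by (intro mult_left_mono) auto
    also have "(- t) * (b / (- t) - c * norm (x /\<^sub>R (- t) - x0)) = b - c * ((- t) * norm (x /\<^sub>R (- t) - x0))" using less by (simp add: algebra_simps)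
    also have "(- t) * norm (x /\<^sub>R (- t) - x0) = norm ((- t) *\<^sub>R (x /\<^sub>R (- t) - x0))" using less by simp
    also have "(- t) *\<^sub>R (x /\<^sub>R (- t) - x0) = x + t *\<^sub>R x0" using less by (simp add: scaleR_diff_right)
    finally show ?thesis by simp
  qed
  have "subspace {(x + t *\<^sub>R x0, b + t * a) |x b t. (x, b) \<in> G}"
    unfolding subspace_def
  proof (intro conjI ballI allI)
    show "0 \<in> {(x + t *\<^sub>R x0, b + t * a) |x b t. (x, b) \<in> G}"
      using G0 by (auto simp: zero_prod_def intro!: exI[of _ 0])
  next
    fix p q assume "p \<in> {(x + t *\<^sub>R x0, b + t * a) |x b t. (x, b) \<in> G}" "q \<in> {(x + t *\<^sub>R x0, b + t * a) |x b t. (x, b) \<in> G}"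
    then obtain x b t x' b' t' where e: "p = (x + t *\<^sub>R x0, b + t * a)" "(x, b) \<in> G" "q = (x' + t' *\<^sub>R x0, b' + t' * a)" "(x', b') \<in> G"
      by blast
    have "(x + x', b + b') \<in> G" using subspace_add[OF sG e(2,4)] by simp
    moreover have "p + q = ((x + x') + (t + t') *\<^sub>R x0, (b + b') + (t + t') * a)"
      by (simp add: e algebra_simps)
    ultimately show "p + q \<in> {(x + t *\<^sub>R x0, b + t * a) |x b t. (x, b) \<in> G}" by blast
  next
    fix r p assume "p \<in> {(x + t *\<^sub>R x0, b + t * a) |x b t. (x, b) \<in> G}"
    then obtain x b t where e: "p = (x + t *\<^sub>R x0, b + t * a)" "(x, b) \<in> G" by blast
    have "(r *\<^sub>R x, r * b) \<in> G" using subspace_scale[OF sG e(2), of r] by simp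
    moreover have "r *\<^sub>R p = (r *\<^sub>R x + (r * t) *\<^sub>R x0, r * b + (r * t) * a)"
      by (simp add: e algebra_simps)
    ultimately show "r *\<^sub>R p \<in> {(x + t *\<^sub>R x0, b + t * a) |x b t. (x, b) \<in> G}" by blast
  qed
  then show ?thesis using dom by (intro that[of a]) (auto simp: dominated_graph_def)
qed

text \<open>Zorn's lemma: a maximal dominated graph equals its own extension by any
  \<open>x0\<close>, so \<open>x0\<close> is already in its domain.\<close>

lemma dominated_graph_total:
  assumes G: "dominated_graph c G" and c: "0 \<le> c"
  obtains M where "G \<subseteq> M" "dominated_graph c M" "fst ` M = UNIV"
proof -
  let ?S = "{M. G \<subseteq> M \<and> dominated_graph c M}"
  have "\<exists>M\<in>?S. \<forall>X\<in>?S. M \<subseteq> X \<longrightarrow> X = M"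
  proof (rule subset_Zorn_nonempty)
    show "?S \<noteq> {}" using G by blast
    fix C assume C: "C \<noteq> {}" "subset.chain ?S C"
    have in_S: "M \<in> C \<Longrightarrow> G \<subseteq> M \<and> subspace M \<and> (\<forall>(x, a)\<in>M. a \<le> c * norm x)" for M
      using C(2) by (auto simp: subset_chain_def dominated_graph_def)
    have sub: "subspace (\<Union>C)"
      unfolding subspace_def
    proof (intro conjI ballI allI)
      obtain D where D: "D \<in> C" using C(1) by blast
      then have "0 \<in> D" using in_S[OF D] subspace_0 by blast
      then show "0 \<in> \<Union>C" using D by (rule UnionI[rotated])
      fix p q assume "p \<in> \<Union>C" "q \<in> \<Union>C"
      then obtain A B where AB: "A \<in> C" "p \<in> A" "B \<in> C" "q \<in> B" by blast
      then have "A \<subseteq> B \<or> B \<subseteq> A" using C(2) by (auto simp: subset_chain_def)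
      then obtain D where D: "D \<in> C" "p \<in> D" "q \<in> D" using AB by (elim disjE) (blast intro: that)+
      then have "p + q \<in> D" using in_S[OF D(1)] subspace_add[of D p q] by simp
      then show "p + q \<in> \<Union>C" using D(1) by (rule UnionI[rotated])
    next
      fix r p assume "p \<in> \<Union>C"
      then obtain D where D: "D \<in> C" "p \<in> D" by blast
      then have "r *\<^sub>R p \<in> D" using in_S[OF D(1)] subspace_scale[of D p r] by simp
      then show "r *\<^sub>R p \<in> \<Union>C" using D(1) by (rule UnionI[rotated])
    qed
    obtain D where D: "D \<in> C" using C(1) by blast
    have "G \<subseteq> D" using in_S[OF D] by simp
    then have "G \<subseteq> \<Union>C" using D by blast
    moreover have "\<forall>p\<in>\<Union>C. case p of (x, a) \<Rightarrow> a \<le> c * norm x"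
    proof
      fix p assume "p \<in> \<Union>C"
      then obtain D where D: "D \<in> C" "p \<in> D" by blast
      then show "case p of (x, a) \<Rightarrow> a \<le> c * norm x" using in_S[OF D(1)] by simp
    qed
    moreover note sub
    ultimately show "\<Union>C \<in> ?S" by (simp add: dominated_graph_def)
  qed
  then obtain M where MS: "M \<in> ?S" "\<forall>X\<in>?S. M \<subseteq> X \<longrightarrow> X = M" by (rule bexE)
  have M: "G \<subseteq> M" "dominated_graph c M" using MS(1) by simp_all
  have max: "X = M" if "G \<subseteq> X" "dominated_graph c X" "M \<subseteq> X" for X
    using bspec[OF MS(2), of X] that by simp
  have "x0 \<in> fst ` M" for x0
  proof -
    obtain a where a: "dominated_graph c {(x + t *\<^sub>R x0, b + t * a) |x b t. (x, b) \<in> M}" (is "dominated_graph c ?X")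
      using dominated_graph_extend[OF M(2) c] by blast
    have "M \<subseteq> ?X"
    proof
      fix p assume p: "p \<in> M"
      obtain y b where yb: "p = (y, b)" by (cases p)
      have "(y + 0 *\<^sub>R x0, b + 0 * a) \<in> ?X" using p yb by blast
      then show "p \<in> ?X" using yb by simp
    qed
    then have X: "?X = M" using max[OF _ a] M(1) by simp
    have "subspace M" using M(2) by (simp add: dominated_graph_def)
    then have "(0, 0) \<in> M" using subspace_0[of M] by (simp add: zero_prod_def)
    then have "(0 + 1 *\<^sub>R x0, 0 + 1 * a) \<in> ?X" by blast
    then have "(x0, a) \<in> M" unfolding X by simp
    then show ?thesis by (rule image_eqI[rotated]) simp
  qed
  then have "fst ` M = UNIV" by auto
  then show ?thesis using that[OF M] by simp
qed

lemma functional_nonzero: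
  fixes e :: "'x::real_normed_vector"
  assumes "e \<noteq> 0"
  obtains f :: "'x \<Rightarrow>\<^sub>L real" where "f e = 1"
proof -
  \<comment> \<open>The functional sending \<open>t *\<^sub>R e\<close> to \<open>t\<close> on the
    line through \<open>e\<close> has exactly this norm.\<close>
  define c where "c = 1 / norm e"
  have c: "0 \<le> c" by (simp add: c_def)
  have "dominated_graph c (range (\<lambda>t. (t *\<^sub>R e, t)))"
    unfolding dominated_graph_def
  proof
    show "subspace (range (\<lambda>t. (t *\<^sub>R e, t)))"
      unfolding subspace_def
    proof (intro conjI ballI allI)
      show "0 \<in> range (\<lambda>t. (t *\<^sub>R e, t))" by (rule range_eqI[of _ _ 0]) (simp add: zero_prod_def)
      show "x + y \<in> range (\<lambda>t. (t *\<^sub>R e, t))" if xy: "x \<in> range (\<lambda>t. (t *\<^sub>R e, t))" "y \<in> range (\<lambda>t. (t *\<^sub>R e, t))" for x y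
      proof -
        obtain s t where "x = (s *\<^sub>R e, s)" "y = (t *\<^sub>R e, t)" using xy by blast
        then show ?thesis by (intro range_eqI[of _ _ "s + t"]) (simp add: scaleR_add_left)
      qed
      show "r *\<^sub>R x \<in> range (\<lambda>t. (t *\<^sub>R e, t))" if x: "x \<in> range (\<lambda>t. (t *\<^sub>R e, t))" for r x
      proof -
        obtain s where "x = (s *\<^sub>R e, s)" using x by blast
        then show ?thesis by (intro range_eqI[of _ _ "r * s"]) simp
      qed
    qed
    show "\<forall>(x, a)\<in>range (\<lambda>t. (t *\<^sub>R e, t)). a \<le> c * norm x" using assms by (auto simp: c_def)
  qed
  then obtain M where M: "range (\<lambda>t. (t *\<^sub>R e, t)) \<subseteq> M" "dominated_graph c M" "fst ` M = UNIV"
    using dominated_graph_total[OF _ c] by blast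
  have sM: "subspace M" and bM: "\<And>x a. (x, a) \<in> M \<Longrightarrow> a \<le> c * norm x"
    using M(2) by (auto simp: dominated_graph_def)
  have bM': "\<bar>a\<bar> \<le> c * norm x" if "(x, a) \<in> M" for x a
    using bM[OF that] bM[of "- x" "- a"] subspace_neg[OF sM that] by auto
  \<comment> \<open>The difference of two values at \<open>x\<close> is a value at 0, where the
    bound is 0.\<close>
  have uniq: "a = b" if "(x, a) \<in> M" "(x, b) \<in> M" for x a b
    using bM'[of 0 "a - b"] subspace_diff[OF sM that] by simp
  have "\<forall>x. \<exists>a. (x, a) \<in> M" using M(3) by (metis UNIV_I imageE prod.collapse)
  then obtain f where f: "\<And>x. (x, f x) \<in> M" by metis
  have "bounded_linear f"
  proof
    show "f (x + y) = f x + f y" for x y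
      using uniq[OF f[of "x + y"]] subspace_add[OF sM f[of x] f[of y]] by simp
    show "f (r *\<^sub>R x) = r *\<^sub>R f x" for r x
      using uniq[OF f[of "r *\<^sub>R x"]] subspace_scale[OF sM f[of x], of r] by simp
    show "\<exists>K. \<forall>x. norm (f x) \<le> norm x * K"
      using bM'[OF f] by (intro exI[of _ c]) (simp add: mult.commute)
  qed
  moreover have "f e = 1"
    by (rule uniq[OF f[of e]]) (use range_subsetD[OF M(1), of 1] in simp)
  ultimately show ?thesis
    using that[of "Blinfun f"] by (simp add: bounded_linear_Blinfun_apply)
qed

text \<open>Induction in the manner of Gram-Schmidt. The functionals found so far define a
  projection \<open>p\<close> onto \<open>span B\<close>. A functional that is 1 on
  \<open>a - p a\<close>, composed with \<open>id_blinfun - p\<close>, vanishes on \<open>B\<close>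
  and is 1 at \<open>a\<close>; subtracting multiples of it makes the old functionals vanish at
  \<open>a\<close>.\<close>

lemma biorthogonal_functionals:
  fixes B :: "'x::real_normed_vector set"
  assumes "finite B" "independent B"
  obtains \<phi> :: "'x \<Rightarrow> 'x \<Rightarrow>\<^sub>L real"
  where "\<And>b b'. b \<in> B \<Longrightarrow> b' \<in> B \<Longrightarrow> \<phi> b b' = (if b = b' then 1 else 0)"
proof -
  have "\<exists>\<phi> :: 'x \<Rightarrow> 'x \<Rightarrow>\<^sub>L real. \<forall>b\<in>B. \<forall>b'\<in>B. \<phi> b b' = (if b = b' then 1 else 0)"
    using assms
  proof (induction B)
    case empty show ?case by simp
  next
    case (insert a B)
    then obtain \<phi> :: "'x \<Rightarrow> 'x \<Rightarrow>\<^sub>L real" where \<phi>: "\<And>b b'. b \<in> B \<Longrightarrow> b' \<in> B \<Longrightarrow> \<phi> b b' = (if b = b' then 1 else 0)"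
      by (auto simp: independent_insert)
    define p :: "'x \<Rightarrow>\<^sub>L 'x" where "p = (\<Sum>b\<in>B. blinfun_scaleR_left b o\<^sub>L \<phi> b)"
    have p: "p x = (\<Sum>b\<in>B. \<phi> b x *\<^sub>R b)" for x
      by (simp add: p_def blinfun.sum_left)
    have pB: "p b = b" if "b \<in> B" for b
    proof -
      have "p b = (\<Sum>b'\<in>B. if b' = b then b else 0)"
        unfolding p using \<phi> that by (intro sum.cong) auto
      then show ?thesis using insert.hyps that by simp
    qed
    have "a \<notin> span B" using insert.prems insert.hyps by (simp add: independent_insert)
    moreover have "p a \<in> span B" unfolding p by (intro span_sum span_scale span_base)
    ultimately have "a - p a \<noteq> 0" by auto
    then obtain f :: "'x \<Rightarrow>\<^sub>L real" where f: "f (a - p a) = 1" by (rule functional_nonzero)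
    define g where "g = f o\<^sub>L (id_blinfun - p)"
    have g: "g x = f (x - p x)" for x by (simp add: g_def blinfun.diff_left)
    have ga: "g a = 1" and gB: "g b = 0" if "b \<in> B" for b using f pB that by (simp_all add: g)
    have ga: "g a = 1" using f by (simp add: g)
    define \<psi> where "\<psi> b = (if b = a then g else \<phi> b - \<phi> b a *\<^sub>R g)" for b
    have "\<psi> b b' = (if b = b' then 1 else 0)" if "b \<in> insert a B" "b' \<in> insert a B" for b b'
      using that insert.hyps \<phi> ga gB
      by (auto simp: \<psi>_def blinfun.diff_left blinfun.scaleR_left)
    then show ?case by blast
  qed
  then show ?thesis using that by blast
qed

section \<open>Fredholm operators of index 0 become invertible after a finite rank
  correction\<close>

lemma finite_dim_basis:
  assumes "finite_dim (S :: 'v::real_vector set)"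
  obtains B where "finite B" "independent B" "span B = S" "card B = dim S"
proof -
  obtain C where C: "finite C" "S = span C" using assms by (auto simp: finite_dim_def)
  obtain B where B: "B \<subseteq> C" "independent B" "C \<subseteq> span B"
    using maximal_independent_subset[of C] by blast
  have "span B = S" using C(2) span_mono[OF B(1)] span_minimal[OF B(3) subspace_span] by blast
  moreover have "finite B" using B C finite_subset by blast
  ultimately show ?thesis using that B(2) dim_eq_card_independent[OF B(2)] dim_span by metis
qed

text \<open>A basis of the range is completed by a finite set \<open>D\<close> of vectors from
  \<open>W\<close>, so \<open>span D\<close> is a complement of the range inside \<open>W\<close>.
  Index 0 says that \<open>D\<close> is as large as a basis of the kernel. \<open>K\<close> maps the
  kernel isomorphically onto \<open>span D\<close>, through continuous biorthogonal functionals, and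
  thereby repairs injectivity and surjectivity together.\<close>

lemma finite_rank_correction:
  fixes T :: "'x::real_normed_vector \<Rightarrow>\<^sub>L 'y::real_normed_vector"
  assumes F: "fredholm T" "fredholm_index T = 0"
    and W: "finite_dim W" "{T x + w |x w. w \<in> W} = UNIV"
  obtains K :: "'x \<Rightarrow>\<^sub>L 'y" where "range (blinfun_apply K) \<subseteq> W" "bij (blinfun_apply (T + K))"
proof -
  let ?R = "range (blinfun_apply T)"
  have sR: "subspace ?R" using F(1) by (simp add: fredholm_def finite_codim_def)
  obtain BN where BN: "finite BN" "independent BN" "span BN = op_kernel T" "card BN = dim (op_kernel T)"
    using finite_dim_basis F(1) unfolding fredholm_def by metis
  obtain C where C: "finite C" "W = span C" and sW: "subspace W" using W(1) by (auto simp: finite_dim_def)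
  obtain BR where BR: "BR \<subseteq> ?R" "independent BR" "?R \<subseteq> span BR"
    using maximal_independent_subset[of ?R] by blast
  have spBR: "span BR = ?R" using BR span_minimal[OF BR(1) sR] by blast
  obtain B where B: "BR \<subseteq> B" "B \<subseteq> BR \<union> C" "independent B" "BR \<union> C \<subseteq> span B"
    using maximal_independent_subset_extend[of BR "BR \<union> C"] BR(2) by blast
  define D where "D = B - BR"
  have D: "finite D" "D \<subseteq> C" "B = BR \<union> D" "BR \<inter> D = {}"
    using B C(1) finite_subset[of D C] by (auto simp: D_def)
  have indD: "independent D" using B(3) D(3) independent_mono by blast
  have spB: "span B = UNIV"
  proof -
    have "span (BR \<union> C) \<subseteq> span B" using B(4) span_minimal subspace_span by blast
    moreover have "y \<in> span (BR \<union> C)" for y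
    proof -
      have "y \<in> {T x + w |x w. w \<in> W}" using W(2) by simp
      then obtain x w where "y = T x + w" "w \<in> W" by blast
      moreover have "T x \<in> span (BR \<union> C)" using spBR span_mono[of BR "BR \<union> C"] by auto
      moreover have "w \<in> span (BR \<union> C)" using \<open>w \<in> W\<close> C span_mono[of C "BR \<union> C"] by blast
      ultimately show ?thesis by (simp add: span_add)
    qed
    ultimately show ?thesis by blast
  qed
  \<comment> \<open>The algebraic projection onto \<open>span D\<close> along the range. Continuity
    is not claimed; it serves to compare dimensions and to separate \<open>K x\<close> from
    \<open>T x\<close>.\<close>
  obtain g where g: "linear g" "\<forall>x\<in>B. g x = (if x \<in> D then x else 0)"
    using linear_independent_extend[OF B(3), of "\<lambda>x. if x \<in> D then x else 0"] by (elim exE conjE)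
  have gR: "g y = 0" if "y \<in> ?R" for y
  proof (rule linear_eq_0_on_span[OF g(1)])
    show "g x = 0" if "x \<in> BR" for x using g(2) D(3,4) that by (auto simp: disjoint_iff)
  qed (use spBR that in simp)
  have gD: "g y = y" if "y \<in> span D" for y
    using linear_eq_on_span[OF g(1) linear_ident _ that] g(2) D(3) by simp
  have g_in: "g y \<in> span D" for y
  proof -
    have "y \<in> span (BR \<union> D)" using spB D(3) by simp
    then obtain r d where "y = r + d" "r \<in> span BR" "d \<in> span D" unfolding span_Un by blast
    then show ?thesis using gR gD linear_add[OF g(1)] spBR by auto
  qed
  have "codim ?R = card D"
    unfolding codim_def
  proof (rule Least_equality)
    have "BR \<union> D \<subseteq> span (?R \<union> D)" using BR(1) by (auto intro: span_base)
    then have "span (BR \<union> D) \<subseteq> span (?R \<union> D)" by (rule span_minimal[OF _ subspace_span])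
    then show "\<exists>D'. finite D' \<and> card D' = card D \<and> span (?R \<union> D') = UNIV"
      using D spB by auto
    \<comment> \<open>A set that spans modulo the range is mapped by \<open>g\<close> to one that
      spans \<open>D\<close>, so it has at least \<open>card D\<close> elements.\<close>
    fix n assume "\<exists>D'. finite D' \<and> card D' = n \<and> span (?R \<union> D') = UNIV"
    then obtain D' where D': "finite D'" "card D' = n" "span (?R \<union> D') = UNIV" by blast
    have "D \<subseteq> span (g ` D')"
    proof
      fix d assume "d \<in> D"
      have "d \<in> span (?R \<union> D')" using D' by simp
      then obtain r d' where rd: "d = r + d'" "r \<in> span ?R" "d' \<in> span D'" unfolding span_Un by blast
      have "r \<in> ?R" using rd(2) sR by (simp add: span_eq_iff[THEN iffD2])
      then have "g d = g d'" using rd(1) linear_add[OF g(1)] gR by simp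
      moreover have "g d = d" using gD \<open>d \<in> D\<close> span_base by blast
      moreover have "g d' \<in> span (g ` D')" using rd(3) linear_span_image[OF g(1)] by blast
      ultimately show "d \<in> span (g ` D')" by simp
    qed
    then have "card D \<le> card (g ` D')" using independent_span_bound[of "g ` D'" D] D' indD by simp
    also have "\<dots> \<le> n" using D' card_image_le by blast
    finally show "card D \<le> n" .
  qed
  then have "card BN = card D" using F(2) BN(4) by (simp add: fredholm_index_def)
  then obtain j where j: "bij_betw j BN D" using BN(1) D(1) finite_same_card_bij by blast
  obtain \<phi> :: "'x \<Rightarrow> 'x \<Rightarrow>\<^sub>L real" where \<phi>: "\<And>b b'. b \<in> BN \<Longrightarrow> b' \<in> BN \<Longrightarrow> \<phi> b b' = (if b = b' then 1 else 0)"
    using biorthogonal_functionals[OF BN(1,2)] by blast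
  define K :: "'x \<Rightarrow>\<^sub>L 'y" where "K = (\<Sum>b\<in>BN. blinfun_scaleR_left (j b) o\<^sub>L \<phi> b)"
  have K: "K x = (\<Sum>b\<in>BN. \<phi> b x *\<^sub>R j b)" for x
    by (simp add: K_def blinfun.sum_left)
  have jD: "j b \<in> D" if "b \<in> BN" for b using j that bij_betwE by blast
  have KD: "K x \<in> span D" for x unfolding K by (intro span_sum span_scale span_base jD)
  have \<phi>sum: "\<phi> b (\<Sum>b'\<in>BN. u b' *\<^sub>R b') = u b" if "b \<in> BN" for u b
  proof -
    have "\<phi> b (\<Sum>b'\<in>BN. u b' *\<^sub>R b') = (\<Sum>b'\<in>BN. if b' = b then u b else 0)"
      unfolding blinfun.sum_right using \<phi> that by (intro sum.cong) (auto simp: blinfun.scaleR_right)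
    then show ?thesis using BN(1) that by simp
  qed
  have Ksum: "K (\<Sum>b'\<in>BN. u b' *\<^sub>R b') = (\<Sum>b\<in>BN. u b *\<^sub>R j b)" for u
    unfolding K using \<phi>sum by (intro sum.cong) auto
  have Tsum: "T (\<Sum>b'\<in>BN. u b' *\<^sub>R b') = 0" for u
  proof -
    have "(\<Sum>b'\<in>BN. u b' *\<^sub>R b') \<in> span BN" by (intro span_sum span_scale span_base)
    then show ?thesis using BN(3) by (simp add: op_kernel_def)
  qed
  have spanD: "\<exists>u. d = (\<Sum>b\<in>BN. u b *\<^sub>R j b)" if dD: "d \<in> span D" for d
  proof -
    obtain u where "d = (\<Sum>v\<in>D. u v *\<^sub>R v)" using dD unfolding span_finite[OF D(1)] by (elim rangeE)
    also have "\<dots> = (\<Sum>b\<in>BN. u (j b) *\<^sub>R j b)"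
      using sum.reindex_bij_betw[OF j, of "\<lambda>v. u v *\<^sub>R v"] by simp
    finally show ?thesis by (intro exI[of _ "\<lambda>b. u (j b)"])
  qed
  have "inj (blinfun_apply (T + K))"
  proof (rule injI)
    fix x y assume "(T + K) x = (T + K) y"
    then have e: "T (x - y) + K (x - y) = 0" by (simp add: blinfun.add_left blinfun.diff_right algebra_simps)
    let ?z = "x - y"
    have "g (T ?z + K ?z) = K ?z" using linear_add[OF g(1)] gR gD[OF KD] by simp
    then have K0: "K ?z = 0" using e linear_0[OF g(1)] by simp
    then have "?z \<in> span BN" using e BN(3) by (simp add: op_kernel_def)
    then obtain u where u: "?z = (\<Sum>b\<in>BN. u b *\<^sub>R b)" unfolding span_finite[OF BN(1)] by (elim rangeE)
    have "(\<Sum>v\<in>D. u (inv_into BN j v) *\<^sub>R v) = (\<Sum>b\<in>BN. u b *\<^sub>R j b)"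
      using sum.reindex_bij_betw[OF j, of "\<lambda>v. u (inv_into BN j v) *\<^sub>R v"] j
      by (auto simp: bij_betw_inv_into_left cong: sum.cong)
    also have "\<dots> = 0" using Ksum[of u] K0 u by simp
    finally have s0: "(\<Sum>v\<in>D. u (inv_into BN j v) *\<^sub>R v) = 0" .
    have "u b = 0" if "b \<in> BN" for b
      using independentD[OF indD D(1) order_refl s0 jD[OF that]] bij_betw_inv_into_left[OF j that] by simp
    then show "x = y" using u by simp
  qed
  moreover have "surj (blinfun_apply (T + K))"
  proof -
    have "\<exists>x. y = (T + K) x" for y
    proof -
      have "y \<in> span (BR \<union> D)" using spB D(3) by simp
      then obtain r d where rd: "y = r + d" "r \<in> span BR" "d \<in> span D" unfolding span_Un by blast
      obtain x where x: "r = T x" using rd(2) spBR by blast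
      obtain u where u: "d = (\<Sum>b\<in>BN. u b *\<^sub>R j b)" using spanD[OF rd(3)] by blast
      \<comment> \<open>\<open>T\<close> and \<open>K\<close> are prescribed independently: a change
        inside the kernel leaves \<open>T x\<close> alone, while \<open>K\<close> depends only on
        the values of the functionals, which the change replaces by \<open>u\<close>.\<close>
      define z where "z = x - (\<Sum>b\<in>BN. \<phi> b x *\<^sub>R b) + (\<Sum>b\<in>BN. u b *\<^sub>R b)"
      have "T z = r" unfolding z_def blinfun.add_right blinfun.diff_right Tsum x by simp
      moreover have "K z = d" unfolding z_def blinfun.add_right blinfun.diff_right Ksum u by (simp add: K)
      ultimately show ?thesis using rd(1) by (auto simp: blinfun.add_left)
    qed
    then show ?thesis by blast
  qed
  moreover have "range (blinfun_apply K) \<subseteq> W" using KD D(2) C(2) span_mono by blast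
  ultimately show ?thesis using that by (simp add: bij_def)
qed

section \<open>Bundle isomorphisms and Whitney sums\<close>

text \<open>Weaker than asking every fibre to be a subspace: fibres over points outside the base are
  empty and lack 0. The isomorphism lemmas can thus be stated without mentioning the base.\<close>

definition prelinear :: "('l, 'w::real_vector) total_space \<Rightarrow> bool" where
  "prelinear E \<longleftrightarrow> (\<forall>l. \<forall>v\<in>fibre E l. \<forall>w\<in>fibre E l. \<forall>a b. a *\<^sub>R v + b *\<^sub>R w \<in> fibre E l)"

lemma prelinearD:
  "prelinear E \<Longrightarrow> (l, v) \<in> topspace E \<Longrightarrow> (l, w) \<in> topspace E \<Longrightarrow> (l, a *\<^sub>R v + b *\<^sub>R w) \<in> topspace E"
  by (auto simp: prelinear_def fibre_def)

lemma continuous_map_fst_topspace: "continuous_map E \<Lambda> fst \<Longrightarrow> (l, v) \<in> topspace E \<Longrightarrow> l \<in> topspace \<Lambda>"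
  using continuous_map_image_subset_topspace by fastforce

lemma prelinear_if_subspace:
  assumes "continuous_map E \<Lambda> fst" "\<forall>l\<in>topspace \<Lambda>. subspace (fibre E l)"
  shows "prelinear E"
  unfolding prelinear_def
proof (intro allI ballI)
  fix l v w and a b :: real assume v: "v \<in> fibre E l" and w: "w \<in> fibre E l"
  then have "subspace (fibre E l)" using continuous_map_fst_topspace[OF assms(1)] assms(2) by (auto simp: fibre_def)
  then show "a *\<^sub>R v + b *\<^sub>R w \<in> fibre E l" using v w by (intro subspace_add subspace_scale)
qed

lemma vector_bundle_prelinear: "vector_bundle \<Lambda> E \<Longrightarrow> prelinear E"
  by (auto simp: vector_bundle_def intro: prelinear_if_subspace)

lemma vector_bundle_fst: "vector_bundle \<Lambda> E \<Longrightarrow> continuous_map E \<Lambda> fst"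
  by (simp add: vector_bundle_def)

lemma bundle_isoI:
  assumes "continuous_map E F (\<lambda>(l, v). (l, s l v))" "continuous_map F E (\<lambda>(l, w). (l, t l w))"
    and "\<And>l v. (l, v) \<in> topspace E \<Longrightarrow> t l (s l v) = v"
    and "\<And>l w. (l, w) \<in> topspace F \<Longrightarrow> s l (t l w) = w"
    and "\<And>l v w a b. (l, v) \<in> topspace E \<Longrightarrow> (l, w) \<in> topspace E \<Longrightarrow> s l (a *\<^sub>R v + b *\<^sub>R w) = a *\<^sub>R s l v + b *\<^sub>R s l w"
  shows "bundle_iso E F"
  unfolding bundle_iso_def
proof (intro exI conjI)
  have "homeomorphic_maps E F (\<lambda>(l, v). (l, s l v)) (\<lambda>(l, w). (l, t l w))"
    using assms(1-4) by (auto simp: homeomorphic_maps_def)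
  then show "homeomorphic_map E F (\<lambda>(l, v). (l, s l v))" using homeomorphic_maps_map by blast
  show "fibre_preserving E (\<lambda>(l, v). (l, s l v))" by (auto simp: fibre_preserving_def)
  show "fibrewise_linear E (\<lambda>(l, v). (l, s l v))" using assms(5) by (auto simp: fibrewise_linear_def fibre_def)
qed

definition bundle_maps ::
    "('l, 'w::real_vector) total_space \<Rightarrow> ('l, 'v::real_vector) total_space \<Rightarrow> ('l \<Rightarrow> 'w \<Rightarrow> 'v) \<Rightarrow> ('l \<Rightarrow> 'v \<Rightarrow> 'w) \<Rightarrow> bool" where
  "bundle_maps E F s t \<longleftrightarrow>
     continuous_map E F (\<lambda>(l, v). (l, s l v)) \<and> continuous_map F E (\<lambda>(l, w). (l, t l w)) \<and>
     (\<forall>l v. (l, v) \<in> topspace E \<longrightarrow> (l, s l v) \<in> topspace F \<and> t l (s l v) = v) \<and>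
     (\<forall>l w. (l, w) \<in> topspace F \<longrightarrow> (l, t l w) \<in> topspace E \<and> s l (t l w) = w) \<and>
     (\<forall>l v w a b. (l, v) \<in> topspace E \<longrightarrow> (l, w) \<in> topspace E \<longrightarrow> s l (a *\<^sub>R v + b *\<^sub>R w) = a *\<^sub>R s l v + b *\<^sub>R s l w) \<and>
     (\<forall>l v w a b. (l, v) \<in> topspace F \<longrightarrow> (l, w) \<in> topspace F \<longrightarrow> t l (a *\<^sub>R v + b *\<^sub>R w) = a *\<^sub>R t l v + b *\<^sub>R t l w)"

lemma bundle_mapsD:
  assumes "bundle_maps E F s t"
  shows "continuous_map E F (\<lambda>(l, v). (l, s l v))" "continuous_map F E (\<lambda>(l, w). (l, t l w))"
    "\<And>l v. (l, v) \<in> topspace E \<Longrightarrow> (l, s l v) \<in> topspace F \<and> t l (s l v) = v"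
    "\<And>l w. (l, w) \<in> topspace F \<Longrightarrow> (l, t l w) \<in> topspace E \<and> s l (t l w) = w"
    "\<And>l v w a b. (l, v) \<in> topspace E \<Longrightarrow> (l, w) \<in> topspace E \<Longrightarrow> s l (a *\<^sub>R v + b *\<^sub>R w) = a *\<^sub>R s l v + b *\<^sub>R s l w"
    "\<And>l v w a b. (l, v) \<in> topspace F \<Longrightarrow> (l, w) \<in> topspace F \<Longrightarrow> t l (a *\<^sub>R v + b *\<^sub>R w) = a *\<^sub>R t l v + b *\<^sub>R t l w"
  using assms unfolding bundle_maps_def by simp_all

text \<open>Closure of the source fibres under linear combinations makes the inverse linear: it
  ensures that a combination of \<open>t l v\<close> and \<open>t l w\<close> is a point on which
  \<open>s\<close> is linear and undone by \<open>t\<close>.\<close>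

lemma bundle_isoE:
  assumes "bundle_iso E F" and "prelinear E"
  obtains s t where "bundle_maps E F s t"
proof -
  obtain h where h: "homeomorphic_map E F h" "fibre_preserving E h" "fibrewise_linear E h"
    using assms(1) by (auto simp: bundle_iso_def)
  have fh: "fibre_homeo E F h" using h by (simp add: fibre_homeo_def)
  obtain k where k: "fibre_homeo F E k" "\<And>x. x \<in> topspace E \<Longrightarrow> k (h x) = x" "\<And>y. y \<in> topspace F \<Longrightarrow> h (k y) = y"
    using fibre_homeo_inverse[OF fh] by metis
  have ck: "continuous_map F E k" "continuous_map E F h" and fk: "fibre_preserving F k"
    using k(1) h(1) homeomorphic_imp_continuous_map by (auto simp: fibre_homeo_def)
  define s t where "s l v = snd (h (l, v))" and "t l w = snd (k (l, w))" for l v w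
  have hs: "h (l, v) = (l, s l v)" if "(l, v) \<in> topspace E" for l v
    using h(2) that by (auto simp: s_def fibre_preserving_def prod_eq_iff)
  have kt: "k (l, v) = (l, t l v)" if "(l, v) \<in> topspace F" for l v
    using fk that by (auto simp: t_def fibre_preserving_def prod_eq_iff)
  have 1: "continuous_map E F (\<lambda>(l, v). (l, s l v))" using ck(2) by (rule continuous_map_eq) (use hs in auto)
  have 2: "continuous_map F E (\<lambda>(l, v). (l, t l v))" using ck(1) by (rule continuous_map_eq) (use kt in auto)
  have 3: "(l, s l v) \<in> topspace F \<and> t l (s l v) = v" if "(l, v) \<in> topspace E" for l v
  proof -
    have "(l, s l v) \<in> topspace F" using continuous_map_image_subset_topspace[OF 1] that by auto
    then show ?thesis using k(2)[OF that] hs[OF that] kt by simp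
  qed
  have 4: "(l, t l v) \<in> topspace E \<and> s l (t l v) = v" if "(l, v) \<in> topspace F" for l v
  proof -
    have "(l, t l v) \<in> topspace E" using continuous_map_image_subset_topspace[OF 2] that by auto
    then show ?thesis using k(3)[OF that] kt[OF that] hs by simp
  qed
  have 5: "s l (a *\<^sub>R v + b *\<^sub>R w) = a *\<^sub>R s l v + b *\<^sub>R s l w" if "(l, v) \<in> topspace E" "(l, w) \<in> topspace E" for l v w a b
    using h(3) that by (simp add: fibrewise_linear_def fibre_def s_def)
  have 6: "t l (a *\<^sub>R v + b *\<^sub>R w) = a *\<^sub>R t l v + b *\<^sub>R t l w" if "(l, v) \<in> topspace F" "(l, w) \<in> topspace F" for l v w a b
  proof -
    have "t l (s l (a *\<^sub>R t l v + b *\<^sub>R t l w)) = a *\<^sub>R t l v + b *\<^sub>R t l w"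
      using 3[OF prelinearD[OF assms(2)]] 4 that by blast
    then show ?thesis using 5 4 that by simp
  qed
  show ?thesis by (rule that[of s t]) (use 1 2 3 4 5 6 in \<open>simp add: bundle_maps_def\<close>)
qed

lemma bundle_iso_refl: "bundle_iso E E"
  by (rule bundle_isoI[where s = "\<lambda>l v. v" and t = "\<lambda>l v. v"]) (auto simp: case_prod_eta)

lemma bundle_maps_iso: "bundle_maps E F s t \<Longrightarrow> bundle_iso E F"
  by (rule bundle_isoI[where s = s and t = t]) (simp_all add: bundle_mapsD)

lemma bundle_maps_sym: "bundle_maps E F s t \<Longrightarrow> bundle_maps F E t s"
  unfolding bundle_maps_def by simp

lemma bundle_iso_sym:
  assumes "bundle_iso E F" "prelinear E" shows "bundle_iso F E"
  using bundle_isoE[OF assms] bundle_maps_sym bundle_maps_iso by metis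

lemma bundle_iso_prelinear:
  assumes "bundle_iso E F" "prelinear E" shows "prelinear F"
proof -
  obtain s t where stm: "bundle_maps E F s t" by (rule bundle_isoE[OF assms])
  note st = bundle_mapsD[OF stm]
  have "(l, a *\<^sub>R v + b *\<^sub>R w) \<in> topspace F" if vw: "(l, v) \<in> topspace F" "(l, w) \<in> topspace F" for l v w and a b :: real
  proof -
    have "(l, s l (a *\<^sub>R t l v + b *\<^sub>R t l w)) \<in> topspace F"
      using st(3)[OF prelinearD[OF assms(2)]] st(4) vw by blast
    then show ?thesis using st(4,5) vw by simp
  qed
  then show ?thesis by (auto simp: prelinear_def fibre_def)
qed

lemma bundle_iso_trans:
  assumes EF: "bundle_iso E F" and FG: "bundle_iso F G" and E: "prelinear E" shows "bundle_iso E G"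
proof -
  obtain s t where stm: "bundle_maps E F s t" by (rule bundle_isoE[OF EF E])
  note st = bundle_mapsD[OF stm]
  obtain s' t' where st'm: "bundle_maps F G s' t'" by (rule bundle_isoE[OF FG bundle_iso_prelinear[OF EF E]])
  note st' = bundle_mapsD[OF st'm]
  show ?thesis
  proof (rule bundle_isoI[where s = "\<lambda>l v. s' l (s l v)" and t = "\<lambda>l w. t l (t' l w)"])
    show "continuous_map E G (\<lambda>(l, v). (l, s' l (s l v)))"
      using continuous_map_compose[OF st(1) st'(1)] by (simp add: o_def case_prod_unfold)
    show "continuous_map G E (\<lambda>(l, v). (l, t l (t' l v)))"
      using continuous_map_compose[OF st'(2) st(2)] by (simp add: o_def case_prod_unfold)
  qed (use st(3-5) st'(3-5) in auto)
qed

text \<open>A bundle map is linear only on fibres, while the facts on dimensions and images concern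
  maps that are linear on a whole space. Extension from a basis of \<open>S\<close> bridges the
  two.\<close>

lemma linear_bijection_extends:
  fixes s :: "'v::real_vector \<Rightarrow> 'w::real_vector"
  assumes S: "subspace S" and s: "\<And>v w a b. v \<in> S \<Longrightarrow> w \<in> S \<Longrightarrow> s (a *\<^sub>R v + b *\<^sub>R w) = a *\<^sub>R s v + b *\<^sub>R s w"
  obtains g where "linear g" "\<forall>v\<in>S. g v = s v"
proof -
  obtain B where B: "B \<subseteq> S" "independent B" "S \<subseteq> span B"
    using maximal_independent_subset[of S] by blast
  obtain g where g: "linear g" "\<forall>x\<in>B. g x = s x"
    using linear_independent_extend[OF B(2), of s] by (elim exE conjE)
  have s0: "s 0 = 0" using s[of 0 0 0 0] subspace_0[OF S] by simp
  have "v \<in> S \<and> g v = s v" if "v \<in> span B" for v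
    using that
  proof (induction rule: span_induct_alt)
    case base then show ?case using s0 subspace_0[OF S] linear_0[OF g(1)] by simp
  next
    case (step c x y)
    have "x \<in> S" using step B by blast
    then show ?case using step g subspace_add[OF S subspace_scale[OF S]] s[of x y c 1] linear_add[OF g(1)] linear_scale[OF g(1)]
      by auto
  qed
  then show ?thesis using that[OF g(1)] B(3) by blast
qed

lemma dim_linear_bijection:
  assumes S: "subspace S" and s: "\<And>v w a b. v \<in> S \<Longrightarrow> w \<in> S \<Longrightarrow> s (a *\<^sub>R v + b *\<^sub>R w) = a *\<^sub>R s v + b *\<^sub>R s w"
    and inj: "inj_on s S"
  shows "dim (s ` S) = dim S"
proof -
  obtain g where g: "linear g" "\<forall>v\<in>S. g v = s v" by (rule linear_bijection_extends[of S s, OF S s])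
  obtain B where B: "B \<subseteq> S" "independent B" "S \<subseteq> span B"
    using maximal_independent_subset[of S] by blast
  have spB: "span B = S" using B(3) span_minimal[OF B(1) S] by blast
  have gS: "g ` S = s ` S" using g(2) by (simp add: image_def)
  have injg: "inj_on g S" using inj g(2) by (simp add: inj_on_def)
  then have "independent (g ` B)" using linear_independent_injective_image[OF g(1) B(2)] spB by simp
  moreover have "span (g ` B) = s ` S" using linear_span_image[OF g(1), of B] spB gS by simp
  ultimately have "dim (s ` S) = card (g ` B)"
    using dim_eq_card_independent dim_span by metis
  also have "\<dots> = card B" using card_image inj_on_subset[OF injg B(1)] by blast
  also have "\<dots> = dim S" using dim_eq_card_independent[OF B(2)] dim_span[of B] spB by simp
  finally show ?thesis .
qed

lemma bundle_iso_dim: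
  assumes "bundle_iso E F" "prelinear E" and S: "subspace (fibre E l)"
  shows "dim (fibre F l) = dim (fibre E l)" "subspace (fibre F l)"
proof -
  obtain s t where stm: "bundle_maps E F s t" by (rule bundle_isoE[OF assms(1,2)])
  note st = bundle_mapsD[OF stm]
  have eq: "fibre F l = s l ` fibre E l"
  proof (intro equalityI subsetI)
    fix w assume "w \<in> fibre F l"
    then have "(l, t l w) \<in> topspace E" "s l (t l w) = w" using st(4) by (auto simp: fibre_def)
    then show "w \<in> s l ` fibre E l" by (intro image_eqI[of _ _ "t l w"]) (auto simp: fibre_def)
  qed (use st(3) in \<open>auto simp: fibre_def\<close>)
  have "inj_on (s l) (fibre E l)" by (rule inj_on_inverseI[of _ "t l"]) (use st(3) in \<open>auto simp: fibre_def\<close>)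
  then show "dim (fibre F l) = dim (fibre E l)"
    unfolding eq by (intro dim_linear_bijection[OF S]) (use st(5) in \<open>auto simp: fibre_def\<close>)
  have lin: "s l (a *\<^sub>R v + b *\<^sub>R w) = a *\<^sub>R s l v + b *\<^sub>R s l w" if "v \<in> fibre E l" "w \<in> fibre E l" for v w a b
    using st(5) that by (simp add: fibre_def)
  obtain g where g: "linear g" "\<forall>v\<in>fibre E l. g v = s l v"
    by (rule linear_bijection_extends[of "fibre E l" "s l", OF S lin])
  have "fibre F l = g ` fibre E l" unfolding eq using g(2) by (simp add: image_def)
  then show "subspace (fibre F l)" using linear_subspace_image[OF g(1) S] by simp
qed

lemma fibre_over: "l \<in> U \<Longrightarrow> fibre (over E U) l = fibre E l"
  by (simp add: fibre_def)

lemma prelinear_over: "prelinear E \<Longrightarrow> prelinear (over E U)"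
  by (auto simp: prelinear_def fibre_def)

lemma over_over: "V \<subseteq> U \<Longrightarrow> over (over E U) V = over E V"
  by (auto simp: subtopology_subtopology Times_Int_Times Int_absorb1)

lemma bundle_iso_over:
  assumes "bundle_iso E F" "prelinear E"
  shows "bundle_iso (over E U) (over F U)"
proof -
  obtain s t where stm: "bundle_maps E F s t" by (rule bundle_isoE[OF assms])
  note st = bundle_mapsD[OF stm]
  show ?thesis
    by (rule bundle_isoI[where s = s and t = t])
       (use st in \<open>auto simp: continuous_map_in_subtopology continuous_map_from_subtopology\<close>)
qed

lemma bundle_iso_vector_bundle:
  assumes E: "vector_bundle \<Lambda> E" and EF: "bundle_iso E F"
  shows "vector_bundle \<Lambda> F"
proof -
  note pE = vector_bundle_prelinear[OF E]
  have FE: "bundle_iso F E" by (rule bundle_iso_sym[OF EF pE])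
  obtain h where h: "homeomorphic_map F E h" "fibre_preserving F h" using FE by (auto simp: bundle_iso_def)
  have "continuous_map F \<Lambda> (fst \<circ> h)"
    using continuous_map_compose[OF homeomorphic_imp_continuous_map[OF h(1)] vector_bundle_fst[OF E]] .
  then have "continuous_map F \<Lambda> fst"
    by (rule continuous_map_eq) (use h(2) in \<open>auto simp: fibre_preserving_def\<close>)
  moreover have "\<forall>l\<in>topspace \<Lambda>. subspace (fibre F l)"
    using bundle_iso_dim(2)[OF EF pE] E by (auto simp: vector_bundle_def)
  moreover have "\<exists>U n. openin \<Lambda> U \<and> l \<in> U \<and>
        bundle_iso (over F U) (prod_topology (subtopology \<Lambda> U) (Euclidean_space n))" if "l \<in> topspace \<Lambda>" for l
  proof -
    obtain U n where U: "openin \<Lambda> U" "l \<in> U" "bundle_iso (over E U) (prod_topology (subtopology \<Lambda> U) (Euclidean_space n))"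
      using E \<open>l \<in> topspace \<Lambda>\<close> unfolding vector_bundle_def by blast
    have pF: "prelinear F" using bundle_iso_prelinear[OF EF pE] .
    have "bundle_iso (over F U) (over E U)" using bundle_iso_over[OF FE pF] .
    from bundle_iso_trans[OF this U(3) prelinear_over[OF pF]] show ?thesis using U(1,2) by blast
  qed
  ultimately show ?thesis unfolding vector_bundle_def by blast
qed

text \<open>The topology of the image is pulled back along the inverse of \<open>f\<close>. This
  moves a total space to fibres of another type.\<close>

lemma pushforward_topology:
  assumes "inj_on f (topspace E)"
  obtains G where "homeomorphic_map E G f"
proof -
  let ?g = "inv_into (topspace E) f"
  let ?G = "pullback_topology (f ` topspace E) ?g E"
  have gf: "?g (f x) = x" if "x \<in> topspace E" for x using assms that by simp
  have "continuous_map E ?G f"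
  proof (rule continuous_map_pullback')
    show "continuous_map E E (?g \<circ> f)" by (rule continuous_map_eq[OF continuous_map_id]) (simp add: gf)
  qed auto
  moreover have "continuous_map ?G E ?g"
    using continuous_map_pullback[OF continuous_map_id[of E], of "f ` topspace E" ?g] by simp
  ultimately have "homeomorphic_maps E ?G f ?g"
    using gf by (auto simp: homeomorphic_maps_def topspace_pullback_topology)
  then show ?thesis using that homeomorphic_maps_map by blast
qed

section \<open>Coordinate spaces and standard models of vector bundles\<close>

lemma sum_fun_apply: "(\<Sum>k\<in>K. f k) i = (\<Sum>k\<in>K. (f k i :: 'a::comm_monoid_add))"
  by (induction K rule: infinite_finite_induct) (auto simp: zero_fun_def plus_fun_def)

lemma subspace_coordinates: "subspace {x :: nat \<Rightarrow> real. \<forall>i\<ge>n. x i = 0}"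
  by (auto simp: subspace_def scaleR_fun_def)

lemma fibre_trivial: "l \<in> U \<Longrightarrow> l \<in> topspace \<Lambda> \<Longrightarrow> fibre (prod_topology (subtopology \<Lambda> U) (Euclidean_space n)) l = {x. \<forall>i\<ge>n. x i = 0}"
  by (simp add: fibre_def topspace_Euclidean_space)

lemma dim_coordinates: "dim {x :: nat \<Rightarrow> real. \<forall>i\<ge>n. x i = 0} = n"
proof -
  define e where "e k = (\<lambda>i. if i = k then 1 else 0 :: real)" for k :: nat
  have inj: "inj e" by (rule injI) (metis e_def zero_neq_one)
  let ?S = "{x :: nat \<Rightarrow> real. \<forall>i\<ge>n. x i = 0}"
  have ev: "(\<Sum>k<n. u k *\<^sub>R e k) i = (if i < n then u i else 0)" for u i
  proof -
    have "(\<Sum>k<n. u k *\<^sub>R e k) i = (\<Sum>k<n. if k = i then u i else 0)"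
      unfolding sum_fun_apply by (intro sum.cong) (auto simp: scaleR_fun_def e_def)
    then show ?thesis by simp
  qed
  have "independent (e ` {..<n})"
  proof (subst independent_explicit_module, clarsimp)
    fix T u v assume T: "finite T" "T \<subseteq> e ` {..<n}" "(\<Sum>v\<in>T. u v *\<^sub>R v) = 0" "v \<in> T"
    show "u v = 0"
    proof -
      obtain K where K: "K \<subseteq> {..<n}" "T = e ` K" using T(2) by (meson subset_imageE)
      have "(\<Sum>k\<in>K. u (e k) *\<^sub>R e k) = 0" using T(3) K sum.reindex[of e K "\<lambda>v. u v *\<^sub>R v"] inj_on_subset[OF inj] by simp
      moreover obtain k where k: "k \<in> K" "v = e k" using T(4) K by blast
      ultimately have "(\<Sum>j\<in>K. u (e j) *\<^sub>R e j) k = 0" by simp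
      moreover have "(\<Sum>j\<in>K. u (e j) *\<^sub>R e j) k = (\<Sum>j\<in>K. if j = k then u v else 0)"
        unfolding sum_fun_apply by (intro sum.cong) (auto simp: scaleR_fun_def e_def k)
      ultimately show ?thesis using k K(1) finite_subset[OF K(1)] by simp
    qed
  qed
  moreover have "span (e ` {..<n}) = ?S"
  proof
    show "span (e ` {..<n}) \<subseteq> ?S" by (rule span_minimal[OF _ subspace_coordinates]) (auto simp: e_def)
    show "?S \<subseteq> span (e ` {..<n})"
    proof
      fix x assume "x \<in> ?S"
      then have "x = (\<Sum>k<n. x k *\<^sub>R e k)" by (intro ext) (auto simp: ev)
      then show "x \<in> span (e ` {..<n})" by (metis (no_types, lifting) image_eqI span_base span_scale span_sum)
    qed
  qed
  ultimately show ?thesis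
    using dim_eq_card_independent[of "e ` {..<n}"] dim_span[of "e ` {..<n}"] card_image[OF inj_on_subset[OF inj]] by simp
qed

text \<open>Bridges the gap between the index bundle and \<open>KO\<close>, whose bundles have
  fibres in \<open>nat \<Rightarrow> real\<close>. Linear coordinates are chosen in every fibre
  independently, with no continuity from fibre to fibre; the topology is transported along with
  them, so the new bundle is isomorphic to the old one by construction.\<close>

lemma vector_bundle_standardize:
  assumes E: "vector_bundle \<Lambda> E"
  obtains G :: "'l std_total_space" where "bundle_iso E G" "vector_bundle \<Lambda> (G :: ('l, nat \<Rightarrow> real) total_space)"
proof -
  have "\<exists>s t. \<forall>v\<in>fibre E l. t (s v :: nat \<Rightarrow> real) = v \<and>
     (\<forall>w\<in>fibre E l. \<forall>a b. s (a *\<^sub>R v + b *\<^sub>R w) = a *\<^sub>R s v + b *\<^sub>R s w)" if l: "l \<in> topspace \<Lambda>" for l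
  proof -
    obtain U n where U: "openin \<Lambda> U" "l \<in> U" "bundle_iso (over E U) (prod_topology (subtopology \<Lambda> U) (Euclidean_space n))"
      using E l unfolding vector_bundle_def by blast
    obtain s t where "bundle_maps (over E U) (prod_topology (subtopology \<Lambda> U) (Euclidean_space n)) s t"
      by (rule bundle_isoE[OF U(3) prelinear_over[OF vector_bundle_prelinear[OF E]]])
    note st = bundle_mapsD[OF this]
    show ?thesis
      by (rule exI[of _ "s l"], rule exI[of _ "t l"]) (use st(3,5) U(2) in \<open>simp add: fibre_def\<close>)
  qed
  then obtain s t where st: "\<And>l v. l \<in> topspace \<Lambda> \<Longrightarrow> v \<in> fibre E l \<Longrightarrow> t l (s l v :: nat \<Rightarrow> real) = v \<and>
     (\<forall>w\<in>fibre E l. \<forall>a b. s l (a *\<^sub>R v + b *\<^sub>R w) = a *\<^sub>R s l v + b *\<^sub>R s l w)"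
    by metis
  note lE = continuous_map_fst_topspace[OF vector_bundle_fst[OF E]]
  define h where "h = (\<lambda>(l, v). (l, s l v))"
  have "inj_on h (topspace E)"
    by (rule inj_on_inverseI[of _ "\<lambda>(l, v). (l, t l v)"]) (use st lE in \<open>auto simp: h_def fibre_def\<close>)
  then obtain G where G: "homeomorphic_map E G h" by (rule pushforward_topology)
  have "fibre_preserving E h" by (auto simp: fibre_preserving_def h_def)
  moreover have "fibrewise_linear E h"
    unfolding fibrewise_linear_def
  proof (intro allI ballI)
    fix l v w and a b :: real assume v: "v \<in> fibre E l" "w \<in> fibre E l"
    then have "l \<in> topspace \<Lambda>" using lE by (auto simp: fibre_def)
    then show "snd (h (l, a *\<^sub>R v + b *\<^sub>R w)) = a *\<^sub>R snd (h (l, v)) + b *\<^sub>R snd (h (l, w))"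
      using st v by (simp add: h_def)
  qed
  ultimately have "bundle_iso E G" using G unfolding bundle_iso_def by blast
  then show ?thesis using that bundle_iso_vector_bundle[OF E] by blast
qed

section \<open>Whitney sums\<close>

lemma topspace_whitney_sum:
  "topspace (whitney_sum E F) = {(l, (v, w)). (l, v) \<in> topspace E \<and> (l, w) \<in> topspace F}"
  by (auto simp: whitney_sum_def topspace_pullback_topology)

lemma fibre_whitney_sum: "fibre (whitney_sum E F) l = fibre E l \<times> fibre F l"
  by (auto simp: fibre_def topspace_whitney_sum)

lemma continuous_map_whitney_proj:
  "continuous_map (whitney_sum E F) E (\<lambda>p. (fst p, fst (snd p)))"
  "continuous_map (whitney_sum E F) F (\<lambda>p. (fst p, snd (snd p)))"
  using continuous_map_pullback[OF continuous_map_fst[of E F], of "{(l, (v, w)). (l, v) \<in> topspace E \<and> (l, w) \<in> topspace F}" "\<lambda>(l, (v, w)). ((l, v), (l, w))"]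
    continuous_map_pullback[OF continuous_map_snd[of E F], of "{(l, (v, w)). (l, v) \<in> topspace E \<and> (l, w) \<in> topspace F}" "\<lambda>(l, (v, w)). ((l, v), (l, w))"]
  by (simp_all add: whitney_sum_def o_def case_prod_unfold)

lemma continuous_map_into_whitney:
  assumes "continuous_map Z E (\<lambda>z. (a z, b z))" "continuous_map Z F (\<lambda>z. (a z, c z))"
  shows "continuous_map Z (whitney_sum E F) (\<lambda>z. (a z, (b z, c z)))"
  unfolding whitney_sum_def
proof (rule continuous_map_pullback')
  have "continuous_map Z (prod_topology E F) (\<lambda>z. ((a z, b z), (a z, c z)))"
    using assms by (simp add: continuous_map_paired)
  then show "continuous_map Z (prod_topology E F) ((\<lambda>(l, (v, w)). ((l, v), (l, w))) \<circ> (\<lambda>z. (a z, (b z, c z))))"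
    by (simp add: o_def)
qed (use continuous_map_image_subset_topspace[OF assms(1)] continuous_map_image_subset_topspace[OF assms(2)] in auto)

lemma bundle_isoI':
  assumes "continuous_map E F (\<lambda>p. (fst p, s (fst p) (snd p)))" "continuous_map F E (\<lambda>p. (fst p, t (fst p) (snd p)))"
    and "\<And>l v. (l, v) \<in> topspace E \<Longrightarrow> t l (s l v) = v"
    and "\<And>l w. (l, w) \<in> topspace F \<Longrightarrow> s l (t l w) = w"
    and "\<And>l v w a b. (l, v) \<in> topspace E \<Longrightarrow> (l, w) \<in> topspace E \<Longrightarrow> s l (a *\<^sub>R v + b *\<^sub>R w) = a *\<^sub>R s l v + b *\<^sub>R s l w"
  shows "bundle_iso E F"
  by (rule bundle_isoI[where s = s and t = t]) (use assms in \<open>simp_all add: case_prod_unfold\<close>)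

lemma bundle_mapsD':
  assumes "bundle_maps E F s t"
  shows "continuous_map E F (\<lambda>p. (fst p, s (fst p) (snd p)))" "continuous_map F E (\<lambda>p. (fst p, t (fst p) (snd p)))"
  using bundle_mapsD(1,2)[OF assms] by (simp_all add: case_prod_unfold)

lemma prelinear_whitney: "prelinear E \<Longrightarrow> prelinear F \<Longrightarrow> prelinear (whitney_sum E F)"
  unfolding prelinear_def fibre_whitney_sum by auto

lemma whitney_sum_cong:
  assumes "bundle_iso E E'" "bundle_iso F F'" "prelinear E" "prelinear F"
  shows "bundle_iso (whitney_sum E F) (whitney_sum E' F')"
proof -
  obtain s t where st: "bundle_maps E E' s t" by (rule bundle_isoE[OF assms(1,3)])
  obtain u v where uv: "bundle_maps F F' u v" by (rule bundle_isoE[OF assms(2,4)])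
  note s = bundle_mapsD[OF st] and s' = bundle_mapsD'[OF st]
  note u = bundle_mapsD[OF uv] and u' = bundle_mapsD'[OF uv]
  show ?thesis
  proof (rule bundle_isoI'[where s = "\<lambda>l p. (s l (fst p), u l (snd p))" and t = "\<lambda>l p. (t l (fst p), v l (snd p))"])
    show "continuous_map (whitney_sum E F) (whitney_sum E' F') (\<lambda>p. (fst p, s (fst p) (fst (snd p)), u (fst p) (snd (snd p))))"
      using continuous_map_compose[OF continuous_map_whitney_proj(1)[of E F] s'(1)]
        continuous_map_compose[OF continuous_map_whitney_proj(2)[of E F] u'(1)]
      by (intro continuous_map_into_whitney) (simp_all add: o_def)
    show "continuous_map (whitney_sum E' F') (whitney_sum E F) (\<lambda>p. (fst p, t (fst p) (fst (snd p)), v (fst p) (snd (snd p))))"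
      using continuous_map_compose[OF continuous_map_whitney_proj(1)[of E' F'] s'(2)]
        continuous_map_compose[OF continuous_map_whitney_proj(2)[of E' F'] u'(2)]
      by (intro continuous_map_into_whitney) (simp_all add: o_def)
  qed (use s u in \<open>auto simp: topspace_whitney_sum\<close>)
qed

lemma whitney_sum_commute: "bundle_iso (whitney_sum E F) (whitney_sum F E)"
  by (rule bundle_isoI'[where s = "\<lambda>l p. (snd p, fst p)" and t = "\<lambda>l p. (snd p, fst p)"])
     (auto intro!: continuous_map_into_whitney continuous_map_whitney_proj)

lemma whitney_sum_assoc: "bundle_iso (whitney_sum (whitney_sum E F) G) (whitney_sum E (whitney_sum F G))"
proof (rule bundle_isoI'[where s = "\<lambda>l p. (fst (fst p), (snd (fst p), snd p))" and t = "\<lambda>l p. ((fst p, fst (snd p)), snd (snd p))"])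
  let ?L = "whitney_sum (whitney_sum E F) G" and ?R = "whitney_sum E (whitney_sum F G)"
  note p = continuous_map_whitney_proj
  show "continuous_map ?L ?R (\<lambda>p. (fst p, fst (fst (snd p)), snd (fst (snd p)), snd (snd p)))"
    using continuous_map_compose[OF p(1)[of "whitney_sum E F" G] p(1)[of E F]]
      continuous_map_compose[OF p(1)[of "whitney_sum E F" G] p(2)[of E F]] p(2)[of "whitney_sum E F" G]
    by (intro continuous_map_into_whitney) (simp_all add: o_def)
  show "continuous_map ?R ?L (\<lambda>p. (fst p, (fst (snd p), fst (snd (snd p))), snd (snd (snd p))))"
    using continuous_map_compose[OF p(2)[of E "whitney_sum F G"] p(1)[of F G]]
      continuous_map_compose[OF p(2)[of E "whitney_sum F G"] p(2)[of F G]] p(1)[of E "whitney_sum F G"]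
    by (intro continuous_map_into_whitney) (simp_all add: o_def)
qed auto

lemma whitney_sum_trivial_0:
  assumes "continuous_map E \<Lambda> fst"
  shows "bundle_iso (whitney_sum E (trivial_bundle \<Lambda> 0)) E"
proof (rule bundle_isoI'[where s = "\<lambda>l p. fst p" and t = "\<lambda>l v. (v, 0)"])
  show "continuous_map (whitney_sum E (trivial_bundle \<Lambda> 0)) E (\<lambda>p. (fst p, fst (snd p)))"
    by (rule continuous_map_whitney_proj)
  show "continuous_map E (whitney_sum E (trivial_bundle \<Lambda> 0)) (\<lambda>p. (fst p, snd p, 0))"
    by (intro continuous_map_into_whitney)
       (auto simp: trivial_bundle_def continuous_map_paired topspace_Euclidean_space assms)
qed (auto simp: topspace_whitney_sum trivial_bundle_def topspace_Euclidean_space)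

lemma continuous_map_Euclidean_iff:
  "continuous_map Z (Euclidean_space n) f \<longleftrightarrow>
     (\<forall>i. continuous_map Z euclideanreal (\<lambda>z. f z i)) \<and> (\<forall>z\<in>topspace Z. \<forall>i\<ge>n. f z i = 0)"
  by (auto simp: Euclidean_space_def continuous_map_in_subtopology continuous_map_componentwise_UNIV)

lemma whitney_sum_trivial:
  "bundle_iso (whitney_sum (prod_topology B (Euclidean_space n)) (prod_topology B (Euclidean_space m)))
     (prod_topology B (Euclidean_space (n + m)))" (is "bundle_iso (whitney_sum ?E ?F) ?G")
proof (rule bundle_isoI'[where s = "\<lambda>l p i. if i < n then fst p i else snd p (i - n)"
      and t = "\<lambda>l x. (\<lambda>i. if i < n then x i else 0, \<lambda>i. x (i + n))"])
  have c: "continuous_map (prod_topology B (Euclidean_space k)) euclideanreal (\<lambda>p. snd p i)" for k i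
    using continuous_map_snd[of B "Euclidean_space k"] unfolding continuous_map_Euclidean_iff by simp
  have b: "continuous_map (whitney_sum ?E ?F) B fst"
    using continuous_map_compose[OF continuous_map_whitney_proj(1)[of ?E ?F] continuous_map_fst] by (simp add: o_def)
  have 1: "continuous_map (whitney_sum ?E ?F) euclideanreal (\<lambda>p. fst (snd p) i)" for i
    using continuous_map_compose[OF continuous_map_whitney_proj(1)[of ?E ?F] c[of n i]] by (simp add: o_def)
  have 2: "continuous_map (whitney_sum ?E ?F) euclideanreal (\<lambda>p. snd (snd p) i)" for i
    using continuous_map_compose[OF continuous_map_whitney_proj(2)[of ?E ?F] c[of m i]] by (simp add: o_def)
  show "continuous_map (whitney_sum ?E ?F) ?G (\<lambda>p. (fst p, \<lambda>i. if i < n then fst (snd p) i else snd (snd p) (i - n)))"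
    unfolding continuous_map_paired continuous_map_Euclidean_iff
    using b 1 2 by (auto simp: topspace_whitney_sum topspace_Euclidean_space)
  show "continuous_map ?G (whitney_sum ?E ?F) (\<lambda>p. (fst p, \<lambda>i. if i < n then snd p i else 0, \<lambda>i. snd p (i + n)))"
    by (intro continuous_map_into_whitney; unfold continuous_map_paired continuous_map_Euclidean_iff)
       (use c[of "n + m"] in \<open>auto simp: topspace_Euclidean_space continuous_map_fst\<close>)
qed (auto simp: topspace_whitney_sum topspace_Euclidean_space fun_eq_iff scaleR_fun_def)

lemma over_whitney_sum: "bundle_iso (over (whitney_sum E F) U) (whitney_sum (over E U) (over F U))"
proof (rule bundle_isoI'[where s = "\<lambda>l p. p" and t = "\<lambda>l p. p"])
  let ?L = "over (whitney_sum E F) U" and ?R = "whitney_sum (over E U) (over F U)"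
  have "continuous_map ?L (over E U) (\<lambda>p. (fst p, fst (snd p)))" "continuous_map ?L (over F U) (\<lambda>p. (fst p, snd (snd p)))"
    by (auto simp: continuous_map_in_subtopology intro!: continuous_map_from_subtopology continuous_map_whitney_proj)
  from continuous_map_into_whitney[OF this] show "continuous_map ?L ?R (\<lambda>p. (fst p, snd p))" by simp
  have "continuous_map ?R E (\<lambda>p. (fst p, fst (snd p)))" "continuous_map ?R F (\<lambda>p. (fst p, snd (snd p)))"
    using continuous_map_whitney_proj[of "over E U" "over F U"] by (auto simp: continuous_map_in_subtopology)
  from continuous_map_into_whitney[OF this] show "continuous_map ?R ?L (\<lambda>p. (fst p, snd p))"
    by (simp add: continuous_map_in_subtopology) (auto simp: topspace_whitney_sum)
qed auto

lemma over_prod_topology: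
  "U \<subseteq> V \<Longrightarrow> over (prod_topology (subtopology B V) X) U = prod_topology (subtopology B U) X"
  unfolding prod_topology_subtopology subtopology_subtopology
  by (rule arg_cong[where f = "subtopology (prod_topology B X)"]) auto

lemma whitney_sum_local_trivial:
  assumes U: "bundle_iso (over E U) (prod_topology (subtopology \<Lambda> U) (Euclidean_space n))"
    and V: "bundle_iso (over F V) (prod_topology (subtopology \<Lambda> V) (Euclidean_space m))"
    and pE: "prelinear E" and pF: "prelinear F"
  shows "bundle_iso (over (whitney_sum E F) (U \<inter> V)) (prod_topology (subtopology \<Lambda> (U \<inter> V)) (Euclidean_space (n + m)))"
proof -
  let ?W = "U \<inter> V"
  have 1: "bundle_iso (over E ?W) (prod_topology (subtopology \<Lambda> ?W) (Euclidean_space n))"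
    using bundle_iso_over[OF U prelinear_over[OF pE], of ?W] by (simp add: over_over over_prod_topology)
  have 2: "bundle_iso (over F ?W) (prod_topology (subtopology \<Lambda> ?W) (Euclidean_space m))"
    using bundle_iso_over[OF V prelinear_over[OF pF], of ?W] by (simp add: over_over over_prod_topology)
  have p: "prelinear (over (whitney_sum E F) ?W)" by (intro prelinear_over prelinear_whitney pE pF)
  show ?thesis
    by (rule bundle_iso_trans[OF bundle_iso_trans[OF over_whitney_sum whitney_sum_cong[OF 1 2 prelinear_over[OF pE] prelinear_over[OF pF]] p] whitney_sum_trivial p])
qed

lemma vector_bundle_whitney_sum:
  assumes E: "vector_bundle \<Lambda> E" and F: "vector_bundle \<Lambda> F"
  shows "vector_bundle \<Lambda> (whitney_sum E F)"
  unfolding vector_bundle_def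
proof (intro conjI ballI)
  note pE = vector_bundle_prelinear[OF E] and pF = vector_bundle_prelinear[OF F]
  show "continuous_map (whitney_sum E F) \<Lambda> fst"
    using continuous_map_compose[OF continuous_map_whitney_proj(1)[of E F] vector_bundle_fst[OF E]] by (simp add: o_def)
  fix l assume l: "l \<in> topspace \<Lambda>"
  then show "subspace (fibre (whitney_sum E F) l)"
    using E F unfolding vector_bundle_def fibre_whitney_sum by (intro subspace_Times) blast+
  obtain U n where U: "openin \<Lambda> U" "l \<in> U" "bundle_iso (over E U) (prod_topology (subtopology \<Lambda> U) (Euclidean_space n))"
    using E l unfolding vector_bundle_def by blast
  obtain V m where V: "openin \<Lambda> V" "l \<in> V" "bundle_iso (over F V) (prod_topology (subtopology \<Lambda> V) (Euclidean_space m))"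
    using F l unfolding vector_bundle_def by blast
  have "bundle_iso (over (whitney_sum E F) (U \<inter> V)) (prod_topology (subtopology \<Lambda> (U \<inter> V)) (Euclidean_space (n + m)))"
    by (rule whitney_sum_local_trivial[OF U(3) V(3) pE pF])
  then show "\<exists>U n. openin \<Lambda> U \<and> l \<in> U \<and>
        bundle_iso (over (whitney_sum E F) U) (prod_topology (subtopology \<Lambda> U) (Euclidean_space n))"
    using U V by (intro exI[of _ "U \<inter> V"]) auto
qed

lemma vector_bundle_trivial: "vector_bundle \<Lambda> (trivial_bundle \<Lambda> n)"
  unfolding vector_bundle_def trivial_bundle_def
proof (intro conjI ballI)
  fix l assume l: "l \<in> topspace \<Lambda>"
  show "subspace (fibre (prod_topology \<Lambda> (Euclidean_space n)) l)"
    using l subspace_coordinates by (simp add: fibre_def topspace_Euclidean_space)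
  have "over (prod_topology \<Lambda> (Euclidean_space n)) (topspace \<Lambda>) = prod_topology (subtopology \<Lambda> (topspace \<Lambda>)) (Euclidean_space n)"
    using over_prod_topology[of "topspace \<Lambda>" UNIV \<Lambda>] by simp
  then show "\<exists>U k. openin \<Lambda> U \<and> l \<in> U \<and>
        bundle_iso (over (prod_topology \<Lambda> (Euclidean_space n)) U) (prod_topology (subtopology \<Lambda> U) (Euclidean_space k))"
    using l bundle_iso_refl by (intro exI[of _ "topspace \<Lambda>"] exI[of _ n]) auto
qed (simp add: continuous_map_fst)

section \<open>The groups of virtual bundles\<close>

lemma bundle_class_eq:
  assumes "vector_bundle \<Lambda> E" "bundle_iso E F"
  shows "bundle_class \<Lambda> E = bundle_class \<Lambda> F"
proof -
  note pE = vector_bundle_prelinear[OF assms(1)]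
  have pF: "prelinear F" using bundle_iso_prelinear[OF assms(2) pE] .
  have "bundle_iso E G \<longleftrightarrow> bundle_iso F G" for G :: "('a, nat \<Rightarrow> real) total_space"
    using bundle_iso_trans[OF assms(2) _ pE] bundle_iso_trans[OF bundle_iso_sym[OF assms(2) pE] _ pF] by blast
  then show ?thesis by (simp add: bundle_class_def)
qed

lemma bundle_class_eqD:
  assumes E: "vector_bundle \<Lambda> E" and F: "vector_bundle \<Lambda> F" and eq: "bundle_class \<Lambda> E = bundle_class \<Lambda> F"
  shows "bundle_iso E F"
proof -
  obtain G :: "'a std_total_space" where G: "bundle_iso E G" "vector_bundle \<Lambda> G"
    by (rule vector_bundle_standardize[OF E])
  then have "G \<in> bundle_class \<Lambda> F" using eq by (auto simp: bundle_class_def)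
  then have "bundle_iso F G" by (simp add: bundle_class_def)
  then show ?thesis
    using bundle_iso_trans[OF G(1) bundle_iso_sym] vector_bundle_prelinear E F by metis
qed

lemma bundle_class_in_Vect:
  assumes E: "vector_bundle \<Lambda> E"
  shows "bundle_class \<Lambda> E \<in> carrier (Vect \<Lambda>)"
proof -
  obtain G :: "'a std_total_space" where G: "bundle_iso E G" "vector_bundle \<Lambda> G"
    by (rule vector_bundle_standardize[OF E])
  have "bundle_class \<Lambda> E = bundle_class \<Lambda> G" by (rule bundle_class_eq[OF E G(1)])
  then show ?thesis using G(2) by (simp add: Vect_def)
qed

lemma Vect_carrierE:
  assumes "p \<in> carrier (Vect \<Lambda>)"
  obtains E :: "'l std_total_space" where "vector_bundle \<Lambda> (E :: ('l, nat \<Rightarrow> real) total_space)" "p = bundle_class \<Lambda> E"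
  using assms by (auto simp: Vect_def)

text \<open>Again a union over representatives collapses. \<open>E\<close> and \<open>F\<close> may
  have fibres of any type; their classes are non-empty because each bundle has a standard
  model.\<close>

lemma Vect_mult:
  assumes E: "vector_bundle \<Lambda> E" and F: "vector_bundle \<Lambda> F"
  shows "bundle_class \<Lambda> E \<otimes>\<^bsub>Vect \<Lambda>\<^esub> bundle_class \<Lambda> F = bundle_class \<Lambda> (whitney_sum E F)"
proof -
  have eq: "bundle_class \<Lambda> (whitney_sum E' F') = bundle_class \<Lambda> (whitney_sum E F)"
    if "E' \<in> bundle_class \<Lambda> E" "F' \<in> bundle_class \<Lambda> F" for E' F'
  proof -
    have "bundle_iso (whitney_sum E F) (whitney_sum E' F')"
      using that E F by (intro whitney_sum_cong vector_bundle_prelinear) (auto simp: bundle_class_def)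
    then show ?thesis using bundle_class_eq[OF vector_bundle_whitney_sum[OF E F]] by metis
  qed
  have ne: "bundle_class \<Lambda> E \<noteq> {}" "bundle_class \<Lambda> F \<noteq> {}"
  proof -
    obtain G :: "'a std_total_space" where "bundle_iso E G" "vector_bundle \<Lambda> G"
      by (rule vector_bundle_standardize[OF E])
    then show "bundle_class \<Lambda> E \<noteq> {}" by (auto simp: bundle_class_def)
    obtain G :: "'a std_total_space" where "bundle_iso F G" "vector_bundle \<Lambda> G"
      by (rule vector_bundle_standardize[OF F])
    then show "bundle_class \<Lambda> F \<noteq> {}" by (auto simp: bundle_class_def)
  qed
  have "bundle_class \<Lambda> E \<otimes>\<^bsub>Vect \<Lambda>\<^esub> bundle_class \<Lambda> F
      = (\<Union>E'\<in>bundle_class \<Lambda> E. \<Union>F'\<in>bundle_class \<Lambda> F. bundle_class \<Lambda> (whitney_sum E' F'))"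
    by (simp add: Vect_def)
  also have "\<dots> = (\<Union>E'\<in>bundle_class \<Lambda> E. \<Union>F'\<in>bundle_class \<Lambda> F. bundle_class \<Lambda> (whitney_sum E F))"
    by (intro SUP_cong refl eq)
  also have "\<dots> = bundle_class \<Lambda> (whitney_sum E F)" using ne by (simp only: UN_constant if_False)
  finally show ?thesis .
qed

lemma comm_monoid_Vect: "comm_monoid (Vect \<Lambda>)"
proof (rule comm_monoidI)
  note W = vector_bundle_whitney_sum
  have one: "\<one>\<^bsub>Vect \<Lambda>\<^esub> = bundle_class \<Lambda> (trivial_bundle \<Lambda> 0)" by (simp add: Vect_def)
  show "\<one>\<^bsub>Vect \<Lambda>\<^esub> \<in> carrier (Vect \<Lambda>)"
    unfolding one by (rule bundle_class_in_Vect[OF vector_bundle_trivial])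
  fix x assume "x \<in> carrier (Vect \<Lambda>)"
  then obtain E :: "'a std_total_space" where E: "vector_bundle \<Lambda> E" "x = bundle_class \<Lambda> E" by (rule Vect_carrierE)
  have triv: "vector_bundle \<Lambda> (trivial_bundle \<Lambda> 0)" by (rule vector_bundle_trivial)
  have "bundle_class \<Lambda> (whitney_sum (trivial_bundle \<Lambda> 0) E) = bundle_class \<Lambda> (whitney_sum E (trivial_bundle \<Lambda> 0))"
    by (rule bundle_class_eq[OF W[OF triv E(1)] whitney_sum_commute])
  also have "\<dots> = bundle_class \<Lambda> E"
    by (rule bundle_class_eq[OF W[OF E(1) triv] whitney_sum_trivial_0[OF vector_bundle_fst[OF E(1)]]])
  finally show "\<one>\<^bsub>Vect \<Lambda>\<^esub> \<otimes>\<^bsub>Vect \<Lambda>\<^esub> x = x" unfolding one E(2) Vect_mult[OF triv E(1)] .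
  fix y assume "y \<in> carrier (Vect \<Lambda>)"
  then obtain F :: "'a std_total_space" where F: "vector_bundle \<Lambda> F" "y = bundle_class \<Lambda> F" by (rule Vect_carrierE)
  show "x \<otimes>\<^bsub>Vect \<Lambda>\<^esub> y \<in> carrier (Vect \<Lambda>)"
    unfolding E(2) F(2) Vect_mult[OF E(1) F(1)] by (rule bundle_class_in_Vect[OF W[OF E(1) F(1)]])
  show "x \<otimes>\<^bsub>Vect \<Lambda>\<^esub> y = y \<otimes>\<^bsub>Vect \<Lambda>\<^esub> x"
    unfolding E(2) F(2) Vect_mult[OF E(1) F(1)] Vect_mult[OF F(1) E(1)]
    by (rule bundle_class_eq[OF W[OF E(1) F(1)] whitney_sum_commute])
  fix z assume "z \<in> carrier (Vect \<Lambda>)"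
  then obtain G :: "'a std_total_space" where G: "vector_bundle \<Lambda> G" "z = bundle_class \<Lambda> G" by (rule Vect_carrierE)
  show "x \<otimes>\<^bsub>Vect \<Lambda>\<^esub> y \<otimes>\<^bsub>Vect \<Lambda>\<^esub> z = x \<otimes>\<^bsub>Vect \<Lambda>\<^esub> (y \<otimes>\<^bsub>Vect \<Lambda>\<^esub> z)"
    unfolding E(2) F(2) G(2) Vect_mult[OF E(1) F(1)] Vect_mult[OF F(1) G(1)]
      Vect_mult[OF W[OF E(1) F(1)] G(1)] Vect_mult[OF E(1) W[OF F(1) G(1)]]
    by (rule bundle_class_eq[OF W[OF W[OF E(1) F(1)] G(1)] whitney_sum_assoc])
qed

section \<open>Ranks of virtual bundles and the reduced group\<close>

lemma local_trivial_dim: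
  assumes "bundle_iso (over E U) (prod_topology (subtopology \<Lambda> U) (Euclidean_space n))"
    and "prelinear E" "l \<in> U" "l \<in> topspace \<Lambda>" "subspace (fibre E l)"
  shows "dim (fibre E l) = n"
proof -
  have "dim (fibre (prod_topology (subtopology \<Lambda> U) (Euclidean_space n)) l) = dim (fibre (over E U) l)"
    by (rule bundle_iso_dim(1)[OF assms(1)]) (use assms in \<open>auto simp: prelinear_over fibre_over\<close>)
  then show ?thesis using assms by (simp add: fibre_trivial dim_coordinates fibre_over)
qed

text \<open>Ranks are read off in trivializations over a common neighbourhood, where the sum is a
  trivial bundle of rank \<open>n + m\<close>.\<close>

lemma dim_fibre_whitney_sum:
  assumes E: "vector_bundle \<Lambda> E" and F: "vector_bundle \<Lambda> F" and l: "l \<in> topspace \<Lambda>"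
  shows "dim (fibre (whitney_sum E F) l) = dim (fibre E l) + dim (fibre F l)"
proof -
  note pE = vector_bundle_prelinear[OF E] and pF = vector_bundle_prelinear[OF F]
  note W = vector_bundle_whitney_sum[OF E F]
  obtain U n where U: "l \<in> U" "bundle_iso (over E U) (prod_topology (subtopology \<Lambda> U) (Euclidean_space n))"
    using E l unfolding vector_bundle_def by blast
  obtain V m where V: "l \<in> V" "bundle_iso (over F V) (prod_topology (subtopology \<Lambda> V) (Euclidean_space m))"
    using F l unfolding vector_bundle_def by blast
  have s: "subspace (fibre E l)" "subspace (fibre F l)" "subspace (fibre (whitney_sum E F) l)"
    using E F W l by (simp_all add: vector_bundle_def)
  have "dim (fibre E l) = n" by (rule local_trivial_dim[OF U(2) pE U(1) l s(1)])
  moreover have "dim (fibre F l) = m" by (rule local_trivial_dim[OF V(2) pF V(1) l s(2)])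
  moreover have "dim (fibre (whitney_sum E F) l) = n + m"
    by (rule local_trivial_dim[OF whitney_sum_local_trivial[OF U(2) V(2) pE pF] prelinear_whitney[OF pE pF] _ l s(3)])
       (use U V in simp)
  ultimately show ?thesis by simp
qed

lemma dim_bundle_class_eq:
  assumes E: "vector_bundle \<Lambda> E" and F: "vector_bundle \<Lambda> F" and "bundle_class \<Lambda> E = bundle_class \<Lambda> F" and l: "l \<in> topspace \<Lambda>"
  shows "dim (fibre E l) = dim (fibre F l)"
  using bundle_iso_dim(1)[OF bundle_class_eqD[OF assms(1-3)] vector_bundle_prelinear[OF E], of l] E l
  by (simp add: vector_bundle_def)

lemma mem_bundle_class_dim:
  assumes E: "vector_bundle \<Lambda> E" and "G \<in> bundle_class \<Lambda> E" and l: "l \<in> topspace \<Lambda>"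
  shows "dim (fibre G l) = dim (fibre E l)"
  using bundle_iso_dim(1)[OF _ vector_bundle_prelinear[OF E], of G l] assms by (simp add: vector_bundle_def bundle_class_def)

text \<open>If \<open>E' - F'\<close> represents the same class as \<open>E - F\<close>, then
  \<open>E + F' + K\<close> and \<open>E' + F + K\<close> are isomorphic for some \<open>K\<close>.
  Ranks add and that of \<open>K\<close> cancels, so the number described by \<open>THE\<close> is
  unique.\<close>

lemma ko_rank_ko_diff:
  assumes E: "vector_bundle \<Lambda> E" and F: "vector_bundle \<Lambda> F"
  shows "ko_rank \<Lambda> (ko_diff \<Lambda> E F) = (\<lambda>l\<in>topspace \<Lambda>. int (dim (fibre E l)) - int (dim (fibre F l)))"
  unfolding ko_rank_def
proof (rule restrict_ext)
  fix l assume l: "l \<in> topspace \<Lambda>"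
  interpret M: comm_monoid "Vect \<Lambda>" by (rule comm_monoid_Vect)
  note W = vector_bundle_whitney_sum and d = dim_fibre_whitney_sum[OF _ _ l]
  let ?r = "int (dim (fibre E l)) - int (dim (fibre F l))"
  have unique: "int (dim (fibre E'' l)) - int (dim (fibre F'' l)) = ?r"
    if PQ: "(P, Q) \<in> ko_diff \<Lambda> E F" "E'' \<in> P" "F'' \<in> Q" for P Q E'' F''
  proof -
    obtain k where k: "P \<in> carrier (Vect \<Lambda>)" "Q \<in> carrier (Vect \<Lambda>)" "k \<in> carrier (Vect \<Lambda>)"
      and eq: "bundle_class \<Lambda> E \<otimes>\<^bsub>Vect \<Lambda>\<^esub> Q \<otimes>\<^bsub>Vect \<Lambda>\<^esub> k = P \<otimes>\<^bsub>Vect \<Lambda>\<^esub> bundle_class \<Lambda> F \<otimes>\<^bsub>Vect \<Lambda>\<^esub> k"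
      using PQ(1) by (auto simp: ko_diff_def formal_diff_def M.grothendieck_rel_iff)
    obtain E' :: "'a std_total_space" where E': "vector_bundle \<Lambda> E'" "P = bundle_class \<Lambda> E'" using k(1) by (rule Vect_carrierE)
    obtain F' :: "'a std_total_space" where F': "vector_bundle \<Lambda> F'" "Q = bundle_class \<Lambda> F'" using k(2) by (rule Vect_carrierE)
    obtain K :: "'a std_total_space" where K: "vector_bundle \<Lambda> K" "k = bundle_class \<Lambda> K" using k(3) by (rule Vect_carrierE)
    have "bundle_class \<Lambda> (whitney_sum (whitney_sum E F') K) = bundle_class \<Lambda> (whitney_sum (whitney_sum E' F) K)"
      using eq unfolding E'(2) F'(2) K(2)
      by (simp add: Vect_mult W E E'(1) F F'(1) K(1))
    from dim_bundle_class_eq[OF _ _ this l]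
    have "dim (fibre E l) + dim (fibre F' l) = dim (fibre E' l) + dim (fibre F l)"
      by (simp add: d W E E'(1) F F'(1) K(1))
    moreover have "dim (fibre E'' l) = dim (fibre E' l)" "dim (fibre F'' l) = dim (fibre F' l)"
      using mem_bundle_class_dim[OF E'(1) _ l] mem_bundle_class_dim[OF F'(1) _ l] PQ E' F' by auto
    ultimately show ?thesis by linarith
  qed
  obtain E' :: "'a std_total_space" where E': "bundle_iso E E'" "vector_bundle \<Lambda> E'"
    by (rule vector_bundle_standardize[OF E])
  obtain F' :: "'a std_total_space" where F': "bundle_iso F F'" "vector_bundle \<Lambda> F'"
    by (rule vector_bundle_standardize[OF F])
  have mem: "(bundle_class \<Lambda> E, bundle_class \<Lambda> F) \<in> ko_diff \<Lambda> E F" "E' \<in> bundle_class \<Lambda> E" "F' \<in> bundle_class \<Lambda> F"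
    using E' F' bundle_class_in_Vect[OF E] bundle_class_in_Vect[OF F]
    by (auto simp: ko_diff_def formal_diff_def M.grothendieck_rel_iff bundle_class_def)
  show "(THE k. \<exists>(P, Q)\<in>ko_diff \<Lambda> E F. \<exists>E\<in>P. \<exists>F\<in>Q. k = int (dim (fibre E l)) - int (dim (fibre F l))) = ?r"
  proof (rule the_equality)
    show "\<exists>(P, Q)\<in>ko_diff \<Lambda> E F. \<exists>E'\<in>P. \<exists>F'\<in>Q. ?r = int (dim (fibre E' l)) - int (dim (fibre F' l))"
      using unique[OF mem] mem by (intro bexI[of _ "(bundle_class \<Lambda> E, bundle_class \<Lambda> F)"]) (auto intro!: bexI)
  qed (use unique in auto)
qed

lemma KO_carrierE:
  assumes "c \<in> carrier (KO \<Lambda>)"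
  obtains E F where "vector_bundle \<Lambda> (E :: ('l, nat \<Rightarrow> real) total_space)" "vector_bundle \<Lambda> (F :: ('l, nat \<Rightarrow> real) total_space)"
    "c = ko_diff \<Lambda> E F"
proof -
  interpret M: comm_monoid "Vect \<Lambda>" by (rule comm_monoid_Vect)
  obtain a b where ab: "a \<in> carrier (Vect \<Lambda>)" "b \<in> carrier (Vect \<Lambda>)" "c = formal_diff (Vect \<Lambda>) a b"
    using assms unfolding KO_def by (rule M.grothendieck_group_carrierE)
  obtain E :: "'l std_total_space" where E: "vector_bundle \<Lambda> E" "a = bundle_class \<Lambda> E" using ab(1) by (rule Vect_carrierE)
  obtain F :: "'l std_total_space" where F: "vector_bundle \<Lambda> F" "b = bundle_class \<Lambda> F" using ab(2) by (rule Vect_carrierE)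
  show ?thesis by (rule that[OF E(1) F(1)]) (simp add: ab E F ko_diff_def)
qed

lemma ko_diff_in_KO:
  assumes "vector_bundle \<Lambda> E" "vector_bundle \<Lambda> F"
  shows "ko_diff \<Lambda> E F \<in> carrier (KO \<Lambda>)"
  unfolding ko_diff_def KO_def
  by (rule comm_monoid.formal_diff_in_carrier[OF comm_monoid_Vect]) (intro bundle_class_in_Vect assms)+

lemma comm_group_KO: "comm_group (KO \<Lambda>)"
  unfolding KO_def by (rule comm_monoid.comm_group_grothendieck_group[OF comm_monoid_Vect])

lemma ko_diff_mult:
  assumes "vector_bundle \<Lambda> E" "vector_bundle \<Lambda> F" "vector_bundle \<Lambda> E'" "vector_bundle \<Lambda> F'"
  shows "ko_diff \<Lambda> E F \<otimes>\<^bsub>KO \<Lambda>\<^esub> ko_diff \<Lambda> E' F' = ko_diff \<Lambda> (whitney_sum E E') (whitney_sum F F')"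
  unfolding ko_diff_def KO_def
  by (subst comm_monoid.formal_diff_mult[OF comm_monoid_Vect]) (simp_all add: bundle_class_in_Vect Vect_mult assms)

text \<open>Makes the carrier of the reduced group the kernel of a homomorphism, hence a subgroup.
  The target has one copy of the integers for each base point, because the rank is a function on the
  base.\<close>

lemma ko_rank_hom: "group_hom (KO \<Lambda>) (product_group (topspace \<Lambda>) (\<lambda>_. integer_group)) (ko_rank \<Lambda>)"
proof -
  let ?H = "product_group (topspace \<Lambda>) (\<lambda>_. integer_group)"
  have H: "Group.group ?H" by (intro product_group) (auto)
  have "ko_rank \<Lambda> \<in> hom (KO \<Lambda>) ?H"
  proof (rule homI)
    fix x assume "x \<in> carrier (KO \<Lambda>)"
    then obtain E F where E: "vector_bundle \<Lambda> (E :: ('a, nat \<Rightarrow> real) total_space)" "vector_bundle \<Lambda> (F :: ('a, nat \<Rightarrow> real) total_space)" "x = ko_diff \<Lambda> E F"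
      by (rule KO_carrierE)
    show "ko_rank \<Lambda> x \<in> carrier ?H"
      unfolding E(3) ko_rank_ko_diff[OF E(1,2)] by (auto simp: product_group_def integer_group_def)
    fix y assume "y \<in> carrier (KO \<Lambda>)"
    then obtain E' F' where E': "vector_bundle \<Lambda> (E' :: ('a, nat \<Rightarrow> real) total_space)" "vector_bundle \<Lambda> (F' :: ('a, nat \<Rightarrow> real) total_space)" "y = ko_diff \<Lambda> E' F'"
      by (rule KO_carrierE)
    show "ko_rank \<Lambda> (x \<otimes>\<^bsub>KO \<Lambda>\<^esub> y) = ko_rank \<Lambda> x \<otimes>\<^bsub>?H\<^esub> ko_rank \<Lambda> y"
      unfolding E(3) E'(3) ko_diff_mult[OF E(1,2) E'(1,2)] ko_rank_ko_diff[OF E(1,2)] ko_rank_ko_diff[OF E'(1,2)]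
        ko_rank_ko_diff[OF vector_bundle_whitney_sum[OF E(1) E'(1)] vector_bundle_whitney_sum[OF E(2) E'(2)]]
      using E(1,2) E'(1,2)
      by (auto simp: product_group_def integer_group_def dim_fibre_whitney_sum fun_eq_iff restrict_def)
  qed
  then show ?thesis
    using H comm_group.axioms(2)[OF comm_group_KO] by (simp add: group_hom_def group_hom_axioms_def)
qed

lemma group_KO_reduced: "Group.group (KO_reduced \<Lambda>)"
  unfolding KO_reduced_def
  by (rule subgroup.subgroup_is_group[OF group_hom.subgroup_kernel[OF ko_rank_hom] comm_group.axioms(2)[OF comm_group_KO]])

lemma ko_diff_in_KO_reduced:
  assumes E: "vector_bundle \<Lambda> E" and F: "vector_bundle \<Lambda> F"
    and rank: "\<And>l. l \<in> topspace \<Lambda> \<Longrightarrow> dim (fibre E l) = dim (fibre F l)"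
  shows "ko_diff \<Lambda> E F \<in> carrier (KO_reduced \<Lambda>)"
  using ko_diff_in_KO[OF E F] rank
  by (auto simp: KO_reduced_def kernel_def ko_rank_ko_diff[OF E F] product_group_def integer_group_def restrict_def)

lemma J_proj_eq_one:
  assumes E: "vector_bundle \<Lambda> (E :: 'l std_total_space)" and F: "vector_bundle \<Lambda> (F :: 'l std_total_space)"
    and rank: "\<And>l. l \<in> topspace \<Lambda> \<Longrightarrow> dim (fibre E l) = dim (fibre F l)"
    and "stably_fibre_homotopy_equivalent \<Lambda> E F"
  shows "J_proj \<Lambda> (ko_diff \<Lambda> E F) = \<one>\<^bsub>J_group \<Lambda>\<^esub>"
proof -
  interpret R: Group.group "KO_reduced \<Lambda>" by (rule group_KO_reduced)
  have T: "subgroup (T_group \<Lambda>) (KO_reduced \<Lambda>)"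
    unfolding T_group_def by (rule R.generate_is_subgroup) blast
  have c: "ko_diff \<Lambda> E F \<in> carrier (KO_reduced \<Lambda>)" by (rule ko_diff_in_KO_reduced[OF E F rank])
  have "ko_diff \<Lambda> E F \<in> T_group \<Lambda>"
    unfolding T_group_def using c E F assms(4) by (intro generate.incl) blast
  then show ?thesis
    using R.coset_join2[OF c T] by (simp add: J_proj_def J_group_def FactGroup_def)
qed

section \<open>Transport of sphere bundles and a criterion for triviality in the J-group\<close>

lemma fibre_metric_transport:
  assumes g: "fibre_metric \<Lambda> E g" and iso: "bundle_iso E F" and pE: "prelinear E"
  obtains h k where "fibre_metric \<Lambda> F h" "fibre_homeo (sphere_bundle E g) (sphere_bundle F h) k"
proof -
  obtain s t where m: "bundle_maps E F s t" by (rule bundle_isoE[OF iso pE])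
  note st = bundle_mapsD[OF m] and st' = bundle_mapsD'[OF m]
  define h where "h l v w = g l (t l v) (t l w)" for l v w
  note p = continuous_map_whitney_proj[of F F]
  have "continuous_map (whitney_sum F F) (whitney_sum E E) (\<lambda>p. (fst p, t (fst p) (fst (snd p)), t (fst p) (snd (snd p))))"
    using continuous_map_compose[OF p(1) st'(2)] continuous_map_compose[OF p(2) st'(2)]
    by (intro continuous_map_into_whitney) (simp_all add: o_def)
  moreover have "continuous_map (whitney_sum E E) euclideanreal (\<lambda>(l, (v, w)). g l v w)"
    using g by (simp add: fibre_metric_def)
  ultimately have "continuous_map (whitney_sum F F) euclideanreal
     ((\<lambda>(l, (v, w)). g l v w) \<circ> (\<lambda>p. (fst p, t (fst p) (fst (snd p)), t (fst p) (snd (snd p)))))"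
    by (rule continuous_map_compose)
  then have 1: "continuous_map (whitney_sum F F) euclideanreal (\<lambda>(l, (v, w)). h l v w)"
    by (simp add: o_def h_def case_prod_unfold)
  have t0: "t l v \<noteq> 0" if "(l, v) \<in> topspace F" "v \<noteq> 0" for l v
  proof
    assume "t l v = 0"
    then have "s l 0 = v" using st(4)[OF that(1)] by simp
    moreover have "(l, 0) \<in> topspace E" using st(4)[OF that(1)] \<open>t l v = 0\<close> by simp
    then have "s l 0 = 0" using st(5)[of l 0 0 0 0] by simp
    ultimately show False using that by simp
  qed
  have "fibre_metric \<Lambda> F h"
    unfolding fibre_metric_def
  proof (intro conjI ballI allI impI)
    show "continuous_map (whitney_sum F F) euclideanreal (\<lambda>(l, (v, w)). h l v w)" by (fact 1)
    fix l u v w and a b :: real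
    assume l: "l \<in> topspace \<Lambda>" "u \<in> fibre F l" "v \<in> fibre F l" "w \<in> fibre F l"
    then have "t l u \<in> fibre E l" "t l v \<in> fibre E l" "t l w \<in> fibre E l" using st(4) by (auto simp: fibre_def)
    then show "h l (a *\<^sub>R u + b *\<^sub>R v) w = a * h l u w + b * h l v w" "h l v w = h l w v"
      using g l st(6)[of l u v a b] by (simp_all add: fibre_metric_def h_def fibre_def)
  next
    fix l v assume l: "l \<in> topspace \<Lambda>" "v \<in> fibre F l" "v \<noteq> 0"
    then show "0 < h l v v" using g st(4) t0 by (auto simp: fibre_metric_def h_def fibre_def)
  qed
  moreover have "fibre_homeo (sphere_bundle E g) (sphere_bundle F h) (\<lambda>(l, v). (l, s l v))"
    unfolding fibre_homeo_def
  proof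
    have "homeomorphic_maps E F (\<lambda>(l, v). (l, s l v)) (\<lambda>(l, v). (l, t l v))"
      using st(1-4) by (auto simp: homeomorphic_maps_def)
    then have "homeomorphic_maps (sphere_bundle E g) (sphere_bundle F h) (\<lambda>(l, v). (l, s l v)) (\<lambda>(l, v). (l, t l v))"
      unfolding sphere_bundle_def
      by (rule homeomorphic_maps_subtopologies_alt) (use st(3,4) in \<open>auto simp: h_def\<close>)
    then show "homeomorphic_map (sphere_bundle E g) (sphere_bundle F h) (\<lambda>(l, v). (l, s l v))"
      using homeomorphic_maps_map by blast
  qed (auto simp: fibre_preserving_def)
  ultimately show ?thesis by (rule that)
qed

lemma fibre_homeo_continuous: "fibre_homeo P Q h \<Longrightarrow> continuous_map P Q h" "fibre_homeo P Q h \<Longrightarrow> fibre_preserving P h"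
  by (auto simp: fibre_homeo_def homeomorphic_imp_continuous_map)

lemma fibre_preserving_compose:
  assumes "continuous_map P Q f" "fibre_preserving P f" "fibre_preserving Q g"
  shows "fibre_preserving P (g \<circ> f)"
  using continuous_map_image_subset_topspace[OF assms(1)] assms(2,3) by (auto simp: fibre_preserving_def image_subset_iff)

lemma fibre_homotopy_equivalent_homeo:
  assumes eq: "fibre_homotopy_equivalent P Q" and a: "fibre_homeo P P' a" and b: "fibre_homeo Q Q' b"
  shows "fibre_homotopy_equivalent P' Q'"
proof -
  obtain \<phi> \<psi> where \<phi>: "continuous_map P Q \<phi>" "fibre_preserving P \<phi>" and \<psi>: "continuous_map Q P \<psi>" "fibre_preserving Q \<psi>"
    and 1: "fibre_homotopic P P (\<psi> \<circ> \<phi>) id" and 2: "fibre_homotopic Q Q (\<phi> \<circ> \<psi>) id"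
    using eq unfolding fibre_homotopy_equivalent_def by blast
  obtain a' where a': "fibre_homeo P' P a'" "\<And>x. x \<in> topspace P \<Longrightarrow> a' (a x) = x" "\<And>x. x \<in> topspace P' \<Longrightarrow> a (a' x) = x"
    using fibre_homeo_inverse[OF a] by metis
  obtain b' where b': "fibre_homeo Q' Q b'" "\<And>x. x \<in> topspace Q \<Longrightarrow> b' (b x) = x" "\<And>x. x \<in> topspace Q' \<Longrightarrow> b (b' x) = x"
    using fibre_homeo_inverse[OF b] by metis
  note ca = fibre_homeo_continuous[OF a] fibre_homeo_continuous[OF a'(1)]
  note cb = fibre_homeo_continuous[OF b] fibre_homeo_continuous[OF b'(1)]
  have inP: "a' x \<in> topspace P" "\<phi> (a' x) \<in> topspace Q" if "x \<in> topspace P'" for x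
    using continuous_map_image_subset_topspace[OF ca(3)] continuous_map_image_subset_topspace[OF \<phi>(1)] that by auto
  have inQ: "b' x \<in> topspace Q" "\<psi> (b' x) \<in> topspace P" if "x \<in> topspace Q'" for x
    using continuous_map_image_subset_topspace[OF cb(3)] continuous_map_image_subset_topspace[OF \<psi>(1)] that by auto
  have H1: "fibre_homotopic P' P' ((a \<circ> \<psi> \<circ> b') \<circ> (b \<circ> \<phi> \<circ> a')) id"
    by (rule homotopic_with_eq[OF fibre_homotopic_compose_right[OF fibre_homotopic_compose_left[OF 1 ca(1,2)] ca(3,4)]])
       (use inP a'(3) b'(2) in \<open>auto intro!: fibre_preserving_cong\<close>)
  have H2: "fibre_homotopic Q' Q' ((b \<circ> \<phi> \<circ> a') \<circ> (a \<circ> \<psi> \<circ> b')) id"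
    by (rule homotopic_with_eq[OF fibre_homotopic_compose_right[OF fibre_homotopic_compose_left[OF 2 cb(1,2)] cb(3,4)]])
       (use inQ b'(3) a'(2) in \<open>auto intro!: fibre_preserving_cong\<close>)
  show ?thesis
    unfolding fibre_homotopy_equivalent_def
  proof (intro exI conjI)
    show "continuous_map P' Q' (b \<circ> \<phi> \<circ> a')" "continuous_map Q' P' (a \<circ> \<psi> \<circ> b')"
      using ca cb \<phi> \<psi> by (meson continuous_map_compose)+
    show "fibre_preserving P' (b \<circ> \<phi> \<circ> a')"
      by (intro fibre_preserving_compose[OF ca(3,4)] fibre_preserving_compose[OF \<phi> cb(2)])
    show "fibre_preserving Q' (a \<circ> \<psi> \<circ> b')"
      by (intro fibre_preserving_compose[OF cb(3,4)] fibre_preserving_compose[OF \<psi> ca(2)])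
  qed (fact H1 H2)+
qed

text \<open>Brings bundles with arbitrary fibres into the form of the generators of
  \<open>T_group\<close>, which have standard fibres and a trivial summand. The summand taken is of
  rank 0, and metrics, sphere bundles and the equivalence are carried along the
  isomorphisms.\<close>

theorem J_proj_eq_one_if_sphere_bundles_equivalent:
  assumes E: "vector_bundle \<Lambda> E" and F: "vector_bundle \<Lambda> F"
    and rank: "\<And>l. l \<in> topspace \<Lambda> \<Longrightarrow> dim (fibre E l) = dim (fibre F l)"
    and g: "fibre_metric \<Lambda> E g" and h: "fibre_metric \<Lambda> F h"
    and eq: "fibre_homotopy_equivalent (sphere_bundle E g) (sphere_bundle F h)"
  shows "J_proj \<Lambda> (ko_diff \<Lambda> E F) = \<one>\<^bsub>J_group \<Lambda>\<^esub>"
proof -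
  note pE = vector_bundle_prelinear[OF E] and pF = vector_bundle_prelinear[OF F]
  obtain E' :: "'a std_total_space" where E': "bundle_iso E E'" "vector_bundle \<Lambda> E'"
    by (rule vector_bundle_standardize[OF E])
  obtain F' :: "'a std_total_space" where F': "bundle_iso F F'" "vector_bundle \<Lambda> F'"
    by (rule vector_bundle_standardize[OF F])
  let ?E = "whitney_sum E' (trivial_bundle \<Lambda> 0)" and ?F = "whitney_sum F' (trivial_bundle \<Lambda> 0)"
  note triv = vector_bundle_trivial[of \<Lambda> 0]
  have "bundle_iso E' ?E" "bundle_iso F' ?F"
    using whitney_sum_trivial_0[OF vector_bundle_fst] E'(2) F'(2) vector_bundle_whitney_sum[OF _ triv]
    by (metis bundle_iso_sym vector_bundle_prelinear)+
  then have iso: "bundle_iso E ?E" "bundle_iso F ?F"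
    using bundle_iso_trans E'(1) F'(1) pE pF by blast+
  obtain g' a where g': "fibre_metric \<Lambda> ?E g'" "fibre_homeo (sphere_bundle E g) (sphere_bundle ?E g') a"
    by (rule fibre_metric_transport[OF g iso(1) pE])
  obtain h' b where h': "fibre_metric \<Lambda> ?F h'" "fibre_homeo (sphere_bundle F h) (sphere_bundle ?F h') b"
    by (rule fibre_metric_transport[OF h iso(2) pF])
  have "stably_fibre_homotopy_equivalent \<Lambda> E' F'"
    unfolding stably_fibre_homotopy_equivalent_def
    using g'(1) h'(1) fibre_homotopy_equivalent_homeo[OF eq g'(2) h'(2)] by blast
  moreover have "dim (fibre E' l) = dim (fibre F' l)" if l: "l \<in> topspace \<Lambda>" for l
    using bundle_iso_dim(1)[OF E'(1) pE, of l] bundle_iso_dim(1)[OF F'(1) pF, of l] E F rank[OF l] l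
    by (simp add: vector_bundle_def)
  ultimately have "J_proj \<Lambda> (ko_diff \<Lambda> E' F') = \<one>\<^bsub>J_group \<Lambda>\<^esub>"
    by (intro J_proj_eq_one[OF E'(2) F'(2)])
  moreover have "ko_diff \<Lambda> E' F' = ko_diff \<Lambda> E F"
    by (simp add: ko_diff_def bundle_class_eq[OF E E'(1)] bundle_class_eq[OF F F'(1)])
  ultimately show ?thesis by simp
qed

section \<open>Cut-off functions and compactness\<close>

lemma continuous_map_binary:
  assumes "continuous_map Z euclidean f" "continuous_map Z euclidean g"
    and "continuous_on T (\<lambda>p. h (fst p) (snd p))" and "\<And>z. z \<in> topspace Z \<Longrightarrow> (f z, g z) \<in> T"
  shows "continuous_map Z euclidean (\<lambda>z. h (f z) (g z))"
proof -
  have "continuous_map Z (prod_topology euclidean euclidean) (\<lambda>z. (f z, g z))"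
    using assms(1,2) by (simp only: continuous_map_paired)
  then have "continuous_map Z (top_of_set T) (\<lambda>z. (f z, g z))"
    using assms(4) by (auto simp: prod_topology_euclidean continuous_map_in_subtopology)
  moreover have "continuous_map (top_of_set T) euclidean (\<lambda>p. h (fst p) (snd p))"
    using assms(3) by (simp add: continuous_map_iff_continuous)
  ultimately have "continuous_map Z euclidean ((\<lambda>p. h (fst p) (snd p)) \<circ> (\<lambda>z. (f z, g z)))"
    by (rule continuous_map_compose)
  then show ?thesis by (simp add: o_def)
qed

lemma continuous_map_blinfun_apply:
  assumes "continuous_map Z euclidean T" "continuous_map Z euclidean x"
  shows "continuous_map Z euclidean (\<lambda>z. blinfun_apply (T z) (x z))"
  by (rule continuous_map_binary[OF assms, where T = UNIV]) (auto intro!: continuous_intros)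

lemma continuous_map_scale:
  fixes x :: "'z \<Rightarrow> 'v::real_normed_vector"
  assumes "continuous_map Z euclideanreal c" "continuous_map Z euclidean x"
  shows "continuous_map Z euclidean (\<lambda>z. c z *\<^sub>R x z)"
  by (rule continuous_map_binary[OF assms, where T = UNIV]) (auto intro!: continuous_intros)

lemma continuous_map_of_continuous_on:
  assumes "continuous_map Z euclidean f" "continuous_on T h" "\<And>z. z \<in> topspace Z \<Longrightarrow> f z \<in> T"
  shows "continuous_map Z euclidean (\<lambda>z. h (f z))"
proof -
  have "continuous_map Z (top_of_set T) f" using assms by (auto simp: continuous_map_in_subtopology)
  moreover have "continuous_map (top_of_set T) euclidean h" using assms(2) by (simp add: continuous_map_iff_continuous)
  ultimately have "continuous_map Z euclidean (h \<circ> f)" by (rule continuous_map_compose)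
  then show ?thesis by (simp add: o_def)
qed

lemma continuous_map_dist_iff:
  fixes f :: "'z \<Rightarrow> 'v::metric_space"
  shows "continuous_map Z euclidean f \<longleftrightarrow>
     (\<forall>z\<in>topspace Z. \<forall>e>0. \<exists>N. openin Z N \<and> z \<in> N \<and> (\<forall>y\<in>N. dist (f z) (f y) < e))"
  using Met_TC.continuous_map_to_metric[of Z f] by (simp add: mtopology_is_euclidean)

text \<open>With contraction factor 1/2, the fixed points for \<open>p\<close> and \<open>q\<close>
  are at most twice as far apart as \<open>G p\<close> and \<open>G q\<close> at the single argument
  \<open>z p\<close>. So continuity in the parameter, for each fixed argument, is enough.\<close>

lemma continuous_map_fixed_point:
  fixes z :: "'p \<Rightarrow> 'y::real_normed_vector"
  assumes G: "\<And>w. w \<in> S \<Longrightarrow> continuous_map Z euclidean (\<lambda>p. G p w)"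
    and z: "\<And>p. p \<in> topspace Z \<Longrightarrow> z p \<in> S \<and> G p (z p) = z p"
    and contr: "\<And>p v w. p \<in> topspace Z \<Longrightarrow> v \<in> S \<Longrightarrow> w \<in> S \<Longrightarrow> norm (G p v - G p w) \<le> norm (v - w) / 2"
  shows "continuous_map Z euclidean z"
  unfolding continuous_map_dist_iff
proof (intro ballI allI impI)
  fix p e assume p: "p \<in> topspace Z" and e: "(e::real) > 0"
  have "continuous_map Z euclidean (\<lambda>q. G q (z p))" using G z[OF p] by blast
  then obtain N where N: "openin Z N" "p \<in> N" "\<forall>q\<in>N. dist (G p (z p)) (G q (z p)) < e / 2"
    using p e unfolding continuous_map_dist_iff by (meson half_gt_zero)
  show "\<exists>N. openin Z N \<and> p \<in> N \<and> (\<forall>q\<in>N. dist (z p) (z q) < e)"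
  proof (intro exI[of _ N] conjI ballI N(1,2))
    fix q assume q: "q \<in> N"
    then have qZ: "q \<in> topspace Z" using openin_subset[OF N(1)] by blast
    have "norm (z p - z q) = norm ((G p (z p) - G q (z p)) + (G q (z p) - G q (z q)))" using z[OF p] z[OF qZ] by simp
    also have "\<dots> \<le> norm (G p (z p) - G q (z p)) + norm (z p - z q) / 2"
      using norm_triangle_ineq contr[OF qZ, of "z p" "z q"] z[OF p] z[OF qZ] by (smt (verit))
    finally have "norm (z p - z q) \<le> 2 * norm (G p (z p) - G q (z p))" by simp
    then show "dist (z p) (z q) < e" using N(3) q by (force simp: dist_norm)
  qed
qed

text \<open>The open set \<open>N\<close> is recorded along with \<rho>: \<rho> vanishes on it, and
  it covers the base together with \<open>U\<close>. The product of \<rho> with a function defined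
  over \<open>U\<close> alone then extends by 0 to a continuous function.\<close>

lemma cutoff_function:
  assumes "normal_space B" "closedin B C" "openin B U" "C \<subseteq> U"
  obtains \<rho> N where "continuous_map B euclideanreal \<rho>" "\<And>b. 0 \<le> \<rho> b" "\<And>b. b \<in> C \<Longrightarrow> \<rho> b = 1"
    "openin B N" "topspace B \<subseteq> N \<union> U" "\<And>b. b \<in> N \<Longrightarrow> \<rho> b = (0::real)"
proof -
  obtain s where s: "continuous_map B euclideanreal s"
     "\<And>x. x \<in> topspace B - U \<Longrightarrow> s x = (0::real)" "\<And>x. x \<in> C \<Longrightarrow> s x = 1"
  proof (rule Urysohn_real[OF assms(1) _ assms(2), of "topspace B - U"])
    show "closedin B (topspace B - U)" using assms(3) by blast
    show "disjnt (topspace B - U) C" using assms(4) by (auto simp: disjnt_iff)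
  qed blast
  show ?thesis
  proof (rule that[of "\<lambda>b. max 0 (min 1 (3 * s b - 1))" "{b \<in> topspace B. s b < 1/3}"])
    show "continuous_map B euclideanreal (\<lambda>b. max 0 (min 1 (3 * s b - 1)))"
      using clamp_continuous[OF s(1)] by (simp add: continuous_map_in_subtopology)
    show "openin B {b \<in> topspace B. s b < 1/3}"
      using continuous_map_upper_lower_semicontinuous_lt s(1) by metis
    show "topspace B \<subseteq> {b \<in> topspace B. s b < 1/3} \<union> U" using s(2) by fastforce
  qed (use s(3) in auto)
qed

lemma cutoff_continuous:
  fixes g :: "'p \<Rightarrow> 'v::real_normed_vector"
  assumes "continuous_map X B f" "continuous_map B euclideanreal \<rho>" "openin B U" "openin B N" "topspace B \<subseteq> N \<union> U"
    and "\<And>b. b \<in> N \<Longrightarrow> \<rho> b = 0" and g: "continuous_map (subtopology X {x \<in> topspace X. f x \<in> U}) euclidean g"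
  shows "continuous_map X euclidean (\<lambda>x. if f x \<in> U then \<rho> (f x) *\<^sub>R g x else 0)"
proof (rule continuous_map_paste2)
  let ?A = "{x \<in> topspace X. f x \<in> U}" and ?B = "{x \<in> topspace X. f x \<in> N}"
  show "openin X ?A" "openin X ?B" using openin_continuous_map_preimage[OF assms(1)] assms(3,4) by auto
  show "topspace X \<subseteq> ?A \<union> ?B" using continuous_map_image_subset_topspace[OF assms(1)] assms(5) by auto
  have "continuous_map X euclideanreal (\<lambda>x. \<rho> (f x))" using continuous_map_compose[OF assms(1,2)] by (simp add: o_def)
  then show "continuous_map (subtopology X ?A) euclidean (\<lambda>x. \<rho> (f x) *\<^sub>R g x)"
    by (intro continuous_map_scale continuous_map_from_subtopology g)
  show "continuous_map (subtopology X ?B) euclidean (\<lambda>x. 0 :: 'v)" by simp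
qed (use assms(6) in auto)

text \<open>Plays the part of a partition of unity. At every point some \<open>\<rho> i\<close> is 1
  and the others are nonnegative, so their sum is at least 1; where weights of total 1 are wanted,
  one can divide by it.\<close>

lemma cutoff_cover:
  assumes cB: "compact_space B" and hB: "Hausdorff_space B"
    and loc: "\<And>b. b \<in> topspace B \<Longrightarrow> \<exists>U. openin B U \<and> b \<in> U \<and> P b U"
  obtains I U \<rho> N where "finite I" "I \<subseteq> topspace B" "\<And>i. i \<in> I \<Longrightarrow> P i (U i)" "\<And>i. i \<in> I \<Longrightarrow> openin B (U i)"
    "\<And>i. i \<in> I \<Longrightarrow> continuous_map B euclideanreal (\<rho> i)" "\<And>i b. i \<in> I \<Longrightarrow> 0 \<le> \<rho> i b"
    "\<And>i. i \<in> I \<Longrightarrow> openin B (N i)" "\<And>i. i \<in> I \<Longrightarrow> topspace B \<subseteq> N i \<union> U i"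
    "\<And>i b. i \<in> I \<Longrightarrow> b \<in> N i \<Longrightarrow> \<rho> i b = (0::real)"
    "\<And>b. b \<in> topspace B \<Longrightarrow> \<exists>i\<in>I. b \<in> U i \<and> \<rho> i b = 1"
proof -
  have nB: "normal_space B" using cB hB compact_Hausdorff_or_regular_imp_normal_space by blast
  have "regular_space B" using cB hB compact_Hausdorff_imp_regular_space by blast
  then have nb: "neighbourhood_base_of (closedin B) B" by (simp add: neighbourhood_base_of_closedin)
  have "\<exists>U \<rho> N W. P b U \<and> openin B U \<and> continuous_map B euclideanreal \<rho> \<and> (\<forall>c. (0::real) \<le> \<rho> c) \<and> openin B N
     \<and> topspace B \<subseteq> N \<union> U \<and> (\<forall>c\<in>N. \<rho> c = 0) \<and> openin B W \<and> b \<in> W \<and> W \<subseteq> U \<and> (\<forall>c\<in>W. \<rho> c = 1)" if b: "b \<in> topspace B" for b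
  proof -
    obtain U where U: "openin B U" "b \<in> U" "P b U" using loc[OF b] by blast
    have "\<exists>W C. openin B W \<and> closedin B C \<and> b \<in> W \<and> W \<subseteq> C \<and> C \<subseteq> U"
      using nb U(1,2) unfolding neighbourhood_base_of by blast
    then obtain W C where W: "openin B W" "closedin B C" "b \<in> W" "W \<subseteq> C" "C \<subseteq> U" by blast
    obtain \<rho> N where "continuous_map B euclideanreal \<rho>" "\<And>b. 0 \<le> \<rho> b" "\<And>b. b \<in> C \<Longrightarrow> \<rho> b = 1"
      "openin B N" "topspace B \<subseteq> N \<union> U" "\<And>b. b \<in> N \<Longrightarrow> \<rho> b = (0::real)"
      using cutoff_function[OF nB W(2) U(1) W(5)] by metis
    then show ?thesis using U W by (intro exI[of _ U] exI[of _ \<rho>] exI[of _ N] exI[of _ W]) auto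
  qed
  then obtain U \<rho> N W where *: "\<And>b. b \<in> topspace B \<Longrightarrow> P b (U b) \<and> openin B (U b) \<and> continuous_map B euclideanreal (\<rho> b) \<and> (\<forall>c. (0::real) \<le> \<rho> b c) \<and> openin B (N b)
     \<and> topspace B \<subseteq> N b \<union> U b \<and> (\<forall>c\<in>N b. \<rho> b c = 0) \<and> openin B (W b) \<and> b \<in> W b \<and> W b \<subseteq> U b \<and> (\<forall>c\<in>W b. \<rho> b c = 1)"
    by metis
  have "compactin B (topspace B)" using cB by (simp add: compact_space_def)
  then have "\<exists>F. finite F \<and> F \<subseteq> W ` topspace B \<and> topspace B \<subseteq> \<Union>F"
    by (rule compactinD) (use * in blast)+
  then obtain I where I: "finite I" "I \<subseteq> topspace B" "topspace B \<subseteq> (\<Union>b\<in>I. W b)"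
    by (metis finite_subset_image)
  have in_top: "i \<in> topspace B" if "i \<in> I" for i using I(2) that by blast
  show ?thesis
  proof (rule that[of I U \<rho> N])
    fix b assume "b \<in> topspace B"
    then obtain i where i: "i \<in> I" "b \<in> W i" using I(3) by blast
    then show "\<exists>i\<in>I. b \<in> U i \<and> \<rho> i b = 1" using *[OF in_top[OF i(1)]] by blast
  qed (use I(1,2) *[OF in_top] in \<open>simp_all\<close>)
qed

text \<open>The tube lemma for the compact trivial branch gives one radius for all
  parameters.\<close>

lemma uniform_ball_at_zero:
  fixes U :: "'x::real_normed_vector set"
  assumes "compact_space \<Lambda>" "open U" "0 \<in> U" "openin (prod_topology \<Lambda> (top_of_set U)) N" "topspace \<Lambda> \<times> {0} \<subseteq> N"
  obtains \<delta> where "\<delta> > 0" "\<And>l x. l \<in> topspace \<Lambda> \<Longrightarrow> norm x < \<delta> \<Longrightarrow> x \<in> U \<and> (l, x) \<in> N"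
proof -
  have "\<exists>A V. openin \<Lambda> A \<and> openin (top_of_set U) V \<and> topspace \<Lambda> \<subseteq> A \<and> 0 \<in> V \<and> A \<times> V \<subseteq> N"
    using assms by (intro tube_lemma_left) (auto simp: compact_space_def)
  then obtain A V where V: "openin (top_of_set U) V" "topspace \<Lambda> \<subseteq> A" "0 \<in> V" "A \<times> V \<subseteq> N" by blast
  have "open V" "V \<subseteq> U" using V(1) assms(2) openin_open_eq by blast+
  then obtain \<delta> where "\<delta> > 0" "ball 0 \<delta> \<subseteq> V" using V(3) open_contains_ball by blast
  then show ?thesis using that[of \<delta>] V \<open>V \<subseteq> U\<close> by (auto simp: subset_iff)
qed

lemma compact_space_norm_bound:
  fixes R :: "'l \<Rightarrow> 'v::real_normed_vector"
  assumes "compact_space \<Lambda>" "continuous_map \<Lambda> euclidean R"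
  obtains C where "C > 0" "\<And>l. l \<in> topspace \<Lambda> \<Longrightarrow> norm (R l) \<le> C"
proof -
  have "compactin euclidean (R ` topspace \<Lambda>)"
    using assms image_compactin unfolding compact_space_def by blast
  then have "bounded (R ` topspace \<Lambda>)" by (simp add: compact_imp_bounded)
  then show ?thesis using that unfolding bounded_pos by blast
qed

text \<open>\<open>Euclidean_space n\<close> is a subspace of a countable product of lines. There
  the disc is closed and lies in the box with sides \<open>[-1, 1]\<close> in the first
  \<open>n\<close> coordinates and \<open>{0}\<close> in the others, which is compact by Tychonoff's
  theorem.\<close>

lemma compactin_unit_disc: "compactin (Euclidean_space n) (unit_disc n)"
proof -
  let ?P = "powertop_real (UNIV :: nat set)"
  let ?B = "PiE UNIV (\<lambda>i. if i < n then {-1..1::real} else {0})"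
  have B: "compactin ?P ?B" by (subst compactin_PiE) auto
  have eq: "unit_disc n = {x \<in> topspace ?P. (\<Sum>i<n. (x i)\<^sup>2) \<in> {..1}} \<inter> topspace (Euclidean_space n)"
    by (auto simp: unit_disc_def topspace_Euclidean_space)
  have "continuous_map ?P euclideanreal (\<lambda>x. \<Sum>i<n. (x i)\<^sup>2)"
    by (intro continuous_map_sum continuous_map_real_pow) (auto intro: continuous_map_product_coordinates)
  then have "closedin ?P {x \<in> topspace ?P. (\<Sum>i<n. (x i)\<^sup>2) \<in> {..1}}"
    by (rule closedin_continuous_map_preimage) auto
  then have c: "closedin ?P (unit_disc n)" unfolding eq by (intro closedin_Int closedin_Euclidean_space)
  have "unit_disc n \<subseteq> ?B"
  proof
    fix x assume x: "x \<in> unit_disc n"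
    have "\<bar>x i\<bar> \<le> 1" if "i < n" for i
    proof -
      have "(x i)\<^sup>2 \<le> (\<Sum>i<n. (x i)\<^sup>2)" using that by (intro member_le_sum) auto
      also have "\<dots> \<le> 1" using x by (simp add: unit_disc_def)
      finally show ?thesis by (simp add: abs_square_le_1)
    qed
    then show "x \<in> ?B" using x by (auto simp: unit_disc_def topspace_Euclidean_space abs_le_iff)
  qed
  then have "compactin ?P (unit_disc n)" using closed_compactin[OF B _ c] by blast
  then show ?thesis
    unfolding Euclidean_space_def compactin_subtopology by (auto simp: unit_disc_def topspace_Euclidean_space)
qed

lemma compactin_boundary_sphere: "compactin (Euclidean_space n) (boundary_sphere n)"
proof (rule closed_compactin[OF compactin_unit_disc])
  have "continuous_map (Euclidean_space n) euclideanreal (\<lambda>x. \<Sum>i<n. (x i)\<^sup>2)"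
    unfolding Euclidean_space_def
    by (intro continuous_map_sum continuous_map_real_pow continuous_map_from_subtopology) (auto intro: continuous_map_product_coordinates)
  then have "closedin (Euclidean_space n) {x \<in> topspace (Euclidean_space n). (\<Sum>i<n. (x i)\<^sup>2) \<in> {1}}"
    by (rule closedin_continuous_map_preimage) auto
  then show "closedin (Euclidean_space n) (boundary_sphere n)" by (simp add: boundary_sphere_def)
qed (auto simp: boundary_sphere_def unit_disc_def)

text \<open>Every open cell lies in the image of a closed disc, so the space is a finite union of
  compact sets.\<close>

lemma finite_CW_complex_compact:
  assumes "finite_CW_complex X"
  shows "compact_space X" "Hausdorff_space X"
proof -
  show "Hausdorff_space X" using assms by (simp add: finite_CW_complex_def)
  obtain C :: "'a set set" and d \<phi> where *: "finite C" "pairwise disjnt C" "\<Union>C = topspace X"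
     "\<forall>e\<in>C. continuous_map (subtopology (Euclidean_space (d e)) (unit_disc (d e))) X (\<phi> e) \<and>
           homeomorphic_map (subtopology (Euclidean_space (d e)) (open_unit_disc (d e)))
             (subtopology X e) (\<phi> e) \<and>
           \<phi> e ` boundary_sphere (d e) \<subseteq> \<Union>{e'\<in>C. d e' < d e}"
    using assms unfolding finite_CW_complex_def by (elim conjE exE)
  note C = *(1,3)
  have \<phi>: "continuous_map (subtopology (Euclidean_space (d e)) (unit_disc (d e))) X (\<phi> e)"
      "homeomorphic_map (subtopology (Euclidean_space (d e)) (open_unit_disc (d e))) (subtopology X e) (\<phi> e)"
    if "e \<in> C" for e
    using bspec[OF *(4) that] by simp_all
  have img: "compactin X (\<phi> e ` unit_disc (d e)) \<and> e \<subseteq> \<phi> e ` unit_disc (d e)" if e: "e \<in> C" for e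
  proof
    have "compactin (subtopology (Euclidean_space (d e)) (unit_disc (d e))) (unit_disc (d e))"
      using compactin_unit_disc by (simp add: compactin_subtopology)
    then show "compactin X (\<phi> e ` unit_disc (d e))" by (rule image_compactin[OF _ \<phi>(1)[OF e]])
    have "\<phi> e ` topspace (subtopology (Euclidean_space (d e)) (open_unit_disc (d e))) = topspace (subtopology X e)"
      using homeomorphic_imp_surjective_map[OF \<phi>(2)[OF e]] .
    moreover have "topspace (subtopology X e) = e" using C e by auto
    ultimately show "e \<subseteq> \<phi> e ` unit_disc (d e)" by (force simp: open_unit_disc_def unit_disc_def)
  qed
  have "compactin X (\<Union>e\<in>C. \<phi> e ` unit_disc (d e))"
    using C(1) img by (intro compactin_Union) auto
  moreover have "topspace X = (\<Union>e\<in>C. \<phi> e ` unit_disc (d e))"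
  proof
    show "topspace X \<subseteq> (\<Union>e\<in>C. \<phi> e ` unit_disc (d e))"
      unfolding C(2)[symmetric] using img by (intro Union_least) (meson UN_upper order_trans)
    show "(\<Union>e\<in>C. \<phi> e ` unit_disc (d e)) \<subseteq> topspace X"
      using compactin_subset_topspace[OF conjunct1[OF img]] by (intro UN_least)
  qed
  ultimately show "compact_space X" by (simp add: compact_space_def)
qed

section \<open>Index subspaces and Lyapunov-Schmidt reduction\<close>

lemma local_correction:
  fixes L :: "'l \<Rightarrow> 'x::banach \<Rightarrow>\<^sub>L 'y::banach"
  assumes cL: "continuous_map \<Lambda> euclidean L" and l0: "l0 \<in> topspace \<Lambda>" and bij: "bij (blinfun_apply (L l0 + K))"
  obtains U where "openin \<Lambda> U" "l0 \<in> U" "\<And>l. l \<in> U \<Longrightarrow> bij (blinfun_apply (L l + K))"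
proof -
  have "continuous_map \<Lambda> euclidean (\<lambda>l. L l + K)"
    by (rule continuous_map_of_continuous_on[OF cL, of UNIV "\<lambda>T. T + K"]) (auto intro!: continuous_intros)
  then have "openin \<Lambda> {l \<in> topspace \<Lambda>. L l + K \<in> {T. bij (blinfun_apply T)}}"
    by (rule openin_continuous_map_preimage) (use open_bij_blinfun in simp)
  then show ?thesis by (rule that) (use l0 bij in auto)
qed

lemma span_range_Un:
  fixes T :: "'x::real_normed_vector \<Rightarrow>\<^sub>L 'y::real_normed_vector"
  shows "span (range (blinfun_apply T) \<union> B) = {T x + w |x w. w \<in> span B}"
proof -
  have "linear (blinfun_apply T)" by (rule bounded_linear.linear[OF blinfun.bounded_linear_right])
  then have "subspace (range (blinfun_apply T))" using linear_subspace_image subspace_UNIV by blast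
  then have sp: "span (range (blinfun_apply T)) = range (blinfun_apply T)" by (simp add: span_eq_iff)
  show ?thesis unfolding span_Un sp by blast
qed

lemma fredholm_complement:
  fixes T :: "'x::real_normed_vector \<Rightarrow>\<^sub>L 'y::real_normed_vector"
  assumes "fredholm T"
  obtains B where "finite B" "{T x + w |x w. w \<in> span B} = UNIV"
proof -
  obtain B where "finite B" "span (range (blinfun_apply T) \<union> B) = UNIV"
    using assms by (auto simp: fredholm_def finite_codim_def)
  then show ?thesis using that by (simp add: span_range_Un)
qed

lemma fredholm_injective_bij:
  fixes T :: "'x::real_normed_vector \<Rightarrow>\<^sub>L 'y::real_normed_vector"
  assumes F: "fredholm T" "fredholm_index T = 0" and ker: "op_kernel T = {0}"
  shows "bij (blinfun_apply T)"
proof -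
  have "inj (blinfun_apply T)"
  proof (rule injI)
    fix x y assume "T x = T y"
    then have "x - y \<in> op_kernel T" by (simp add: op_kernel_def blinfun.diff_right)
    then show "x = y" using ker by simp
  qed
  moreover have "surj (blinfun_apply T)"
  proof -
    obtain C where C: "finite C" "span (range (blinfun_apply T) \<union> C) = UNIV"
      using F(1) by (auto simp: fredholm_def finite_codim_def)
    have "dim (op_kernel T) = 0"
      using dim_span[of "{} :: 'x set"] dim_eq_card_independent[of "{} :: 'x set"] by (simp add: ker independent_empty)
    then have "codim (range (blinfun_apply T)) = 0" using F(2) by (simp add: fredholm_index_def)
    moreover have "\<exists>B. finite B \<and> card B = codim (range (blinfun_apply T)) \<and> span (range (blinfun_apply T) \<union> B) = UNIV"
      unfolding codim_def by (rule LeastI[of _ "card C"]) (use C in blast)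
    ultimately have "span (range (blinfun_apply T) \<union> {}) = UNIV" by auto
    then show ?thesis unfolding span_range_Un by auto
  qed
  ultimately show ?thesis by (simp add: bij_def)
qed

text \<open>At \<open>l0\<close> the range is completed by a finite set \<open>B\<close>. A
  correction of \<open>L l0\<close> with values in \<open>span B\<close> that is invertible at
  \<open>l0\<close> stays so nearby, hence \<open>span B\<close> remains transversal there. By
  compactness finitely many such sets can be united.\<close>

lemma index_subspace_exists:
  fixes L :: "'l \<Rightarrow> 'x::banach \<Rightarrow>\<^sub>L 'y::banach"
  assumes c\<Lambda>: "compact_space \<Lambda>" and cL: "continuous_map \<Lambda> euclidean L"
    and F: "\<And>l. l \<in> topspace \<Lambda> \<Longrightarrow> fredholm (L l) \<and> fredholm_index (L l) = 0"
  shows "\<exists>V. index_subspace \<Lambda> L V"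
proof -
  have "\<exists>U B. openin \<Lambda> U \<and> l0 \<in> U \<and> finite B \<and> (\<forall>l\<in>U. \<forall>y. \<exists>x. y - L l x \<in> span B)" if l0: "l0 \<in> topspace \<Lambda>" for l0
  proof -
    obtain B where B: "finite B" "{L l0 x + w |x w. w \<in> span B} = UNIV"
      by (rule fredholm_complement[OF conjunct1[OF F[OF l0]]])
    have "finite_dim (span B)" using B(1) by (auto simp: finite_dim_def subspace_span)
    then obtain K where K: "range (blinfun_apply K) \<subseteq> span B" "bij (blinfun_apply (L l0 + K))"
      by (rule finite_rank_correction[OF conjunct1[OF F[OF l0]] conjunct2[OF F[OF l0]] _ B(2)])
    obtain U where U: "openin \<Lambda> U" "l0 \<in> U" "\<And>l. l \<in> U \<Longrightarrow> bij (blinfun_apply (L l + K))"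
      using local_correction[OF cL l0 K(2)] by blast
    have "\<exists>x. y - L l x \<in> span B" if "l \<in> U" for l y
    proof
      let ?x = "binv (L l + K) y"
      have "L l ?x + K ?x = y" using binv(1)[OF U(3)[OF that], of y] by (simp add: blinfun.add_left)
      then have "y - L l ?x = K ?x" by (simp add: algebra_simps)
      then show "y - L l ?x \<in> span B" using K(1) by auto
    qed
    then show ?thesis using U(1,2) B(1) by blast
  qed
  then obtain U B where UB: "\<And>l0. l0 \<in> topspace \<Lambda> \<Longrightarrow> openin \<Lambda> (U l0) \<and> l0 \<in> U l0 \<and> finite (B l0) \<and> (\<forall>l\<in>U l0. \<forall>y. \<exists>x. y - L l x \<in> span (B l0))"
    by metis
  have "compactin \<Lambda> (topspace \<Lambda>)" using c\<Lambda> by (simp add: compact_space_def)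
  then have "\<exists>F. finite F \<and> F \<subseteq> U ` topspace \<Lambda> \<and> topspace \<Lambda> \<subseteq> \<Union>F"
    by (rule compactinD) (use UB in blast)+
  then obtain I where I: "finite I" "I \<subseteq> topspace \<Lambda>" "topspace \<Lambda> \<subseteq> (\<Union>b\<in>I. U b)"
    by (metis finite_subset_image)
  have in_top: "i \<in> topspace \<Lambda>" if "i \<in> I" for i using I(2) that by blast
  let ?B = "\<Union>i\<in>I. B i"
  have "finite ?B" using I(1) UB[OF in_top] by simp
  moreover have "{L l x + v |x v. v \<in> span ?B} = UNIV" if l: "l \<in> topspace \<Lambda>" for l
  proof -
    have "y \<in> {L l x + v |x v. v \<in> span ?B}" for y
    proof -
      obtain i where i: "i \<in> I" "l \<in> U i" using I(3) l by blast
      then obtain x where x: "y - L l x \<in> span (B i)" using UB[OF in_top[OF i(1)]] by blast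
      have "span (B i) \<subseteq> span ?B" using i(1) by (intro span_mono) blast
      then have "y - L l x \<in> span ?B" using x by blast
      moreover have "y = L l x + (y - L l x)" by simp
      ultimately show ?thesis by blast
    qed
    then show ?thesis by blast
  qed
  ultimately have "index_subspace \<Lambda> L (span ?B)"
    by (auto simp: index_subspace_def finite_dim_def subspace_span)
  then show ?thesis by blast
qed

text \<open>Biorthogonal functionals define \<open>c\<close> on the whole space and not only on
  \<open>V\<close>, so \<open>d \<circ> c\<close> is a continuous projection onto
  \<open>V\<close>.\<close>

lemma finite_dim_coordinates:
  fixes V :: "'y::real_normed_vector set"
  assumes "finite_dim V"
  obtains n c d where "continuous_map euclidean (Euclidean_space n) c" "continuous_map (Euclidean_space n) euclidean d"
    "\<And>v w a b. c (a *\<^sub>R v + b *\<^sub>R w) = a *\<^sub>R c v + b *\<^sub>R c w"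
    "\<And>v w a b. d (a *\<^sub>R v + b *\<^sub>R w) = a *\<^sub>R d v + b *\<^sub>R d w"
    "\<And>a. a \<in> topspace (Euclidean_space n) \<Longrightarrow> d a \<in> V \<and> c (d a) = a"
    "\<And>v. v \<in> V \<Longrightarrow> d (c v) = v" "dim V = n"
proof -
  obtain B where B: "finite B" "independent B" "span B = V" "card B = dim V"
    by (rule finite_dim_basis[OF assms])
  obtain b where b: "bij_betw b {..<dim V} B" using B(1,4) ex_bij_betw_nat_finite[of B] by (auto simp: atLeast0LessThan)
  obtain \<phi> :: "'y \<Rightarrow> 'y \<Rightarrow>\<^sub>L real" where \<phi>: "\<And>b b'. b \<in> B \<Longrightarrow> b' \<in> B \<Longrightarrow> \<phi> b b' = (if b = b' then 1 else 0)"
    using biorthogonal_functionals[OF B(1,2)] by blast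
  let ?n = "dim V"
  define c where "c v = (\<lambda>i. if i < ?n then \<phi> (b i) v else 0)" for v
  define d where "d a = (\<Sum>i<?n. a i *\<^sub>R b i)" for a :: "nat \<Rightarrow> real"
  have bB: "b i \<in> B" if "i < ?n" for i using b that bij_betwE by blast
  have \<phi>b: "\<phi> (b i) (b j) = (if i = j then 1 else 0)" if "i < ?n" "j < ?n" for i j
    using \<phi>[OF bB bB] b that by (simp add: bij_betw_def inj_on_def)
  have cd: "c (d a) = a" if "a \<in> topspace (Euclidean_space ?n)" for a
  proof
    fix i
    show "c (d a) i = a i"
    proof (cases "i < ?n")
      case True
      have "\<phi> (b i) (d a) = (\<Sum>j<?n. if j = i then a i else 0)"
        unfolding d_def blinfun.sum_right using \<phi>b True by (intro sum.cong) (auto simp: blinfun.scaleR_right)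
      then show ?thesis using True by (simp add: c_def)
    qed (use that in \<open>simp add: c_def topspace_Euclidean_space\<close>)
  qed
  have dV: "d a \<in> V" for a
  proof -
    have "d a \<in> span B" unfolding d_def by (intro span_sum span_scale span_base bB) simp
    then show ?thesis using B(3) by simp
  qed
  have dc: "d (c v) = v" if v: "v \<in> V" for v
  proof -
    have "v \<in> span B" using v B(3) by simp
    then obtain u where "v = (\<Sum>x\<in>B. u x *\<^sub>R x)" unfolding span_finite[OF B(1)] by (elim rangeE)
    also have "\<dots> = (\<Sum>i<?n. u (b i) *\<^sub>R b i)" using sum.reindex_bij_betw[OF b, of "\<lambda>x. u x *\<^sub>R x"] by simp
    also have "\<dots> = d (\<lambda>i. if i < ?n then u (b i) else 0)" unfolding d_def by (intro sum.cong) auto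
    finally have v: "v = d (\<lambda>i. if i < ?n then u (b i) else 0)" .
    show ?thesis unfolding v by (subst cd) (simp_all add: topspace_Euclidean_space)
  qed
  have 1: "continuous_map euclidean (Euclidean_space ?n) c"
    unfolding continuous_map_Euclidean_iff
  proof (intro conjI allI)
    fix i
    have "continuous_on UNIV (blinfun_apply (\<phi> (b i)))" by (intro continuous_intros)
    then show "continuous_map euclidean euclideanreal (\<lambda>v. c v i)" by (cases "i < ?n") (simp_all add: c_def)
  qed (simp add: c_def)
  have 2: "continuous_map (Euclidean_space ?n) euclidean d"
    unfolding d_def
  proof (intro continuous_map_sum continuous_map_scale)
    fix i show "continuous_map (Euclidean_space ?n) euclideanreal (\<lambda>a. a i)"
      unfolding Euclidean_space_def by (intro continuous_map_from_subtopology continuous_map_product_coordinates) simp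
  qed auto
  have 3: "c (a *\<^sub>R v + t *\<^sub>R w) = a *\<^sub>R c v + t *\<^sub>R c w" for v w a t
    by (auto simp: c_def fun_eq_iff blinfun.add_right blinfun.scaleR_right scaleR_fun_def)
  have 4: "d (a *\<^sub>R v + t *\<^sub>R w) = a *\<^sub>R d v + t *\<^sub>R d w" for v w a t
    by (simp add: d_def scaleR_fun_def scaleR_add_left sum.distrib scaleR_sum_right)
  show ?thesis by (rule that[OF 1 2 3 4 _ dc refl]) (use dV cd in auto)
qed

text \<open>If \<open>x = e + R z\<close> and \<open>z = - h x\<close>, then
  \<open>f x = L e + (L (R z) - z)\<close>. As \<open>R\<close> is a right inverse modulo
  \<open>V\<close>, the bracket lies in \<open>V\<close>, so the reduced map \<Phi> takes values in
  \<open>V\<close> on the fibres of the index bundle. A zero of \<Phi> gives a zero \<open>x\<close>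
  of \<open>f\<close>, so \<open>x = 0\<close>, then \<open>z = - h 0 = 0\<close> and
  \<open>e = 0\<close>. Finally \<open>norm z\<close> is at most
  \<open>2 * \<kappa> * norm e\<close>, so \<Phi> is as close to \<open>L\<close> as \<kappa> is
  small.\<close>

lemma lyapunov_schmidt:
  fixes f :: "'l \<Rightarrow> 'x::banach \<Rightarrow> 'y::banach" and L :: "'l \<Rightarrow> 'x \<Rightarrow>\<^sub>L 'y" and R :: "'l \<Rightarrow> 'y \<Rightarrow>\<^sub>L 'x"
  assumes cf: "continuous_map (prod_topology \<Lambda> (top_of_set (ball 0 \<delta>))) euclidean (\<lambda>(l, x). f l x)"
    and cL: "continuous_map \<Lambda> euclidean L" and cR: "continuous_map \<Lambda> euclidean R"
    and sV: "subspace V" and LR: "\<And>l y. l \<in> topspace \<Lambda> \<Longrightarrow> L l (R l y) - y \<in> V"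
    and bR: "\<And>l. l \<in> topspace \<Lambda> \<Longrightarrow> norm (R l) \<le> C" and C: "C > 0" and \<kappa>: "\<kappa> > 0" "\<kappa> * C \<le> 1 / 2" and \<delta>: "\<delta> > 0"
    and lip: "\<And>l x x'. l \<in> topspace \<Lambda> \<Longrightarrow> norm x < \<delta> \<Longrightarrow> norm x' < \<delta> \<Longrightarrow>
      norm ((f l x - L l x) - (f l x' - L l x')) \<le> \<kappa> * norm (x - x')"
    and f0: "\<And>l. l \<in> topspace \<Lambda> \<Longrightarrow> f l 0 = 0"
    and only0: "\<And>l x. l \<in> topspace \<Lambda> \<Longrightarrow> norm x < \<delta> \<Longrightarrow> f l x = 0 \<Longrightarrow> x = 0"
  obtains \<Phi> where "continuous_map (prod_topology \<Lambda> (top_of_set (cball 0 (\<delta> / 4)))) euclidean (\<lambda>(l, e). \<Phi> l e)"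
    "\<And>l e. l \<in> topspace \<Lambda> \<Longrightarrow> norm e \<le> \<delta> / 4 \<Longrightarrow> L l e \<in> V \<Longrightarrow> \<Phi> l e \<in> V"
    "\<And>l e. l \<in> topspace \<Lambda> \<Longrightarrow> norm e \<le> \<delta> / 4 \<Longrightarrow> \<Phi> l e = 0 \<Longrightarrow> e = 0"
    "\<And>l e. l \<in> topspace \<Lambda> \<Longrightarrow> norm e \<le> \<delta> / 4 \<Longrightarrow> norm (\<Phi> l e - L l e) \<le> (norm (L l) * C + 1) * (2 * \<kappa>) * norm e"
proof -
  define h where "h l x = f l x - L l x" for l x
  \<comment> \<open>For \<open>norm e \<le> \<delta> / 4\<close> and \<open>z\<close> in this ball,
    \<open>R z\<close> has norm at most \<open>C * (\<kappa> * \<delta> / 2)\<close>, hence at most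
    \<open>\<delta> / 4\<close>. So \<open>x\<close> has norm at most \<open>\<delta> / 2\<close>,
    the hypotheses on the ball of radius \<delta> apply, and \<open>- h x\<close> lies in the ball
    \<open>S\<close> again.\<close>
  define S where "S = cball (0::'y) (\<kappa> * \<delta> / 2)"
  define X where "X = (\<lambda>p z. snd p + R (fst p) z)"
  define G where "G p z = - h (fst p) (X p z)" for p z
  let ?Z = "prod_topology \<Lambda> (top_of_set (cball (0::'x) (\<delta> / 4)))"
  have hlip: "norm (h l x - h l x') \<le> \<kappa> * norm (x - x')" if "l \<in> topspace \<Lambda>" "norm x < \<delta>" "norm x' < \<delta>" for l x x'
    using lip[OF that] by (simp add: h_def)
  have h0: "h l 0 = 0" if "l \<in> topspace \<Lambda>" for l using f0[OF that] by (simp add: h_def)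
  have hb: "norm (h l x) \<le> \<kappa> * norm x" if "l \<in> topspace \<Lambda>" "norm x < \<delta>" for l x
    using hlip[OF that, of 0] h0[OF that(1)] \<delta> by simp
  have Rz: "norm (R l z) \<le> C * norm z" if "l \<in> topspace \<Lambda>" for l z
    using norm_blinfun[of "R l" z] mult_right_mono[OF bR[OF that] norm_ge_zero[of z]] by linarith
  have RS: "norm (R l z) \<le> \<delta> / 4" if "l \<in> topspace \<Lambda>" "z \<in> S" for l z
  proof -
    have "C * norm z \<le> C * (\<kappa> * \<delta> / 2)" using that C by (intro mult_left_mono) (auto simp: S_def)
    also have "\<dots> = (\<kappa> * C) * (\<delta> / 2)" by simp
    also have "\<dots> \<le> (1 / 2) * (\<delta> / 2)" using \<kappa> \<delta> by (intro mult_right_mono) auto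
    finally show ?thesis using Rz[OF that(1), of z] by simp
  qed
  have Xb: "norm (X p z) \<le> \<delta> / 2" if "p \<in> topspace ?Z" "z \<in> S" for p z
    using norm_triangle_ineq[of "snd p" "R (fst p) z"] RS[of "fst p" z] that by (auto simp: X_def)
  have X\<delta>: "norm (X p z) < \<delta>" if "p \<in> topspace ?Z" "z \<in> S" for p z
    using Xb[OF that] \<delta> by linarith
  have GS: "G p z \<in> S" if "p \<in> topspace ?Z" "z \<in> S" for p z
  proof -
    have "norm (G p z) \<le> \<kappa> * norm (X p z)" using hb[of "fst p" "X p z"] X\<delta>[OF that] that by (auto simp: G_def)
    also have "\<dots> \<le> \<kappa> * (\<delta> / 2)" using Xb[OF that] \<kappa> by (intro mult_left_mono) auto
    finally show ?thesis by (simp add: S_def)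
  qed
  have contr: "norm (G p v - G p w) \<le> norm (v - w) / 2" if "p \<in> topspace ?Z" "v \<in> S" "w \<in> S" for p v w
  proof -
    have p: "fst p \<in> topspace \<Lambda>" using that by auto
    have "norm (G p v - G p w) \<le> \<kappa> * norm (X p v - X p w)"
      using hlip[OF p X\<delta>[OF that(1,2)] X\<delta>[OF that(1,3)]] by (simp add: G_def norm_minus_commute)
    also have "X p v - X p w = R (fst p) (v - w)" by (simp add: X_def blinfun.diff_right)
    also have "\<kappa> * norm (R (fst p) (v - w)) \<le> \<kappa> * (C * norm (v - w))" using Rz[OF p] \<kappa> by (intro mult_left_mono) auto
    also have "\<dots> = (\<kappa> * C) * norm (v - w)" by simp
    also have "\<dots> \<le> (1 / 2) * norm (v - w)" using \<kappa> by (intro mult_right_mono) auto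
    finally show ?thesis by simp
  qed
  have "\<exists>!z. z \<in> S \<and> G p z = z" if p: "p \<in> topspace ?Z" for p
  proof -
    have "\<exists>!z\<in>S. G p z = z"
    proof (rule Banach_fix[where c = "1/2"])
      show "complete S" by (simp add: S_def complete_eq_closed)
      have "0 \<in> S" using \<kappa> \<delta> by (simp add: S_def)
      then show "S \<noteq> {}" by blast
      show "G p ` S \<subseteq> S" using GS[OF p] by blast
      show "dist (G p v) (G p w) \<le> 1/2 * dist v w" if "v \<in> S" "w \<in> S" for v w
        using contr[OF p that] by (simp add: dist_norm)
    qed auto
    then show ?thesis by simp
  qed
  then have "\<forall>p. \<exists>z. p \<in> topspace ?Z \<longrightarrow> z \<in> S \<and> G p z = z" by blast
  then obtain z where z: "\<And>p. p \<in> topspace ?Z \<Longrightarrow> z p \<in> S \<and> G p (z p) = z p" by metis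
  have cfst: "continuous_map ?Z euclidean (\<lambda>p. R (fst p))" "continuous_map ?Z euclidean (\<lambda>p. L (fst p))"
    using continuous_map_compose[OF continuous_map_fst cR] continuous_map_compose[OF continuous_map_fst cL] by (simp_all add: o_def)
  have csnd: "continuous_map ?Z euclidean snd"
    using continuous_map_snd[of \<Lambda> "top_of_set (cball (0::'x) (\<delta> / 4))"] by (simp add: continuous_map_in_subtopology)
  have cX: "continuous_map ?Z euclidean (\<lambda>p. X p (w p))" if "continuous_map ?Z euclidean w" for w
    unfolding X_def by (intro continuous_map_add csnd continuous_map_blinfun_apply cfst that)
  have cfX: "continuous_map ?Z euclidean (\<lambda>p. f (fst p) (X p (w p)))"
    if w: "continuous_map ?Z euclidean w" "\<And>p. p \<in> topspace ?Z \<Longrightarrow> w p \<in> S" for w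
  proof -
    have "continuous_map ?Z (prod_topology \<Lambda> (top_of_set (ball 0 \<delta>))) (\<lambda>p. (fst p, X p (w p)))"
      unfolding continuous_map_paired continuous_map_in_subtopology
      using cX[OF w(1)] X\<delta> w(2) by (auto simp: continuous_map_fst)
    from continuous_map_compose[OF this cf] show ?thesis by (simp add: o_def)
  qed
  have cz: "continuous_map ?Z euclidean z"
  proof (rule continuous_map_fixed_point[where S = S and G = G])
    fix w assume w: "w \<in> S"
    have "continuous_map ?Z euclidean (\<lambda>p. - (f (fst p) (X p w) - L (fst p) (X p w)))"
      by (intro continuous_map_minus continuous_map_diff cfX continuous_map_blinfun_apply cfst cX) (use w in auto)
    then show "continuous_map ?Z euclidean (\<lambda>p. G p w)" by (simp add: G_def h_def)
  qed (use z contr in auto)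
  define \<Phi> where "\<Phi> l e = f l (X (l, e) (z (l, e)))" for l e
  have zeq: "z (l, e) = - h l (X (l, e) (z (l, e)))" and zS: "z (l, e) \<in> S" and X\<delta>': "norm (X (l, e) (z (l, e))) < \<delta>"
    if "l \<in> topspace \<Lambda>" "norm e \<le> \<delta> / 4" for l e
    using z[of "(l, e)"] X\<delta>[of "(l, e)"] that by (auto simp: G_def)
  have \<Phi>: "\<Phi> l e = L l e + (L l (R l (z (l, e))) - z (l, e))" if "l \<in> topspace \<Lambda>" "norm e \<le> \<delta> / 4" for l e
  proof -
    let ?x = "X (l, e) (z (l, e))"
    have "f l ?x = L l ?x + h l ?x" by (simp add: h_def)
    also have "h l ?x = - z (l, e)" using zeq[OF that] by (metis minus_minus)
    also have "L l ?x = L l e + L l (R l (z (l, e)))" by (simp add: X_def blinfun.add_right)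
    finally show ?thesis by (simp add: \<Phi>_def)
  qed
  have zb: "norm (z (l, e)) \<le> 2 * \<kappa> * norm e" if le: "l \<in> topspace \<Lambda>" "norm e \<le> \<delta> / 4" for l e
  proof -
    let ?z = "z (l, e)"
    have "norm ?z \<le> \<kappa> * norm (X (l, e) ?z)" using hb[OF le(1) X\<delta>'[OF le]] zeq[OF le] by (metis norm_minus_cancel)
    also have "\<dots> \<le> \<kappa> * (norm e + C * norm ?z)"
      using norm_triangle_ineq[of e "R l ?z"] Rz[OF le(1), of ?z] \<kappa> by (intro mult_left_mono) (auto simp: X_def)
    also have "\<dots> = \<kappa> * norm e + (\<kappa> * C) * norm ?z" by (simp add: algebra_simps)
    also have "\<dots> \<le> \<kappa> * norm e + (1 / 2) * norm ?z" using \<kappa> by (intro add_left_mono mult_right_mono) auto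
    finally show ?thesis by simp
  qed
  show ?thesis
  proof (rule that[of \<Phi>])
    have "continuous_map ?Z euclidean (\<lambda>p. f (fst p) (X p (z p)))" by (rule cfX[OF cz]) (use z in auto)
    then show "continuous_map ?Z euclidean (\<lambda>(l, e). \<Phi> l e)" by (simp add: \<Phi>_def case_prod_unfold)
    fix l and e :: 'x assume le: "l \<in> topspace \<Lambda>" "norm e \<le> \<delta> / 4"
    show "\<Phi> l e \<in> V" if "L l e \<in> V" unfolding \<Phi>[OF le] using LR[OF le(1)] that sV by (intro subspace_add)
    show "e = 0" if "\<Phi> l e = 0"
    proof -
      have X0: "X (l, e) (z (l, e)) = 0" using only0[OF le(1) X\<delta>'[OF le]] that by (simp add: \<Phi>_def)
      then have "z (l, e) = 0" using zeq[OF le] h0[OF le(1)] by simp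
      then show ?thesis using X0 by (simp add: X_def)
    qed
    have "norm (\<Phi> l e - L l e) \<le> norm (L l (R l (z (l, e)))) + norm (z (l, e))"
      unfolding \<Phi>[OF le] using norm_triangle_ineq4[of "L l (R l (z (l, e)))" "z (l, e)"] by simp
    also have "norm (L l (R l (z (l, e)))) \<le> norm (L l) * (C * norm (z (l, e)))"
      using norm_blinfun[of "L l" "R l (z (l, e))"] mult_left_mono[OF Rz[OF le(1), of "z (l, e)"] norm_ge_zero[of "L l"]] by linarith
    also have "norm (L l) * (C * norm (z (l, e))) + norm (z (l, e)) = (norm (L l) * C + 1) * norm (z (l, e))"
      by (simp add: algebra_simps)
    also have "\<dots> \<le> (norm (L l) * C + 1) * (2 * \<kappa> * norm e)"
      using zb[OF le] C by (intro mult_left_mono) auto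
    finally show "norm (\<Phi> l e - L l e) \<le> (norm (L l) * C + 1) * (2 * \<kappa>) * norm e" by (simp add: mult.assoc)
  qed
qed

section \<open>The index bundle\<close>

text \<open>\<open>c\<close> and \<open>d\<close> are inverse linear coordinates on \<open>V\<close>.  For \<open>i\<close> in the finite set \<open>I\<close> of base points,
  \<open>L l + K i\<close> is invertible for \<open>l \<in> U i\<close> and agrees with \<open>L l\<close> modulo \<open>V\<close>, so it trivializes the index
  bundle over \<open>U i\<close>.  The cut-off function \<open>\<rho> i\<close> vanishes on the open set \<open>N i\<close>, which covers \<open>\<Lambda>\<close> together
  with \<open>U i\<close>.\<close>

locale index_cover =
  fixes \<Lambda> :: "'l topology" and L :: "'l \<Rightarrow> 'x::banach \<Rightarrow>\<^sub>L 'y::banach" and V :: "'y set"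
    and n :: nat and c :: "'y \<Rightarrow> nat \<Rightarrow> real" and d :: "(nat \<Rightarrow> real) \<Rightarrow> 'y"
    and I :: "'l set" and U :: "'l \<Rightarrow> 'l set" and K :: "'l \<Rightarrow> 'x \<Rightarrow>\<^sub>L 'y" and \<rho> :: "'l \<Rightarrow> 'l \<Rightarrow> real" and N :: "'l \<Rightarrow> 'l set"
  assumes compact: "compact_space \<Lambda>" and Hausdorff: "Hausdorff_space \<Lambda>"
    and cL: "continuous_map \<Lambda> euclidean L" and sV: "subspace V"
    and c_cont: "continuous_map euclidean (Euclidean_space n) c" and d_cont: "continuous_map (Euclidean_space n) euclidean d"
    and c_lin: "\<And>v w a b. c (a *\<^sub>R v + b *\<^sub>R w) = a *\<^sub>R c v + b *\<^sub>R c w"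
    and d_lin: "\<And>v w a b. d (a *\<^sub>R v + b *\<^sub>R w) = a *\<^sub>R d v + b *\<^sub>R d w"
    and cd: "\<And>a. a \<in> topspace (Euclidean_space n) \<Longrightarrow> d a \<in> V \<and> c (d a) = a"
    and dc: "\<And>v. v \<in> V \<Longrightarrow> d (c v) = v" and dimV: "dim V = n"
    and finI: "finite I" and K_range: "\<And>i. i \<in> I \<Longrightarrow> range (blinfun_apply (K i)) \<subseteq> V"
    and bijK: "\<And>i l. i \<in> I \<Longrightarrow> l \<in> U i \<Longrightarrow> bij (blinfun_apply (L l + K i))"
    and U_open: "\<And>i. i \<in> I \<Longrightarrow> openin \<Lambda> (U i)"
    and \<rho>_cont: "\<And>i. i \<in> I \<Longrightarrow> continuous_map \<Lambda> euclideanreal (\<rho> i)" and \<rho>_nonneg: "\<And>i b. i \<in> I \<Longrightarrow> 0 \<le> \<rho> i b"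
    and N_open: "\<And>i. i \<in> I \<Longrightarrow> openin \<Lambda> (N i)" and NU: "\<And>i. i \<in> I \<Longrightarrow> topspace \<Lambda> \<subseteq> N i \<union> U i"
    and \<rho>_N: "\<And>i b. i \<in> I \<Longrightarrow> b \<in> N i \<Longrightarrow> \<rho> i b = 0"
    and cover: "\<And>b. b \<in> topspace \<Lambda> \<Longrightarrow> \<exists>i\<in>I. b \<in> U i \<and> \<rho> i b = 1"
begin

text \<open>The Euclidean product in the coordinates \<open>c\<close>. It is defined on the whole
  Banach space because \<open>c\<close> is, and is shown to be positive definite on
  \<open>V\<close>.\<close>

definition ip :: "'y \<Rightarrow> 'y \<Rightarrow> real" where "ip v w = (\<Sum>i<n. c v i * c w i)"
definition nrm :: "'y \<Rightarrow> 'y" where "nrm v = v /\<^sub>R sqrt (ip v v)"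
definition S :: "'y set" where "S = {v \<in> V. ip v v = 1}"

abbreviation E :: "('l, 'x) total_space" where "E \<equiv> index_bundle_total \<Lambda> L V"
abbreviation F :: "('l, 'y) total_space" where "F \<equiv> prod_topology \<Lambda> (top_of_set V)"

section \<open>Inner product and unit sphere of \<open>V\<close>\<close>

lemma ip_commute: "ip v w = ip w v"
  by (simp add: ip_def mult.commute)

lemma ip_linear: "ip (a *\<^sub>R v + b *\<^sub>R w) u = a * ip v u + b * ip w u"
  by (simp add: ip_def c_lin scaleR_fun_def sum_distrib_left sum.distrib algebra_simps)

lemma ip_scale: "ip (a *\<^sub>R v) (b *\<^sub>R w) = a * b * ip v w"
  using ip_linear[of a v 0 0 "b *\<^sub>R w"] ip_linear[of b w 0 0 v] by (simp add: ip_commute)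

lemma ip_nonneg: "0 \<le> ip v v"
  by (simp add: ip_def sum_nonneg)

lemma ip_pos: assumes "v \<in> V" "v \<noteq> 0" shows "0 < ip v v"
proof -
  have c_top: "c v \<in> topspace (Euclidean_space n)" for v
    using continuous_map_image_subset_topspace[OF c_cont] by auto
  have "ip v v \<noteq> 0"
  proof
    assume "ip v v = 0"
    then have "c v i = 0" if "i < n" for i
      using that by (simp add: ip_def sum_nonneg_eq_0_iff)
    then have "c v i = 0" for i using c_top[of v] by (cases "i < n") (auto simp: topspace_Euclidean_space)
    then have "c v = 0 *\<^sub>R c v" by (simp add: fun_eq_iff scaleR_fun_def)
    moreover have "d (0 *\<^sub>R c v) = 0" using d_lin[of 0 "c v" 0 "c v"] by simp
    ultimately show False using dc[OF assms(1)] assms(2) by simp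
  qed
  then show ?thesis using ip_nonneg[of v] by linarith
qed

lemma continuous_map_ip:
  assumes "continuous_map Z euclidean a" "continuous_map Z euclidean b"
  shows "continuous_map Z euclideanreal (\<lambda>z. ip (a z) (b z))"
proof -
  have "continuous_map Z euclideanreal (\<lambda>z. c (a z) i)" if "continuous_map Z euclidean a" for a i
    using continuous_map_compose[OF that c_cont] unfolding continuous_map_Euclidean_iff by (simp add: o_def)
  then show ?thesis unfolding ip_def using assms by (intro continuous_map_sum continuous_map_real_mult) auto
qed

lemma nrm_in_S: "v \<in> V \<Longrightarrow> v \<noteq> 0 \<Longrightarrow> nrm v \<in> S"
  using ip_pos[of v] subspace_scale[OF sV, of v]
  by (simp add: nrm_def S_def ip_scale) (simp add: field_simps)

lemma nrm_S: "v \<in> S \<Longrightarrow> nrm v = v"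
  by (simp add: nrm_def S_def)

lemma S_nonzero: "v \<in> S \<Longrightarrow> v \<noteq> 0"
  using ip_linear[of 0 0 0 0 0] by (auto simp: S_def)

lemma nrm_scale: "0 < a \<Longrightarrow> nrm (a *\<^sub>R v) = nrm v"
  by (simp add: nrm_def ip_scale real_sqrt_mult)

lemma continuous_map_nrm:
  assumes "continuous_map Z euclidean a" "\<And>z. z \<in> topspace Z \<Longrightarrow> a z \<in> V \<and> a z \<noteq> 0"
  shows "continuous_map Z euclidean (\<lambda>z. nrm (a z))"
  unfolding nrm_def
proof (intro continuous_map_scale assms(1))
  have "continuous_on {0<..} (\<lambda>t::real. inverse (sqrt t))" by (auto intro!: continuous_intros)
  then show "continuous_map Z euclideanreal (\<lambda>z. inverse (sqrt (ip (a z) (a z))))"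
    by (rule continuous_map_of_continuous_on[OF continuous_map_ip[OF assms(1) assms(1)]]) (use assms(2) ip_pos in auto)
qed

lemma compact_S: "compact S"
proof -
  have ipd: "ip (d a) (d a) = (\<Sum>i<n. (a i)\<^sup>2)" if "a \<in> topspace (Euclidean_space n)" for a
    using cd[OF that] by (simp add: ip_def power2_eq_square)
  have "S = d ` boundary_sphere n"
  proof (intro equalityI subsetI)
    fix v assume v: "v \<in> S"
    then have "v = d (c v)" "c v \<in> topspace (Euclidean_space n)"
      using dc continuous_map_image_subset_topspace[OF c_cont] by (auto simp: S_def)
    moreover have "(\<Sum>i<n. (c v i)\<^sup>2) = 1" using v by (simp add: S_def ip_def power2_eq_square)
    ultimately show "v \<in> d ` boundary_sphere n" by (auto simp: boundary_sphere_def)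
  qed (auto simp: boundary_sphere_def S_def cd ipd)
  then show ?thesis using image_compactin[OF compactin_boundary_sphere d_cont] by simp
qed

text \<open>Stated for an arbitrary operator \<open>T\<close>, because besides the
  \<open>K i\<close> also \<open>T = 0\<close> occurs, near the point where \<open>L\<close> itself
  is invertible.\<close>

definition correction :: "'l set \<Rightarrow> ('x \<Rightarrow>\<^sub>L 'y) \<Rightarrow> bool" where
  "correction W T \<longleftrightarrow> openin \<Lambda> W \<and> range (blinfun_apply T) \<subseteq> V \<and> (\<forall>l\<in>W. bij (blinfun_apply (L l + T)))"

lemma correction_exists: "b \<in> topspace \<Lambda> \<Longrightarrow> \<exists>i\<in>I. b \<in> U i \<and> correction (U i) (K i)"
  using cover[of b] K_range bijK U_open unfolding correction_def by metis

lemma correction_in_V: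
  assumes "range (blinfun_apply T) \<subseteq> V"
  shows "(L l + T) x \<in> V \<longleftrightarrow> L l x \<in> V"
proof -
  have T: "T x \<in> V" using assms by auto
  have "L l x = (L l + T) x - T x" by (simp add: blinfun.add_left)
  then show ?thesis using subspace_add[OF sV _ T] subspace_diff[OF sV _ T] by (metis blinfun.add_left)
qed

section \<open>Local triviality, metric and global right inverse for the index bundle\<close>

lemma topspace_E: "topspace E = {(l, x). l \<in> topspace \<Lambda> \<and> L l x \<in> V}"
  by (auto simp: index_bundle_total_def)

lemma continuous_E_fst: "continuous_map E \<Lambda> fst"
  unfolding index_bundle_total_def by (intro continuous_map_from_subtopology continuous_map_fst)

lemma continuous_E_snd: "continuous_map E euclidean snd"
  unfolding index_bundle_total_def by (intro continuous_map_from_subtopology continuous_map_snd)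

lemma continuous_map_into_E:
  assumes "continuous_map Z \<Lambda> a" "continuous_map Z euclidean b" "\<And>z. z \<in> topspace Z \<Longrightarrow> L (a z) (b z) \<in> V"
  shows "continuous_map Z E (\<lambda>z. (a z, b z))"
  unfolding index_bundle_total_def continuous_map_in_subtopology continuous_map_paired using assms by auto

lemma continuous_map_L:
  assumes "continuous_map Z \<Lambda> a" shows "continuous_map Z euclidean (\<lambda>z. L (a z) + T)"
proof -
  have "continuous_map Z euclidean (\<lambda>z. L (a z))" using continuous_map_compose[OF assms cL] by (simp add: o_def)
  then show ?thesis by (rule continuous_map_add) simp
qed

lemma continuous_map_binv_L:
  assumes W: "correction W T" and a: "continuous_map Z \<Lambda> a" "\<And>z. z \<in> topspace Z \<Longrightarrow> a z \<in> W"
  shows "continuous_map Z euclidean (\<lambda>z. binv (L (a z) + T))"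
  by (rule continuous_map_of_continuous_on[OF continuous_map_L[OF a(1)] continuous_on_binv])
     (use W a(2) in \<open>auto simp: correction_def\<close>)

text \<open>\<open>L l + T\<close> is invertible and agrees with \<open>L l\<close> modulo
  \<open>V\<close>, so it maps the fibre of \<open>E\<close> at \<open>l\<close> isomorphically onto
  \<open>V\<close>, where \<open>c\<close> gives coordinates. Continuity of operator inversion makes
  the inverse continuous.\<close>

lemma correction_bundle_iso:
  assumes W: "correction W T"
  shows "bundle_iso (over E W) (prod_topology (subtopology \<Lambda> W) (Euclidean_space n))"
proof -
  have bij: "bij (blinfun_apply (L l + T))" if "l \<in> W" for l using W that by (simp add: correction_def)
  have T: "range (blinfun_apply T) \<subseteq> V" using W by (simp add: correction_def)
  have inV: "(L l + T) x \<in> V" if "(l, x) \<in> topspace (over E W)" for l x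
    using that correction_in_V[OF T] by (simp add: topspace_E)
  let ?G = "prod_topology (subtopology \<Lambda> W) (Euclidean_space n)"
  show ?thesis
  proof (rule bundle_isoI'[where s = "\<lambda>l x. c ((L l + T) x)" and t = "\<lambda>l a. binv (L l + T) (d a)"])
    have fE: "continuous_map (over E W) \<Lambda> fst" and sE: "continuous_map (over E W) euclidean snd"
      by (intro continuous_map_from_subtopology continuous_E_fst continuous_E_snd)+
    have "continuous_map (over E W) euclidean (\<lambda>p. (L (fst p) + T) (snd p))"
      by (rule continuous_map_blinfun_apply[OF continuous_map_L[OF fE] sE])
    from continuous_map_compose[OF this c_cont]
    show "continuous_map (over E W) ?G (\<lambda>p. (fst p, c ((L (fst p) + T) (snd p))))"
      unfolding continuous_map_paired using fE by (auto simp: o_def continuous_map_in_subtopology)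
    have fG: "continuous_map ?G \<Lambda> fst"
      using continuous_map_fst[of "subtopology \<Lambda> W" "Euclidean_space n"] by (simp add: continuous_map_in_subtopology)
    have sG: "continuous_map ?G euclidean (\<lambda>p. d (snd p))"
      using continuous_map_compose[OF continuous_map_snd d_cont] by (simp add: o_def)
    have "continuous_map ?G E (\<lambda>p. (fst p, binv (L (fst p) + T) (d (snd p))))"
    proof (rule continuous_map_into_E[OF fG])
      show "continuous_map ?G euclidean (\<lambda>p. binv (L (fst p) + T) (d (snd p)))"
        by (rule continuous_map_blinfun_apply[OF continuous_map_binv_L[OF W fG] sG]) auto
      fix p assume "p \<in> topspace ?G"
      then show "L (fst p) (binv (L (fst p) + T) (d (snd p))) \<in> V"
        using correction_in_V[OF T, of "fst p" "binv (L (fst p) + T) (d (snd p))"] cd[of "snd p"]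
          binv(1)[OF bij[of "fst p"], of "d (snd p)"] by auto
    qed
    then show "continuous_map ?G (over E W) (\<lambda>p. (fst p, binv (L (fst p) + T) (d (snd p))))"
      by (auto simp: continuous_map_in_subtopology)
  next
    fix l x assume lx: "(l, x) \<in> topspace (over E W)"
    then show "binv (L l + T) (d (c ((L l + T) x))) = x" using dc[OF inV[OF lx]] binv(2)[OF bij] by simp
  next
    fix l a assume "(l, a) \<in> topspace ?G"
    then show "c ((L l + T) (binv (L l + T) (d a))) = a" using cd[of a] binv(1)[OF bij] by simp
  qed (simp add: c_lin blinfun.add_right blinfun.scaleR_right)
qed

lemma vector_bundle_E: "vector_bundle \<Lambda> E"
  unfolding vector_bundle_def
proof (intro conjI ballI continuous_E_fst)
  fix l assume l: "l \<in> topspace \<Lambda>"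
  have "fibre E l = {x. L l x \<in> V}" using l by (auto simp: fibre_def topspace_E)
  then show "subspace (fibre E l)"
    using sV by (auto simp: subspace_def blinfun.add_right blinfun.scaleR_right)
  obtain i where i: "i \<in> I" "l \<in> U i" "correction (U i) (K i)" using correction_exists[OF l] by blast
  then show "\<exists>U n. openin \<Lambda> U \<and> l \<in> U \<and> bundle_iso (over E U) (prod_topology (subtopology \<Lambda> U) (Euclidean_space n))"
    using correction_bundle_iso[OF i(3)] U_open[OF i(1)] by blast
qed

lemma dim_fibre_E:
  assumes l: "l \<in> topspace \<Lambda>" shows "dim (fibre E l) = n"
proof -
  obtain i where i: "i \<in> I" "l \<in> U i" "correction (U i) (K i)" using correction_exists[OF l] by blast
  show ?thesis
    by (rule local_trivial_dim[OF correction_bundle_iso[OF i(3)] vector_bundle_prelinear[OF vector_bundle_E] i(2) l])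
       (use vector_bundle_E l in \<open>simp add: vector_bundle_def\<close>)
qed

lemma vector_bundle_F: "vector_bundle \<Lambda> F"
proof (rule bundle_iso_vector_bundle[OF vector_bundle_trivial[of \<Lambda> n]])
  show "bundle_iso (trivial_bundle \<Lambda> n) F"
    unfolding trivial_bundle_def
  proof (rule bundle_isoI'[where s = "\<lambda>l. d" and t = "\<lambda>l. c"])
    have "continuous_map (prod_topology \<Lambda> (Euclidean_space n)) euclidean (\<lambda>p. d (snd p))"
      using continuous_map_compose[OF continuous_map_snd d_cont] by (simp add: o_def)
    then show "continuous_map (prod_topology \<Lambda> (Euclidean_space n)) F (\<lambda>p. (fst p, d (snd p)))"
      unfolding continuous_map_paired using cd by (auto simp: continuous_map_in_subtopology continuous_map_fst)
    have "continuous_map F euclidean snd"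
      using continuous_map_snd[of \<Lambda> "top_of_set V"] by (simp add: continuous_map_in_subtopology)
    then have "continuous_map F (Euclidean_space n) (\<lambda>p. c (snd p))"
      using continuous_map_compose[OF _ c_cont] by (fastforce simp: o_def)
    then show "continuous_map F (prod_topology \<Lambda> (Euclidean_space n)) (\<lambda>p. (fst p, c (snd p)))"
      unfolding continuous_map_paired by (auto simp: continuous_map_fst)
  qed (use cd dc d_lin in auto)
qed

lemma fibre_F: "l \<in> topspace \<Lambda> \<Longrightarrow> fibre F l = V"
  by (auto simp: fibre_def)

text \<open>The products pulled back from \<open>V\<close> by the local trivializations, added with
  cut-off weights. The weights are not normalized: for positivity one positive summand is
  enough.\<close>

definition g :: "'l \<Rightarrow> 'x \<Rightarrow> 'x \<Rightarrow> real" where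
  "g l x x' = (\<Sum>i\<in>I. if l \<in> U i then \<rho> i l *\<^sub>R ip ((L l + K i) x) ((L l + K i) x') else 0)"

lemma g_scale: "g l (a *\<^sub>R x) (b *\<^sub>R x') = a * b * g l x x'"
  unfolding g_def sum_distrib_left by (intro sum.cong) (auto simp: blinfun.scaleR_right ip_scale)

lemma g_pos:
  assumes "(l, x) \<in> topspace E" "x \<noteq> 0" shows "0 < g l x x"
proof -
  have l: "l \<in> topspace \<Lambda>" "L l x \<in> V" using assms(1) by (auto simp: topspace_E)
  obtain i where i: "i \<in> I" "l \<in> U i" "\<rho> i l = 1" using cover[OF l(1)] by blast
  have "(L l + K i) x \<in> V" using correction_in_V[OF K_range[OF i(1)]] l(2) by simp
  moreover have "(L l + K i) x \<noteq> 0" using binv(2)[OF bijK[OF i(1,2)], of x] assms(2) by auto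
  ultimately have "0 < ip ((L l + K i) x) ((L l + K i) x)" by (rule ip_pos)
  then show ?thesis
    unfolding g_def using i by (intro sum_pos2[OF finI i(1)]) (auto simp: \<rho>_nonneg ip_nonneg)
qed

lemma continuous_map_g:
  assumes f: "continuous_map Z \<Lambda> a" and x: "continuous_map Z euclidean x" and y: "continuous_map Z euclidean y"
  shows "continuous_map Z euclideanreal (\<lambda>z. g (a z) (x z) (y z))"
  unfolding g_def
proof (intro continuous_map_sum finI)
  fix i assume i: "i \<in> I"
  show "continuous_map Z euclideanreal (\<lambda>z. if a z \<in> U i then \<rho> i (a z) *\<^sub>R ip ((L (a z) + K i) (x z)) ((L (a z) + K i) (y z)) else 0)"
    by (rule cutoff_continuous[OF f \<rho>_cont[OF i] U_open[OF i] N_open[OF i] NU[OF i] \<rho>_N[OF i]])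
       (assumption, intro continuous_map_from_subtopology continuous_map_ip continuous_map_blinfun_apply continuous_map_L f x y)
qed

lemma fibre_metric_g: "fibre_metric \<Lambda> E g"
  unfolding fibre_metric_def
proof (intro conjI ballI allI impI)
  have "continuous_map (whitney_sum E E) \<Lambda> fst"
    using continuous_map_compose[OF continuous_map_whitney_proj(1) continuous_E_fst] by (simp add: o_def)
  moreover have "continuous_map (whitney_sum E E) euclidean (\<lambda>p. fst (snd p))" "continuous_map (whitney_sum E E) euclidean (\<lambda>p. snd (snd p))"
    using continuous_map_compose[OF continuous_map_whitney_proj(1) continuous_E_snd]
      continuous_map_compose[OF continuous_map_whitney_proj(2) continuous_E_snd] by (simp_all add: o_def)
  ultimately show "continuous_map (whitney_sum E E) euclideanreal (\<lambda>(l, v, w). g l v w)"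
    unfolding case_prod_unfold by (rule continuous_map_g)
  fix l u v w and a b :: real
  show "g l (a *\<^sub>R u + b *\<^sub>R v) w = a * g l u w + b * g l v w"
    unfolding g_def sum_distrib_left sum.distrib[symmetric]
    by (intro sum.cong) (auto simp: blinfun.add_right blinfun.scaleR_right ip_linear algebra_simps)
  show "g l v w = g l w v" unfolding g_def by (intro sum.cong refl) (metis ip_commute)
qed (use g_pos in \<open>auto simp: fibre_def\<close>)

lemma fibre_metric_ip: "fibre_metric \<Lambda> F (\<lambda>l. ip)"
  unfolding fibre_metric_def
proof (intro conjI ballI allI impI)
  have F: "continuous_map F euclidean snd"
    using continuous_map_snd[of \<Lambda> "top_of_set V"] by (simp add: continuous_map_in_subtopology)
  have "continuous_map (whitney_sum F F) euclidean (\<lambda>p. fst (snd p))" "continuous_map (whitney_sum F F) euclidean (\<lambda>p. snd (snd p))"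
    using continuous_map_compose[OF continuous_map_whitney_proj(1) F]
      continuous_map_compose[OF continuous_map_whitney_proj(2) F] by (simp_all add: o_def)
  then show "continuous_map (whitney_sum F F) euclideanreal (\<lambda>(l, v, w). ip v w)"
    unfolding case_prod_unfold by (rule continuous_map_ip)
  fix l u v w and a b :: real
  show "ip (a *\<^sub>R u + b *\<^sub>R v) w = a * ip u w + b * ip v w" by (rule ip_linear)
  show "ip v w = ip w v" by (rule ip_commute)
qed (auto simp: fibre_def ip_pos)

text \<open>Right inverses modulo \<open>V\<close> are stable under affine combinations, so the
  local ones \<open>binv (L l + K i)\<close> can be averaged. Here, unlike for \<open>g\<close>, the
  weights must add up to 1.\<close>

definition R :: "'l \<Rightarrow> 'y \<Rightarrow>\<^sub>L 'x" where
  "R l = (\<Sum>i\<in>I. if l \<in> U i then (\<rho> i l / (\<Sum>j\<in>I. \<rho> j l)) *\<^sub>R binv (L l + K i) else 0)"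

lemma sum_\<rho>_pos: "l \<in> topspace \<Lambda> \<Longrightarrow> 0 < (\<Sum>j\<in>I. \<rho> j l)"
  using cover[of l] finI \<rho>_nonneg by (auto intro!: sum_pos2)

lemma continuous_R: "continuous_map \<Lambda> euclidean R"
  unfolding R_def
proof (intro continuous_map_sum finI)
  fix i assume i: "i \<in> I"
  have id: "continuous_map \<Lambda> \<Lambda> (\<lambda>l. l)" by simp
  have W: "correction (U i) (K i)" using i K_range bijK U_open by (simp add: correction_def)
  have "continuous_map \<Lambda> euclideanreal (\<lambda>l. \<rho> i l / (\<Sum>j\<in>I. \<rho> j l))"
    by (intro continuous_map_real_divide continuous_map_sum finI \<rho>_cont i) (use sum_\<rho>_pos in \<open>auto simp: less_imp_neq[symmetric]\<close>)
  from cutoff_continuous[OF id this U_open[OF i] N_open[OF i] NU[OF i]]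
  show "continuous_map \<Lambda> euclidean (\<lambda>l. if l \<in> U i then (\<rho> i l / (\<Sum>j\<in>I. \<rho> j l)) *\<^sub>R binv (L l + K i) else 0)"
    using \<rho>_N[OF i] continuous_map_binv_L[OF W continuous_map_from_subtopology[OF id], of "{l \<in> topspace \<Lambda>. l \<in> U i}"]
    by auto
qed

text \<open>\<open>L l\<close> applied to \<open>binv (L l + K i) y\<close> is \<open>y\<close>
  minus a value of \<open>K i\<close>, hence \<open>y\<close> modulo \<open>V\<close>; averaging
  with total weight 1 keeps this.\<close>

lemma R_right_inverse:
  assumes l: "l \<in> topspace \<Lambda>" shows "L l (R l y) - y \<in> V"
proof -
  let ?w = "\<lambda>i. \<rho> i l / (\<Sum>j\<in>I. \<rho> j l)"
  have w1: "(\<Sum>i\<in>I. ?w i) = 1" using sum_\<rho>_pos[OF l] by (simp flip: sum_divide_distrib)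
  have "L l (R l y) - y = (\<Sum>i\<in>I. L l (blinfun_apply (if l \<in> U i then ?w i *\<^sub>R binv (L l + K i) else 0) y) - ?w i *\<^sub>R y)"
    using w1 by (simp add: R_def blinfun.sum_left blinfun.sum_right sum_subtractf flip: scaleR_sum_left)
  moreover have "L l (blinfun_apply (if l \<in> U i then ?w i *\<^sub>R binv (L l + K i) else 0) y) - ?w i *\<^sub>R y \<in> V" if i: "i \<in> I" for i
  proof (cases "l \<in> U i")
    case True
    let ?z = "binv (L l + K i) y"
    have "L l ?z = y - K i ?z" using binv(1)[OF bijK[OF i True], of y] by (simp add: blinfun.add_left algebra_simps)
    then have "L l (?w i *\<^sub>R ?z) - ?w i *\<^sub>R y = (- ?w i) *\<^sub>R K i ?z"
      by (simp add: blinfun.scaleR_right scaleR_diff_right)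
    moreover have "(- ?w i) *\<^sub>R K i ?z \<in> V" using K_range[OF i] by (intro subspace_scale[OF sV]) auto
    ultimately show ?thesis using True by (simp add: blinfun.scaleR_left)
  next
    case False
    then have "\<rho> i l = 0" using NU[OF i] \<rho>_N[OF i] l by blast
    then show ?thesis using False subspace_0[OF sV] by simp
  qed
  ultimately show ?thesis by (simp add: subspace_sum[OF sV])
qed

end

section \<open>Sphere maps\<close>

context index_cover begin

abbreviation P :: "('l, 'x) total_space" where "P \<equiv> sphere_bundle E g"
abbreviation Q :: "('l, 'y) total_space" where "Q \<equiv> sphere_bundle F (\<lambda>l. ip)"

lemma Q_eq: "Q = prod_topology \<Lambda> (top_of_set S)"
proof -
  have "Q = subtopology (prod_topology \<Lambda> euclidean) (topspace \<Lambda> \<times> V \<inter> {(l, v). ip v v = 1})"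
    by (simp add: sphere_bundle_def prod_topology_subtopology subtopology_subtopology)
  also have "topspace \<Lambda> \<times> V \<inter> {(l, v). ip v v = 1} = topspace \<Lambda> \<times> S" by (auto simp: S_def)
  finally show ?thesis by (simp add: prod_topology_subtopology)
qed

lemma over_Q_eq: "over Q W = prod_topology (subtopology \<Lambda> W) (top_of_set S)"
  using over_prod_topology[of W UNIV \<Lambda> "top_of_set S"] by (simp add: Q_eq)

lemma topspace_P: "topspace P = {(l, x). l \<in> topspace \<Lambda> \<and> L l x \<in> V \<and> g l x x = 1}"
  by (auto simp: sphere_bundle_def topspace_E)

lemma continuous_P_fst: "continuous_map P \<Lambda> fst"
  unfolding sphere_bundle_def by (intro continuous_map_from_subtopology continuous_E_fst)

lemma continuous_P_snd: "continuous_map P euclidean snd"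
  unfolding sphere_bundle_def by (intro continuous_map_from_subtopology continuous_E_snd)

lemma continuous_Q_fst: "continuous_map Q \<Lambda> fst"
  by (simp add: Q_eq continuous_map_fst)

lemma continuous_Q_snd: "continuous_map Q (top_of_set S) snd"
  by (simp add: Q_eq continuous_map_snd)

lemma P_nonzero: "(l, x) \<in> topspace P \<Longrightarrow> x \<noteq> 0"
  using g_scale[of l 0 0 0 0] by (auto simp: topspace_P)

lemma continuous_map_into_P:
  assumes "continuous_map Z \<Lambda> a" "continuous_map Z euclidean b"
    "\<And>z. z \<in> topspace Z \<Longrightarrow> L (a z) (b z) \<in> V \<and> g (a z) (b z) (b z) = 1"
  shows "continuous_map Z P (\<lambda>z. (a z, b z))"
  using continuous_map_into_E[OF assms(1,2)] assms(3)
  by (auto simp: sphere_bundle_def continuous_map_in_subtopology)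

lemma continuous_map_into_Q:
  assumes "continuous_map Z \<Lambda> a" "continuous_map Z euclidean b" "\<And>z. z \<in> topspace Z \<Longrightarrow> b z \<in> S"
  shows "continuous_map Z Q (\<lambda>z. (a z, b z))"
  using assms unfolding Q_eq continuous_map_paired by (auto simp: continuous_map_in_subtopology)

definition triv :: "('x \<Rightarrow>\<^sub>L 'y) \<Rightarrow> 'l \<times> 'x \<Rightarrow> 'l \<times> 'y" where
  "triv T p = (fst p, nrm ((L (fst p) + T) (snd p)))"

definition unit_vector :: "'l \<Rightarrow> 'x \<Rightarrow> 'x" where "unit_vector l x = x /\<^sub>R sqrt (g l x x)"

definition untriv :: "('x \<Rightarrow>\<^sub>L 'y) \<Rightarrow> 'l \<times> 'y \<Rightarrow> 'l \<times> 'x" where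
  "untriv T p = (fst p, unit_vector (fst p) (binv (L (fst p) + T) (snd p)))"

text \<open>A linear isomorphism followed by radial projection to the unit sphere. The positive
  factors introduced on one side are removed by the normalization on the other.\<close>

lemma triv_homeomorphic:
  assumes W: "correction W T"
  shows "homeomorphic_maps (over P W) (over Q W) (triv T) (untriv T)"
proof -
  have bij: "bij (blinfun_apply (L l + T))" if "l \<in> W" for l using W that by (simp add: correction_def)
  have T: "range (blinfun_apply T) \<subseteq> V" using W by (simp add: correction_def)
  have inV: "(L l + T) x \<in> V \<and> (L l + T) x \<noteq> 0" if "(l, x) \<in> topspace P" "l \<in> W" for l x
    using that correction_in_V[OF T] P_nonzero[OF that(1)] binv(2)[OF bij[OF that(2)], of x]
    by (auto simp: topspace_P)
  have inE: "(l, binv (L l + T) v) \<in> topspace E \<and> binv (L l + T) v \<noteq> 0" if "l \<in> topspace \<Lambda>" "v \<in> S" "l \<in> W" for l v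
    using that correction_in_V[OF T, of l "binv (L l + T) v"] binv(1)[OF bij[OF that(3)], of v] S_nonzero[OF that(2)]
    by (auto simp: topspace_E S_def)
  have gpos: "0 < g l (binv (L l + T) v) (binv (L l + T) v)" if "l \<in> topspace \<Lambda>" "v \<in> S" "l \<in> W" for l v
    using inE[OF that] g_pos by blast
  have fP: "continuous_map (over P W) \<Lambda> fst" and sP: "continuous_map (over P W) euclidean snd"
    by (intro continuous_map_from_subtopology continuous_P_fst continuous_P_snd)+
  have fQ: "continuous_map (over Q W) \<Lambda> fst" by (intro continuous_map_from_subtopology continuous_Q_fst)
  have sQ: "continuous_map (over Q W) euclidean snd"
    using continuous_map_from_subtopology[OF continuous_Q_snd] by (simp add: continuous_map_in_subtopology)
  have tQ: "topspace (over Q W) = {(l, v). l \<in> topspace \<Lambda> \<and> l \<in> W \<and> v \<in> S}"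
    by (auto simp: Q_eq)
  show ?thesis
    unfolding homeomorphic_maps_def
  proof (intro conjI ballI)
    have "continuous_map (over P W) Q (\<lambda>p. (fst p, nrm ((L (fst p) + T) (snd p))))"
    proof (rule continuous_map_into_Q[OF fP])
      show "continuous_map (over P W) euclidean (\<lambda>p. nrm ((L (fst p) + T) (snd p)))"
        by (rule continuous_map_nrm[OF continuous_map_blinfun_apply[OF continuous_map_L[OF fP] sP]]) (use inV in auto)
    qed (use inV nrm_in_S in auto)
    then show "continuous_map (over P W) (over Q W) (triv T)"
      unfolding triv_def[abs_def] by (auto simp: continuous_map_in_subtopology)
    have cb: "continuous_map (over Q W) euclidean (\<lambda>p. binv (L (fst p) + T) (snd p))"
      by (rule continuous_map_blinfun_apply[OF continuous_map_binv_L[OF W fQ] sQ]) auto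
    have "continuous_map (over Q W) P (\<lambda>p. (fst p, unit_vector (fst p) (binv (L (fst p) + T) (snd p))))"
    proof (rule continuous_map_into_P[OF fQ])
      have "continuous_on {0<..} (\<lambda>t::real. inverse (sqrt t))" by (auto intro!: continuous_intros)
      then have "continuous_map (over Q W) euclideanreal
         (\<lambda>p. inverse (sqrt (g (fst p) (binv (L (fst p) + T) (snd p)) (binv (L (fst p) + T) (snd p)))))"
      proof (rule continuous_map_of_continuous_on[OF continuous_map_g[OF fQ cb cb]])
        fix p assume "p \<in> topspace (over Q W)"
        then have "fst p \<in> topspace \<Lambda>" "snd p \<in> S" "fst p \<in> W" unfolding tQ by auto
        from gpos[OF this] show "g (fst p) (binv (L (fst p) + T) (snd p)) (binv (L (fst p) + T) (snd p)) \<in> {0<..}" by simp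
      qed
      then show "continuous_map (over Q W) euclidean (\<lambda>p. unit_vector (fst p) (binv (L (fst p) + T) (snd p)))"
        unfolding unit_vector_def by (rule continuous_map_scale[OF _ cb])
      fix p assume "p \<in> topspace (over Q W)"
      then obtain l v where p: "p = (l, v)" "l \<in> topspace \<Lambda>" "v \<in> S" "l \<in> W" unfolding tQ by blast
      have "L l (binv (L l + T) v) \<in> V" using inE[OF p(2-4)] by (simp add: topspace_E)
      then show "L (fst p) (unit_vector (fst p) (binv (L (fst p) + T) (snd p))) \<in> V \<and>
          g (fst p) (unit_vector (fst p) (binv (L (fst p) + T) (snd p))) (unit_vector (fst p) (binv (L (fst p) + T) (snd p))) = 1"
        using gpos[OF p(2-4)] subspace_scale[OF sV]
        by (simp add: p(1) unit_vector_def blinfun.scaleR_right g_scale) (simp add: field_simps)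
    qed
    then show "continuous_map (over Q W) (over P W) (untriv T)"
      unfolding untriv_def[abs_def] by (auto simp: continuous_map_in_subtopology)
  next
    fix p assume p: "p \<in> topspace (over P W)"
    then obtain l x where lx: "p = (l, x)" "(l, x) \<in> topspace P" "l \<in> W" by auto
    let ?m = "(L l + T) x"
    have a: "0 < ip ?m ?m" using inV[OF lx(2,3)] ip_pos by blast
    have "binv (L l + T) (nrm ?m) = x /\<^sub>R sqrt (ip ?m ?m)"
      by (simp add: nrm_def blinfun.scaleR_right binv(2)[OF bij[OF lx(3)]])
    moreover have "unit_vector l (x /\<^sub>R sqrt (ip ?m ?m)) = x"
      using a lx(2) by (simp add: unit_vector_def g_scale topspace_P real_sqrt_mult real_sqrt_inverse)
    ultimately show "untriv T (triv T p) = p" by (simp add: lx(1) untriv_def triv_def)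
  next
    fix p assume "p \<in> topspace (over Q W)"
    then obtain l v where p: "p = (l, v)" "l \<in> topspace \<Lambda>" "v \<in> S" "l \<in> W" unfolding tQ by blast
    have "nrm ((L l + T) (unit_vector l (binv (L l + T) v))) = v"
      unfolding unit_vector_def blinfun.scaleR_right binv(1)[OF bij[OF p(4)]]
      using nrm_scale[of "inverse (sqrt (g l (binv (L l + T) v) (binv (L l + T) v)))" v] gpos[OF p(2-4)] nrm_S[OF p(3)] by simp
    then show "triv T (untriv T p) = p" by (simp add: p(1) triv_def untriv_def)
  qed
qed

text \<open>Serves twice: near each base point, to freeze the sphere map there, and at
  \<open>b0\<close>, to compare it with the linear map.\<close>

lemma straight_homotopy:
  fixes Z :: "('l, 'w) total_space"
  assumes f: "continuous_map Z \<Lambda> fst" "\<And>p. p \<in> topspace Z \<Longrightarrow> fst p \<in> W"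
    and a: "continuous_map Z euclidean a" "\<And>p. p \<in> topspace Z \<Longrightarrow> a p \<in> V" and b: "continuous_map Z euclidean b" "\<And>p. p \<in> topspace Z \<Longrightarrow> b p \<in> V"
    and nz: "\<And>p t. p \<in> topspace Z \<Longrightarrow> 0 \<le> t \<Longrightarrow> t \<le> 1 \<Longrightarrow> (1 - t) *\<^sub>R a p + t *\<^sub>R b p \<noteq> 0"
  shows "fibre_homotopic Z (over Q W) (\<lambda>p. (fst p, nrm (a p))) (\<lambda>p. (fst p, nrm (b p)))"
  unfolding fibre_homotopic_iff
proof (intro exI conjI ballI)
  let ?X = "prod_topology (top_of_set {0..1::real}) Z"
  let ?c = "\<lambda>q. (1 - fst q) *\<^sub>R a (snd q) + fst q *\<^sub>R b (snd q)"
  have 1: "continuous_map ?X euclideanreal fst"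
    using continuous_map_fst[of "top_of_set {0..1::real}" Z] by (simp add: continuous_map_in_subtopology)
  have 2: "continuous_map ?X \<Lambda> (\<lambda>q. fst (snd q))" "continuous_map ?X euclidean (\<lambda>q. a (snd q))" "continuous_map ?X euclidean (\<lambda>q. b (snd q))"
    using continuous_map_compose[OF continuous_map_snd f(1)] continuous_map_compose[OF continuous_map_snd a(1)]
      continuous_map_compose[OF continuous_map_snd b(1)] by (simp_all add: o_def)
  have c: "continuous_map ?X euclidean ?c"
    by (intro continuous_map_add continuous_map_scale continuous_map_diff 1 2) simp
  have inV: "?c q \<in> V \<and> ?c q \<noteq> 0" if "q \<in> topspace ?X" for q
    using that a(2) b(2) nz[of "snd q" "fst q"] by (auto intro!: subspace_add[OF sV] subspace_scale[OF sV])
  have "continuous_map ?X Q (\<lambda>q. (fst (snd q), nrm (?c q)))"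
    by (rule continuous_map_into_Q[OF 2(1) continuous_map_nrm[OF c]]) (use inV nrm_in_S in blast)+
  then show "continuous_map ?X (over Q W) (\<lambda>q. (fst (snd q), nrm (?c q)))"
    using f(2) by (auto simp: continuous_map_in_subtopology)
qed auto

end

text \<open>What is kept of the nonlinear problem: a map without zeros from the sphere bundle to
  \<open>V\<close>, and a point \<open>b0\<close> at which segments missing 0 join it to the
  invertible \<open>L b0\<close>. The factor \<open>r / norm x\<close> is there because the reduced
  map is evaluated on the norm sphere of radius \<open>r\<close> and not on the sphere of
  \<open>g\<close>; being positive, it is lost after normalization.\<close>

locale sphere_map = index_cover \<Lambda> L V n c d I U K \<rho> N
  for \<Lambda> :: "'l topology" and L :: "'l \<Rightarrow> 'x::banach \<Rightarrow>\<^sub>L 'y::banach" and V n c d I U K \<rho> N +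
  fixes \<Phi> :: "'l \<times> 'x \<Rightarrow> 'y" and b0 :: 'l and r :: real
  assumes \<Phi>_cont: "continuous_map P euclidean \<Phi>" and \<Phi>_V: "\<And>p. p \<in> topspace P \<Longrightarrow> \<Phi> p \<in> V \<and> \<Phi> p \<noteq> 0"
    and connected: "connected_space \<Lambda>" and b0: "b0 \<in> topspace \<Lambda>" "bij (blinfun_apply (L b0))" and r: "r > 0"
    and near_L: "\<And>x t. (b0, x) \<in> topspace P \<Longrightarrow> 0 \<le> t \<Longrightarrow> t \<le> 1 \<Longrightarrow>
       (1 - t) *\<^sub>R \<Phi> (b0, x) + t *\<^sub>R L b0 ((r / norm x) *\<^sub>R x) \<noteq> 0"
begin

definition \<phi> :: "'l \<times> 'x \<Rightarrow> 'l \<times> 'y" where "\<phi> p = (fst p, nrm (\<Phi> p))"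

lemma \<phi>_continuous: "continuous_map P Q \<phi>"
  unfolding \<phi>_def[abs_def]
  by (rule continuous_map_into_Q[OF continuous_P_fst continuous_map_nrm[OF \<Phi>_cont]]) (use \<Phi>_V nrm_in_S in auto)

lemma \<phi>_fibre_preserving: "fibre_preserving P \<phi>"
  by (simp add: fibre_preserving_def \<phi>_def)

text \<open>The fibre part of \<phi> over \<open>l\<close>, read in the trivialization given by
  \<open>T\<close> as a self-map of \<open>S\<close>.\<close>

definition \<psi> :: "('x \<Rightarrow>\<^sub>L 'y) \<Rightarrow> 'l \<Rightarrow> 'y \<Rightarrow> 'y" where "\<psi> T l v = nrm (\<Phi> (untriv T (l, v)))"

lemma triv_continuous:
  assumes W: "correction W T"
  shows "continuous_map (over P W) (over Q W) (triv T)" "continuous_map (over Q W) (over P W) (untriv T)"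
    "p \<in> topspace (over P W) \<Longrightarrow> untriv T (triv T p) = p" "q \<in> topspace (over Q W) \<Longrightarrow> triv T (untriv T q) = q"
  using triv_homeomorphic[OF W] by (auto simp: homeomorphic_maps_def)

lemma \<psi>_continuous:
  assumes W: "correction W T"
  shows "continuous_map (over Q W) euclidean (\<lambda>q. \<psi> T (fst q) (snd q))"
    "\<And>l v. (l, v) \<in> topspace (over Q W) \<Longrightarrow> \<psi> T l v \<in> S"
proof -
  note u = triv_continuous(2)[OF W]
  have uP: "continuous_map (over Q W) P (untriv T)" using u by (simp add: continuous_map_in_subtopology)
  have inP: "untriv T q \<in> topspace P" if "q \<in> topspace (over Q W)" for q
    using continuous_map_image_subset_topspace[OF uP] that by blast
  have "continuous_map (over Q W) euclidean (\<lambda>q. \<Phi> (untriv T q))"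
    using continuous_map_compose[OF uP \<Phi>_cont] by (simp add: o_def)
  then have "continuous_map (over Q W) euclidean (\<lambda>q. nrm (\<Phi> (untriv T q)))"
    by (rule continuous_map_nrm) (use inP \<Phi>_V in blast)
  then show "continuous_map (over Q W) euclidean (\<lambda>q. \<psi> T (fst q) (snd q))" by (simp add: \<psi>_def)
  show "\<psi> T l v \<in> S" if "(l, v) \<in> topspace (over Q W)" for l v
    unfolding \<psi>_def using nrm_in_S \<Phi>_V[OF inP[OF that]] by blast
qed

lemma \<phi>_eq: "correction W T \<Longrightarrow> p \<in> topspace (over P W) \<Longrightarrow> \<phi> p = (fst p, \<psi> T (fst p) (snd (triv T p)))"
  using triv_continuous(3)[of W T p] by (simp add: \<phi>_def \<psi>_def triv_def)

text \<open>Close to \<open>b\<close> the map \<open>\<phi>\<close> differs so little from its value at \<open>b\<close>, in the trivialization \<open>triv T\<close>, that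
  the two are joined by normalized segments.\<close>

lemma locally_constant_model:
  assumes W: "correction W T" and b: "b \<in> W"
  obtains W' where "openin \<Lambda> W'" "b \<in> W'" "W' \<subseteq> W"
    "fibre_homotopic (over P W') (over Q W') \<phi> (\<lambda>p. (fst p, \<psi> T b (snd (triv T p))))"
proof -
  let ?B = "prod_topology (subtopology \<Lambda> W) (top_of_set S)"
  have oW: "openin \<Lambda> W" using W by (simp add: correction_def)
  have bL: "b \<in> topspace \<Lambda>" using openin_subset[OF oW] b by blast
  have QB: "over Q W = ?B" by (rule over_Q_eq)
  have cb: "continuous_map ?B (over Q W) (\<lambda>q. (b, snd q))"
    unfolding QB continuous_map_paired using b bL by (simp add: continuous_map_snd)
  have c1: "continuous_map ?B euclidean (\<lambda>q. \<psi> T (fst q) (snd q))" using \<psi>_continuous(1)[OF W] by (simp add: QB)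
  have c2: "continuous_map ?B euclidean (\<lambda>q. \<psi> T b (snd q))"
    using continuous_map_compose[OF cb \<psi>_continuous(1)[OF W]] by (simp add: o_def)
  \<comment> \<open>Unit vectors with positive inner product are not antipodal, so the segment
    between them misses 0. The product is 1 on \<open>{b} \<times> S\<close>, and compactness of
    \<open>S\<close> keeps it positive over a neighbourhood of \<open>b\<close>.\<close>
  let ?f = "\<lambda>q. ip (\<psi> T (fst q) (snd q)) (\<psi> T b (snd q))"
  have "continuous_map ?B euclideanreal ?f" by (rule continuous_map_ip[OF c1 c2])
  then have open_N: "openin ?B {q \<in> topspace ?B. ?f q \<in> {0<..}}" by (rule openin_continuous_map_preimage) simp
  have "{b} \<times> S \<subseteq> {q \<in> topspace ?B. ?f q \<in> {0<..}}"
  proof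
    fix q assume "q \<in> {b} \<times> S"
    then obtain v where v: "q = (b, v)" "v \<in> S" by blast
    have "\<psi> T b v \<in> S" by (rule \<psi>_continuous(2)[OF W]) (use v b bL in \<open>simp add: QB\<close>)
    then show "q \<in> {q \<in> topspace ?B. ?f q \<in> {0<..}}" using v b bL by (simp add: S_def)
  qed
  moreover have "compactin (top_of_set S) S" using compact_S by (simp add: compactin_subtopology)
  ultimately have "\<exists>W' S'. openin (subtopology \<Lambda> W) W' \<and> openin (top_of_set S) S' \<and> b \<in> W' \<and> S \<subseteq> S' \<and>
      W' \<times> S' \<subseteq> {q \<in> topspace ?B. ?f q \<in> {0<..}}"
    by (intro tube_lemma_right[OF open_N]) (use b bL in auto)
  then obtain W' S' where W': "openin (subtopology \<Lambda> W) W'" "b \<in> W'" "S \<subseteq> S'" "W' \<times> S' \<subseteq> {q \<in> topspace ?B. ?f q \<in> {0<..}}"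
    by blast
  have oW': "openin \<Lambda> W'" "W' \<subseteq> W" using W'(1) oW openin_open_subtopology by blast+
  let ?Z = "over P W'"
  have tc: "continuous_map ?Z (over Q W) (triv T)"
    using continuous_map_from_subtopology[OF triv_continuous(1)[OF W], of "W' \<times> UNIV"] oW'(2) by (simp add: over_over)
  have tS: "snd (triv T p) \<in> S" if "p \<in> topspace ?Z" for p
  proof -
    have "triv T p \<in> topspace (over Q W)" using continuous_map_image_subset_topspace[OF tc] that by blast
    then show ?thesis by (simp add: QB mem_Times_iff)
  qed
  have ca: "continuous_map ?Z euclidean (\<lambda>p. \<psi> T (fst p) (snd (triv T p)))"
    using continuous_map_compose[OF tc \<psi>_continuous(1)[OF W]] by (simp add: o_def triv_def)
  have cb': "continuous_map ?Z euclidean (\<lambda>p. \<psi> T b (snd (triv T p)))"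
    using continuous_map_compose[OF tc[unfolded QB] c2] by (simp add: o_def)
  have Sa: "\<psi> T (fst p) (snd (triv T p)) \<in> S" and Sb: "\<psi> T b (snd (triv T p)) \<in> S"
    and pos: "0 < ip (\<psi> T (fst p) (snd (triv T p))) (\<psi> T b (snd (triv T p)))" if p: "p \<in> topspace ?Z" for p
  proof -
    have l: "fst p \<in> W'" "fst p \<in> topspace \<Lambda>" using p openin_subset[OF oW'(1)] by (auto simp: mem_Times_iff)
    have "(fst p, snd (triv T p)) \<in> W' \<times> S'" using l(1) tS[OF p] W'(3) by blast
    then show "0 < ip (\<psi> T (fst p) (snd (triv T p))) (\<psi> T b (snd (triv T p)))" using W'(4) by auto
    show "\<psi> T (fst p) (snd (triv T p)) \<in> S" "\<psi> T b (snd (triv T p)) \<in> S"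
      by (rule \<psi>_continuous(2)[OF W]; use l b bL tS[OF p] oW'(2) in \<open>auto simp: QB\<close>)+
  qed
  have H: "fibre_homotopic ?Z (over Q W') (\<lambda>p. (fst p, nrm (\<psi> T (fst p) (snd (triv T p))))) (\<lambda>p. (fst p, nrm (\<psi> T b (snd (triv T p)))))"
  proof (rule straight_homotopy[OF _ _ ca _ cb'])
    fix p and t :: real assume p: "p \<in> topspace ?Z" and t: "0 \<le> t" "t \<le> 1"
    let ?a = "\<psi> T (fst p) (snd (triv T p))" and ?b = "\<psi> T b (snd (triv T p))"
    show "(1 - t) *\<^sub>R ?a + t *\<^sub>R ?b \<noteq> 0"
    proof
      assume z: "(1 - t) *\<^sub>R ?a + t *\<^sub>R ?b = 0"
      \<comment> \<open>Pairing with the unit vector \<open>?b\<close> gives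
        \<open>(1 - t) * ip ?a ?b + t\<close>, which cannot vanish because \<open>ip ?a ?b\<close>
        is positive.\<close>
      have "ip ((1 - t) *\<^sub>R ?a + t *\<^sub>R ?b) ?b = (1 - t) * ip ?a ?b + t"
        using Sb[OF p] by (simp add: ip_linear S_def)
      moreover have "ip ((1 - t) *\<^sub>R ?a + t *\<^sub>R ?b) ?b = 0" unfolding z using ip_linear[of 0 0 0 0 ?b] by simp
      moreover have "0 \<le> (1 - t) * ip ?a ?b" using pos[OF p] t by simp
      ultimately have "t = 0" "(1 - t) * ip ?a ?b = 0" using t by linarith+
      then show False using pos[OF p] by simp
    qed
  qed (use Sa Sb in \<open>auto simp: S_def intro!: continuous_map_from_subtopology continuous_P_fst\<close>)
  have "fibre_homotopic ?Z (over Q W') \<phi> (\<lambda>p. (fst p, \<psi> T b (snd (triv T p))))"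
  proof (rule homotopic_with_eq[OF H])
    fix p assume p: "p \<in> topspace ?Z"
    then have "p \<in> topspace (over P W)" using oW'(2) by auto
    then show "\<phi> p = (fst p, nrm (\<psi> T (fst p) (snd (triv T p))))" using \<phi>_eq[OF W] nrm_S[OF Sa[OF p]] by simp
    show "(fst p, \<psi> T b (snd (triv T p))) = (fst p, nrm (\<psi> T b (snd (triv T p))))" using nrm_S[OF Sb[OF p]] by simp
  qed (rule fibre_preserving_cong)
  then show ?thesis by (rule that[OF oW'(1) W'(2) oW'(2)])
qed

end

section \<open>Homotopy to homeomorphisms: from one fibre to neighbourhoods and to the whole
  base\<close>

lemma fibre_homeo_compose:
  assumes "fibre_homeo P Q f" "fibre_homeo Q R k" shows "fibre_homeo P R (k \<circ> f)"
  using homeomorphic_map_compose[of P Q f R k] fibre_preserving_compose[of P Q f k] assms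
  by (simp add: fibre_homeo_def homeomorphic_imp_continuous_map)

context sphere_map begin

lemma triv_fibre_homeo: "correction W T \<Longrightarrow> fibre_homeo (over P W) (over Q W) (triv T)"
  using triv_homeomorphic[of W T] by (auto simp: fibre_homeo_def homeomorphic_maps_map fibre_preserving_def triv_def)

definition constant_model :: "('x \<Rightarrow>\<^sub>L 'y) \<Rightarrow> 'l \<Rightarrow> 'l set \<Rightarrow> bool" where
  "constant_model T b W \<longleftrightarrow> openin \<Lambda> W \<and> b \<in> W \<and> (\<exists>W0. correction W0 T \<and> W \<subseteq> W0 \<and> b \<in> W0) \<and>
     fibre_homotopic (over P W) (over Q W) \<phi> (\<lambda>p. (fst p, \<psi> T b (snd (triv T p))))"

definition homotopic_to_homeo :: "('y \<Rightarrow> 'y) \<Rightarrow> bool" where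
  "homotopic_to_homeo f \<longleftrightarrow> (\<exists>\<kappa>. homeomorphic_map (top_of_set S) (top_of_set S) \<kappa> \<and> homotopic_with (\<lambda>_. True) (top_of_set S) (top_of_set S) f \<kappa>)"

definition homeo_over :: "'l set \<Rightarrow> bool" where
  "homeo_over W \<longleftrightarrow> (\<exists>m. fibre_homeo (over P W) (over Q W) m \<and> fibre_homotopic (over P W) (over Q W) \<phi> m)"

lemma homeo_over_subset:
  assumes "homeo_over W" "W' \<subseteq> W" shows "homeo_over W'"
proof -
  obtain m where m: "fibre_homeo (over P W) (over Q W) m" "fibre_homotopic (over P W) (over Q W) \<phi> m"
    using assms(1) unfolding homeo_over_def by blast
  have "fibre_homotopic (over (over P W) W') (over (over Q W) W') \<phi> m" by (rule fibre_homotopic_over[OF m(2)])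
  then show ?thesis using fibre_homeo_over[OF m(1) assms(2)] assms(2) unfolding homeo_over_def by (auto simp: over_over)
qed

text \<open>In the trivialization the model is the same self-map of \<open>S\<close> on every fibre
  over \<open>W\<close>. A homotopy from it to a homeomorphism of \<open>S\<close> therefore acts on
  all these fibres at once.\<close>

lemma constant_model_homeo_over:
  assumes M: "constant_model T b W" and H: "homotopic_to_homeo (\<psi> T b)"
  shows "homeo_over W"
proof -
  obtain W0 where W0: "correction W0 T" "W \<subseteq> W0" and hom: "fibre_homotopic (over P W) (over Q W) \<phi> (\<lambda>p. (fst p, \<psi> T b (snd (triv T p))))"
    using M unfolding constant_model_def by blast
  obtain \<kappa> where \<kappa>: "homeomorphic_map (top_of_set S) (top_of_set S) \<kappa>" "homotopic_with (\<lambda>_. True) (top_of_set S) (top_of_set S) (\<psi> T b) \<kappa>"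
    using H unfolding homotopic_to_homeo_def by blast
  obtain \<kappa>' where \<kappa>': "homeomorphic_maps (top_of_set S) (top_of_set S) \<kappa> \<kappa>'" using \<kappa>(1) homeomorphic_map_maps by blast
  have tr: "fibre_homeo (over P W) (over Q W) (triv T)"
    by (rule fibre_homeo_over[OF triv_fibre_homeo[OF W0(1)] W0(2)])
  have ct: "continuous_map (over P W) (over Q W) (triv T)" using tr by (simp add: fibre_homeo_def homeomorphic_imp_continuous_map)
  have "homeomorphic_maps (over Q W) (over Q W) (\<lambda>q. (fst q, \<kappa> (snd q))) (\<lambda>q. (fst q, \<kappa>' (snd q)))"
    using \<kappa>' unfolding over_Q_eq homeomorphic_maps_def continuous_map_paired
    by (auto simp: continuous_map_fst continuous_map_compose[OF continuous_map_snd, unfolded o_def])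
  then have "fibre_homeo (over Q W) (over Q W) (\<lambda>q. (fst q, \<kappa> (snd q)))"
    by (auto simp: fibre_homeo_def homeomorphic_maps_map fibre_preserving_def)
  from fibre_homeo_compose[OF tr this]
  have m: "fibre_homeo (over P W) (over Q W) (\<lambda>p. (fst p, \<kappa> (snd (triv T p))))"
    by (simp add: o_def triv_def)
  obtain k where k: "continuous_map (prod_topology (top_of_set {0..1::real}) (top_of_set S)) (top_of_set S) k"
      "\<And>v. k (0, v) = \<psi> T b v" "\<And>v. k (1, v) = \<kappa> v"
    using \<kappa>(2) unfolding homotopic_with_def by blast
  have "fibre_homotopic (over P W) (over Q W) (\<lambda>p. (fst p, \<psi> T b (snd (triv T p)))) (\<lambda>p. (fst p, \<kappa> (snd (triv T p))))"
    unfolding fibre_homotopic_iff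
  proof (intro exI conjI ballI)
    let ?X = "prod_topology (top_of_set {0..1::real}) (over P W)"
    have "continuous_map (over P W) (top_of_set S) (\<lambda>p. snd (triv T p))"
      using continuous_map_compose[OF ct[unfolded over_Q_eq] continuous_map_snd] by (simp add: o_def)
    then have "continuous_map ?X (prod_topology (top_of_set {0..1}) (top_of_set S)) (\<lambda>q. (fst q, snd (triv T (snd q))))"
      unfolding continuous_map_paired
      using continuous_map_compose[OF continuous_map_snd, of "over P W" "top_of_set S" "\<lambda>p. snd (triv T p)"]
      by (auto simp: o_def continuous_map_fst)
    from continuous_map_compose[OF this k(1)]
    have 1: "continuous_map ?X (top_of_set S) (\<lambda>q. k (fst q, snd (triv T (snd q))))" by (simp add: o_def)
    have "continuous_map ?X \<Lambda> (\<lambda>q. fst (snd q))"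
      using continuous_map_compose[OF continuous_map_snd continuous_map_from_subtopology[OF continuous_P_fst]] by (simp add: o_def)
    then have "continuous_map ?X Q (\<lambda>q. (fst (snd q), k (fst q, snd (triv T (snd q)))))"
      unfolding Q_eq continuous_map_paired using 1 by blast
    then show "continuous_map ?X (over Q W) (\<lambda>q. (fst (snd q), k (fst q, snd (triv T (snd q)))))"
      by (auto simp: continuous_map_in_subtopology)
  qed (auto simp: k)
  then show ?thesis unfolding homeo_over_def using m homotopic_with_trans[OF hom] by blast
qed

text \<open>The converse needs a single fibre, over any \<open>l\<close> in \<open>W\<close>: the
  model is \<open>\<psi> T b\<close> there too, and the trivialization at \<open>l\<close> turns a
  homeomorphism between the fibre spheres into one of \<open>S\<close>.\<close>

lemma homeo_over_point_model:
  assumes M: "constant_model T b W" and l: "l \<in> W" and G: "homeo_over {l}"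
  shows "homotopic_to_homeo (\<psi> T b)"
proof -
  obtain W0 where W0: "correction W0 T" "W \<subseteq> W0" and oW: "openin \<Lambda> W"
    and hom: "fibre_homotopic (over P W) (over Q W) \<phi> (\<lambda>p. (fst p, \<psi> T b (snd (triv T p))))"
    using M unfolding constant_model_def by blast
  let ?A = "\<lambda>p. (fst p, \<psi> T b (snd (triv T p)))"
  have lL: "l \<in> topspace \<Lambda>" using openin_subset[OF oW] l by blast
  obtain m where m: "fibre_homeo (over P {l}) (over Q {l}) m" "fibre_homotopic (over P {l}) (over Q {l}) \<phi> m"
    using G unfolding homeo_over_def by blast
  have "fibre_homotopic (over (over P W) {l}) (over (over Q W) {l}) \<phi> ?A" by (rule fibre_homotopic_over[OF hom])
  then have "fibre_homotopic (over P {l}) (over Q {l}) \<phi> ?A" using l by (simp add: over_over)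
  then have Am: "fibre_homotopic (over P {l}) (over Q {l}) ?A m"
    using homotopic_with_trans[OF homotopic_with_symD m(2)] by blast
  have tr: "fibre_homeo (over P {l}) (over Q {l}) (triv T)"
    by (rule fibre_homeo_over[OF triv_fibre_homeo[OF W0(1)]]) (use W0(2) l in auto)
  obtain u where u: "fibre_homeo (over Q {l}) (over P {l}) u" "\<And>q. q \<in> topspace (over Q {l}) \<Longrightarrow> triv T (u q) = q"
    using fibre_homeo_inverse[OF tr] by metis
  have i: "homeomorphic_maps (top_of_set S) (over Q {l}) (\<lambda>v. (l, v)) snd"
    unfolding over_Q_eq homeomorphic_maps_def continuous_map_paired using lL by (auto simp: continuous_map_snd)
  have i1: "homeomorphic_map (top_of_set S) (over Q {l}) (\<lambda>v. (l, v))" and i2: "homeomorphic_map (over Q {l}) (top_of_set S) snd"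
    using i homeomorphic_maps_map by blast+
  let ?j = "\<lambda>v. u (l, v)"
  have j: "homeomorphic_map (top_of_set S) (over P {l}) ?j"
    using homeomorphic_map_compose[OF i1, of "over P {l}" u] u(1) by (simp add: fibre_homeo_def o_def)
  have \<kappa>: "homeomorphic_map (top_of_set S) (top_of_set S) (snd \<circ> (m \<circ> ?j))"
    using homeomorphic_map_compose[OF homeomorphic_map_compose[OF j] i2] m(1) by (simp add: fibre_homeo_def)
  have "homotopic_with (\<lambda>_. True) (top_of_set S) (over Q {l}) (?A \<circ> ?j) (m \<circ> ?j)"
    by (rule homotopic_with_compose_continuous_map_right[OF Am homeomorphic_imp_continuous_map[OF j]]) simp
  then have "homotopic_with (\<lambda>_. True) (top_of_set S) (top_of_set S) (snd \<circ> (?A \<circ> ?j)) (snd \<circ> (m \<circ> ?j))"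
    by (rule homotopic_with_compose_continuous_map_left[OF _ homeomorphic_imp_continuous_map[OF i2]]) simp
  then have "homotopic_with (\<lambda>_. True) (top_of_set S) (top_of_set S) (\<psi> T b) (snd \<circ> (m \<circ> ?j))"
  proof (rule homotopic_with_eq)
    fix v assume "v \<in> topspace (top_of_set S)"
    then have "(l, v) \<in> topspace (over Q {l})" using lL by (simp add: over_Q_eq)
    then show "\<psi> T b v = (snd \<circ> (?A \<circ> ?j)) v" using u(2)[of "(l, v)"] by simp
  qed auto
  then show ?thesis unfolding homotopic_to_homeo_def using \<kappa> by blast
qed

lemma constant_model_exists:
  assumes b: "b \<in> topspace \<Lambda>"
  obtains T W where "constant_model T b W"
proof -
  obtain i where i: "i \<in> I" "b \<in> U i" "correction (U i) (K i)" using correction_exists[OF b] by blast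
  obtain W where "openin \<Lambda> W" "b \<in> W" "W \<subseteq> U i" "fibre_homotopic (over P W) (over Q W) \<phi> (\<lambda>p. (fst p, \<psi> (K i) b (snd (triv (K i) p))))"
    by (rule locally_constant_model[OF i(3,2)])
  then have "constant_model (K i) b W" unfolding constant_model_def using i by blast
  then show ?thesis by (rule that)
qed

text \<open>At \<open>b0\<close> the correction 0 is admissible, so \<open>triv 0\<close> is the
  normalized linear map, and the segments of \<open>near_L\<close> join \<phi> to it.\<close>

lemma homeo_over_b0: "homeo_over {b0}"
proof -
  have bij0: "bij (blinfun_apply (L b0 + 0))" using b0(2) by simp
  obtain W where W: "openin \<Lambda> W" "b0 \<in> W" "\<And>l. l \<in> W \<Longrightarrow> bij (blinfun_apply (L l + 0))"
    using local_correction[OF cL b0(1) bij0] by blast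
  have corr: "correction W 0" using W(1,3) subspace_0[OF sV] by (auto simp: correction_def)
  have tr: "fibre_homeo (over P {b0}) (over Q {b0}) (triv 0)"
    by (rule fibre_homeo_over[OF triv_fibre_homeo[OF corr]]) (use W(2) in auto)
  let ?Z = "over P {b0}"
  let ?b = "\<lambda>p. L (fst p) ((r / norm (snd p)) *\<^sub>R snd p)"
  have f: "continuous_map ?Z \<Lambda> fst" and s: "continuous_map ?Z euclidean snd"
    by (intro continuous_map_from_subtopology continuous_P_fst continuous_P_snd)+
  have nz: "snd p \<noteq> 0" if "p \<in> topspace ?Z" for p using that P_nonzero by (cases p) auto
  have "continuous_on (- {0}) (\<lambda>x::'x. (r / norm x) *\<^sub>R x)" by (intro continuous_intros) auto
  then have "continuous_map ?Z euclidean (\<lambda>p. (r / norm (snd p)) *\<^sub>R snd p)"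
    by (rule continuous_map_of_continuous_on[OF s]) (use nz in blast)
  then have b: "continuous_map ?Z euclidean ?b"
    using continuous_map_blinfun_apply[OF continuous_map_L[OF f, of 0]] by simp
  have H: "fibre_homotopic ?Z (over Q {b0}) (\<lambda>p. (fst p, nrm (\<Phi> p))) (\<lambda>p. (fst p, nrm (?b p)))"
  proof (rule straight_homotopy[OF f _ continuous_map_from_subtopology[OF \<Phi>_cont] _ b])
    fix p assume p: "p \<in> topspace ?Z"
    then obtain x where x: "p = (b0, x)" "(b0, x) \<in> topspace P" by (cases p) auto
    show "fst p \<in> {b0}" using x by simp
    show "\<Phi> p \<in> V" using p \<Phi>_V by auto
    show "?b p \<in> V" using x subspace_scale[OF sV] by (simp add: topspace_P blinfun.scaleR_right)
    show "(1 - t) *\<^sub>R \<Phi> p + t *\<^sub>R ?b p \<noteq> 0" if "0 \<le> t" "t \<le> 1" for t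
      using near_L[OF x(2) that] x(1) by simp
  qed
  have "fibre_homotopic ?Z (over Q {b0}) \<phi> (triv 0)"
  proof (rule homotopic_with_eq[OF H])
    fix p assume p: "p \<in> topspace ?Z"
    show "\<phi> p = (fst p, nrm (\<Phi> p))" by (simp add: \<phi>_def)
    have "0 < r / norm (snd p)" using r nz[OF p] by simp
    from nrm_scale[OF this, of "L (fst p) (snd p)"] show "triv 0 p = (fst p, nrm (?b p))"
      by (simp add: triv_def blinfun.scaleR_right)
  qed (rule fibre_preserving_cong)
  then show ?thesis unfolding homeo_over_def using tr by blast
qed

text \<open>For \<open>l\<close> in the domain of a constant model around \<open>b\<close>, the
  statements at \<open>l\<close> and at \<open>b\<close> are both equivalent to one about
  \<open>\<psi> T b\<close>. This one equivalence makes the set of good points and its complement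
  open.\<close>

lemma homeo_over_points:
  assumes "b \<in> topspace \<Lambda>" shows "homeo_over {b}"
proof -
  let ?D = "{b \<in> topspace \<Lambda>. homeo_over {b}}"
  have step: "homeo_over {l} \<longleftrightarrow> homeo_over {b}" if M: "constant_model T b W" and l: "l \<in> W" for T b W l
  proof -
    have b: "b \<in> W" using M by (simp add: constant_model_def)
    have "homeo_over {l}" if "homeo_over {b}"
      using constant_model_homeo_over[OF M homeo_over_point_model[OF M b that]] homeo_over_subset l by blast
    moreover have "homeo_over {b}" if "homeo_over {l}"
      using constant_model_homeo_over[OF M homeo_over_point_model[OF M l that]] homeo_over_subset b by blast
    ultimately show ?thesis by blast
  qed
  have loc: "\<exists>W. openin \<Lambda> W \<and> b \<in> W \<and> (\<forall>l\<in>W. homeo_over {l} \<longleftrightarrow> homeo_over {b})" if "b \<in> topspace \<Lambda>" for b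
  proof -
    obtain T W where M: "constant_model T b W" by (rule constant_model_exists[OF \<open>b \<in> topspace \<Lambda>\<close>])
    then have "openin \<Lambda> W" "b \<in> W" by (simp_all add: constant_model_def)
    then show ?thesis using step[OF M] by blast
  qed
  have "openin \<Lambda> ?D"
  proof (subst openin_subopen, intro ballI)
    fix x assume x: "x \<in> ?D"
    then obtain W where "openin \<Lambda> W" "x \<in> W" "\<forall>l\<in>W. homeo_over {l} \<longleftrightarrow> homeo_over {x}" using loc[of x] by blast
    then show "\<exists>T. openin \<Lambda> T \<and> x \<in> T \<and> T \<subseteq> ?D" using x openin_subset by (intro exI[of _ W]) fastforce
  qed
  moreover have "openin \<Lambda> (topspace \<Lambda> - ?D)"
  proof (subst openin_subopen, intro ballI)
    fix x assume x: "x \<in> topspace \<Lambda> - ?D"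
    then obtain W where "openin \<Lambda> W" "x \<in> W" "\<forall>l\<in>W. homeo_over {l} \<longleftrightarrow> homeo_over {x}" using loc[of x] by blast
    then show "\<exists>T. openin \<Lambda> T \<and> x \<in> T \<and> T \<subseteq> topspace \<Lambda> - ?D" using x openin_subset by (intro exI[of _ W]) fastforce
  qed
  then have "closedin \<Lambda> ?D" by (simp add: closedin_def)
  ultimately have "?D = {} \<or> ?D = topspace \<Lambda>"
    using connected unfolding connected_space_clopen_in by blast
  then show ?thesis using homeo_over_b0 b0(1) assms by blast
qed

lemma locally_fibre_homeo_phi: "locally_fibre_homeo \<Lambda> P Q \<phi>"
  unfolding locally_fibre_homeo_def
proof
  fix b assume b: "b \<in> topspace \<Lambda>"
  obtain T W where M: "constant_model T b W" by (rule constant_model_exists[OF b])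
  then have W: "openin \<Lambda> W" "b \<in> W" by (simp_all add: constant_model_def)
  have "homeo_over W" by (rule constant_model_homeo_over[OF M homeo_over_point_model[OF M W(2) homeo_over_points[OF b]]])
  then show "\<exists>U l. openin \<Lambda> U \<and> b \<in> U \<and> fibre_homeo (over P U) (over Q U) l \<and> fibre_homotopic (over P U) (over Q U) \<phi> l"
    unfolding homeo_over_def using W by blast
qed

theorem J_proj_index_eq_one: "J_proj \<Lambda> (ko_diff \<Lambda> E F) = \<one>\<^bsub>J_group \<Lambda>\<^esub>"
proof (rule J_proj_eq_one_if_sphere_bundles_equivalent[OF vector_bundle_E vector_bundle_F _ fibre_metric_g fibre_metric_ip])
  show "dim (fibre E l) = dim (fibre F l)" if "l \<in> topspace \<Lambda>" for l
    using dim_fibre_E[OF that] fibre_F[OF that] dimV by simp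
  show "fibre_homotopy_equivalent P Q"
    by (rule locally_fibre_homeo_imp_equivalence[OF compact Hausdorff continuous_P_fst continuous_Q_fst
          \<phi>_continuous \<phi>_fibre_preserving locally_fibre_homeo_phi])
qed

end

section \<open>Bifurcation\<close>

lemma C1_family_derivative:
  assumes "C1_family \<Lambda> U f" "open U" "l \<in> topspace \<Lambda>" "x \<in> U"
  shows "(f l has_derivative blinfun_apply (fderiv f l x)) (at x)"
proof -
  have "(f l has_derivative frechet_derivative (f l) (at x)) (at x)"
    using assms by (simp add: C1_family_def flip: frechet_derivative_works)
  then show ?thesis
    unfolding fderiv_def by (simp add: bounded_linear_Blinfun_apply has_derivative_bounded_linear)
qed

text \<open>Mean value inequality on a ball, which is convex, for \<open>f l\<close> minus its
  linear part at 0: the derivative of this difference has norm at most \<kappa> there.\<close>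

lemma C1_family_remainder_lipschitz:
  assumes f: "C1_family \<Lambda> U f" and U: "open U" and l: "l \<in> topspace \<Lambda>"
    and \<delta>: "\<And>x. norm x < \<delta> \<Longrightarrow> x \<in> U \<and> norm (fderiv f l x - fderiv f l 0) \<le> \<kappa>"
    and x: "norm x < \<delta>" "norm x' < \<delta>"
  shows "norm ((f l x - fderiv f l 0 x) - (f l x' - fderiv f l 0 x')) \<le> \<kappa> * norm (x - x')"
proof (rule differentiable_bound[where S = "ball 0 \<delta>" and f' = "\<lambda>x. blinfun_apply (fderiv f l x - fderiv f l 0)"])
  fix y assume "y \<in> ball (0::'b) \<delta>"
  then have y: "y \<in> U" "norm (fderiv f l y - fderiv f l 0) \<le> \<kappa>" using \<delta> by auto
  have "((\<lambda>z. f l z - fderiv f l 0 z) has_derivative (\<lambda>z. fderiv f l y z - fderiv f l 0 z)) (at y)"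
    by (intro has_derivative_diff C1_family_derivative[OF f U l y(1)]
          bounded_linear_imp_has_derivative blinfun.bounded_linear_right)
  then show "((\<lambda>z. f l z - fderiv f l 0 z) has_derivative blinfun_apply (fderiv f l y - fderiv f l 0)) (at y within ball 0 \<delta>)"
    by (simp add: minus_blinfun.rep_eq has_derivative_at_withinI)
  show "onorm (blinfun_apply (fderiv f l y - fderiv f l 0)) \<le> \<kappa>" using y(2) by (simp add: norm_blinfun.rep_eq)
qed (use x in auto)

text \<open>Each \<open>(l, 0)\<close> has a neighbourhood without nontrivial zeros. The union of
  all such open sets contains the trivial branch, and the tube lemma yields a uniform
  radius.\<close>

lemma no_bifurcation_isolated_zeros:
  assumes "compact_space \<Lambda>" "open U" "0 \<in> U" and nb: "\<nexists>l0. bifurcation_point \<Lambda> U f l0"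
  obtains \<delta> where "\<delta> > 0" "\<And>l x. l \<in> topspace \<Lambda> \<Longrightarrow> norm x < \<delta> \<Longrightarrow> x \<in> U \<and> (f l x = 0 \<longrightarrow> x = 0)"
proof -
  let ?T = "prod_topology \<Lambda> (top_of_set U)"
  let ?N = "\<Union>{N. openin ?T N \<and> (\<forall>(l, x)\<in>N. f l x = 0 \<longrightarrow> x = 0)}"
  have "openin ?T ?N" by (rule openin_Union) simp
  moreover have "topspace \<Lambda> \<times> {0} \<subseteq> ?N"
  proof
    fix p assume "p \<in> topspace \<Lambda> \<times> {0 :: 'b}"
    then obtain l where l: "l \<in> topspace \<Lambda>" "p = (l, 0)" by blast
    have "\<not> bifurcation_point \<Lambda> U f l" using nb by blast
    then have "\<exists>N. (openin ?T N \<and> (l, 0) \<in> N) \<and> \<not> (\<exists>(l, x)\<in>N. f l x = 0 \<and> x \<noteq> 0)"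
      using l(1) by (simp only: bifurcation_point_def not_all not_imp simp_thms de_Morgan_conj)
    then obtain N where N: "openin ?T N" "(l, 0) \<in> N" "\<not> (\<exists>(l, x)\<in>N. f l x = 0 \<and> x \<noteq> 0)"
      by (elim exE conjE)
    then have "N \<in> {N. openin ?T N \<and> (\<forall>(l, x)\<in>N. f l x = 0 \<longrightarrow> x = 0)}" by auto
    then show "p \<in> ?N" using N(2) l(2) by (metis (no_types, lifting) UnionI)
  qed
  ultimately show ?thesis
  proof (rule uniform_ball_at_zero[OF assms(1-3)])
    fix \<delta> assume \<delta>: "\<delta> > 0" "\<And>l x. l \<in> topspace \<Lambda> \<Longrightarrow> norm x < \<delta> \<Longrightarrow> x \<in> U \<and> (l, x) \<in> ?N"
    show ?thesis
    proof (rule that[OF \<delta>(1)])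
      fix l x assume lx: "l \<in> topspace \<Lambda>" "norm (x :: 'b) < \<delta>"
      obtain N where "(l, x) \<in> N" "\<forall>(l, x)\<in>N. f l x = 0 \<longrightarrow> x = 0" using \<delta>(2)[OF lx] by auto
      then show "x \<in> U \<and> (f l x = 0 \<longrightarrow> x = 0)" using \<delta>(2)[OF lx] by auto
    qed
  qed
qed

lemma C1_family_uniform_derivative:
  fixes f :: "'l \<Rightarrow> 'x::real_normed_vector \<Rightarrow> 'y::real_normed_vector"
  assumes f: "C1_family \<Lambda> U f" and c: "compact_space \<Lambda>" and U: "open U" "0 \<in> U" and \<kappa>: "\<kappa> > 0"
  obtains \<delta> where "\<delta> > 0" "\<And>l x. l \<in> topspace \<Lambda> \<Longrightarrow> norm x < \<delta> \<Longrightarrow> x \<in> U \<and> norm (fderiv f l x - fderiv f l 0) \<le> \<kappa>"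
proof -
  let ?T = "prod_topology \<Lambda> (top_of_set U)"
  have D: "continuous_map ?T euclidean (\<lambda>p. fderiv f (fst p) (snd p))"
    using f by (simp add: C1_family_def case_prod_unfold)
  have "continuous_map ?T ?T (\<lambda>p. (fst p, 0))"
    unfolding continuous_map_paired using U(2) by (simp add: continuous_map_fst)
  from continuous_map_compose[OF this D] have D0: "continuous_map ?T euclidean (\<lambda>p. fderiv f (fst p) 0)" by (simp add: o_def)
  have "continuous_map ?T euclideanreal (\<lambda>p. norm (fderiv f (fst p) (snd p) - fderiv f (fst p) 0))"
    by (intro continuous_map_norm continuous_map_diff D D0)
  then have "openin ?T {p \<in> topspace ?T. norm (fderiv f (fst p) (snd p) - fderiv f (fst p) 0) \<in> {..<\<kappa>}}" (is "openin _ ?N")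
    by (rule openin_continuous_map_preimage) simp
  moreover have "topspace \<Lambda> \<times> {0} \<subseteq> ?N" using U(2) \<kappa> by auto
  ultimately show ?thesis
  proof (rule uniform_ball_at_zero[OF c U])
    fix \<delta> assume \<delta>: "\<delta> > 0" "\<And>l x. l \<in> topspace \<Lambda> \<Longrightarrow> norm x < \<delta> \<Longrightarrow> x \<in> U \<and> (l, x) \<in> ?N"
    show ?thesis
    proof (rule that[OF \<delta>(1)])
      fix l x assume "l \<in> topspace \<Lambda>" "norm (x :: 'x) < \<delta>"
      from \<delta>(2)[OF this] show "x \<in> U \<and> norm (fderiv f l x - fderiv f l 0) \<le> \<kappa>" by simp
    qed
  qed
qed

text \<open>All corrections must take values in the given \<open>V\<close>, since it determines the
  index bundle; transversality of \<open>V\<close> at every point allows this.\<close>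

lemma index_cover_exists:
  fixes L :: "'l \<Rightarrow> 'x::banach \<Rightarrow>\<^sub>L 'y::banach"
  assumes c: "compact_space \<Lambda>" and h: "Hausdorff_space \<Lambda>" and cL: "continuous_map \<Lambda> euclidean L"
    and F: "\<And>l. l \<in> topspace \<Lambda> \<Longrightarrow> fredholm (L l) \<and> fredholm_index (L l) = 0"
    and V: "index_subspace \<Lambda> L V"
  obtains n c d I U K \<rho> N where "index_cover \<Lambda> L V n c d I U K \<rho> N"
proof -
  have fV: "finite_dim V" using V by (simp add: index_subspace_def)
  have loc: "\<exists>W. openin \<Lambda> W \<and> l0 \<in> W \<and> (\<exists>K. range (blinfun_apply K) \<subseteq> V \<and> (\<forall>l\<in>W. bij (blinfun_apply (L l + K))))"
    if l0: "l0 \<in> topspace \<Lambda>" for l0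
  proof -
    have "{L l0 x + v |x v. v \<in> V} = UNIV" using V l0 by (simp add: index_subspace_def)
    then obtain K where K: "range (blinfun_apply K) \<subseteq> V" "bij (blinfun_apply (L l0 + K))"
      by (rule finite_rank_correction[OF conjunct1[OF F[OF l0]] conjunct2[OF F[OF l0]] fV])
    obtain W where "openin \<Lambda> W" "l0 \<in> W" "\<And>l. l \<in> W \<Longrightarrow> bij (blinfun_apply (L l + K))"
      using local_correction[OF cL l0 K(2)] by blast
    then show ?thesis using K(1) by blast
  qed
  show ?thesis
  proof (rule finite_dim_coordinates[OF fV])
    fix n cc d assume cd: "continuous_map euclidean (Euclidean_space n) cc" "continuous_map (Euclidean_space n) euclidean d"
      "\<And>v w a b. cc (a *\<^sub>R v + b *\<^sub>R w) = a *\<^sub>R cc v + b *\<^sub>R cc w"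
      "\<And>v w a b. d (a *\<^sub>R v + b *\<^sub>R w) = a *\<^sub>R d v + b *\<^sub>R d w"
      "\<And>a. a \<in> topspace (Euclidean_space n) \<Longrightarrow> d a \<in> V \<and> cc (d a) = a"
      "\<And>v. v \<in> V \<Longrightarrow> d (cc v) = v" "dim V = n"
    show ?thesis
    proof (rule cutoff_cover[OF c h loc])
      fix I U \<rho> N
      assume *: "finite I" "I \<subseteq> topspace \<Lambda>"
        "\<And>i. i \<in> I \<Longrightarrow> \<exists>K. range (blinfun_apply K) \<subseteq> V \<and> (\<forall>l\<in>U i. bij (blinfun_apply (L l + K)))" "\<And>i. i \<in> I \<Longrightarrow> openin \<Lambda> (U i)"
        "\<And>i. i \<in> I \<Longrightarrow> continuous_map \<Lambda> euclideanreal (\<rho> i)" "\<And>i b. i \<in> I \<Longrightarrow> 0 \<le> \<rho> i b"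
        "\<And>i. i \<in> I \<Longrightarrow> openin \<Lambda> (N i)" "\<And>i. i \<in> I \<Longrightarrow> topspace \<Lambda> \<subseteq> N i \<union> U i"
        "\<And>i b. i \<in> I \<Longrightarrow> b \<in> N i \<Longrightarrow> \<rho> i b = (0::real)"
        "\<And>b. b \<in> topspace \<Lambda> \<Longrightarrow> \<exists>i\<in>I. b \<in> U i \<and> \<rho> i b = 1"
      have "\<forall>i\<in>I. \<exists>K. range (blinfun_apply K) \<subseteq> V \<and> (\<forall>l\<in>U i. bij (blinfun_apply (L l + K)))" using *(3) by blast
      from bchoice[OF this] obtain K
        where K: "\<forall>i\<in>I. range (blinfun_apply (K i)) \<subseteq> V \<and> (\<forall>l\<in>U i. bij (blinfun_apply (L l + K i)))" by (elim exE)
      have "subspace V" using fV by (simp add: finite_dim_def)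
      then have "index_cover \<Lambda> L V n cc d I U K \<rho> N"
        using c h cL cd * K by unfold_locales simp_all
      then show ?thesis by (rule that)
    qed
  qed
qed

theorem theorem1p2p1:
  fixes \<Lambda> :: "'l topology"
    and U :: "'x::banach set"
    and f :: "'l \<Rightarrow> 'x \<Rightarrow> 'y::banach"
  assumes "open U" and "0 \<in> U"
    and "finite_CW_complex \<Lambda>" and "connected_space \<Lambda>"
    and "C1_fredholm0_family \<Lambda> U f"
    and "\<And>l. l \<in> topspace \<Lambda> \<Longrightarrow> f l 0 = 0"
    and "singular_set \<Lambda> (\<lambda>l. fderiv f l 0) \<subset> topspace \<Lambda>"
    and "bifurcation_index \<Lambda> f \<noteq> \<one>\<^bsub>J_group \<Lambda>\<^esub>"
  shows "\<exists>l0. bifurcation_point \<Lambda> U f l0"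
proof (rule ccontr)
  assume nb: "\<nexists>l0. bifurcation_point \<Lambda> U f l0"
  note c\<Lambda> = finite_CW_complex_compact(1)[OF assms(3)] and h\<Lambda> = finite_CW_complex_compact(2)[OF assms(3)]
  have C1: "C1_family \<Lambda> U f" using assms(5) by (simp add: C1_fredholm0_family_def)
  define L where "L l = fderiv f l 0" for l
  have F: "fredholm (L l) \<and> fredholm_index (L l) = 0" if "l \<in> topspace \<Lambda>" for l
    using assms(2,5) that by (simp add: C1_fredholm0_family_def L_def)
  have cL: "continuous_map \<Lambda> euclidean L"
  proof -
    have "continuous_map \<Lambda> (prod_topology \<Lambda> (top_of_set U)) (\<lambda>l. (l, 0))"
      unfolding continuous_map_paired using assms(2) by simp
    moreover have "continuous_map (prod_topology \<Lambda> (top_of_set U)) euclidean (\<lambda>(l, x). fderiv f l x)"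
      using C1 by (simp add: C1_family_def)
    ultimately have "continuous_map \<Lambda> euclidean ((\<lambda>(l, x). fderiv f l x) \<circ> (\<lambda>l. (l, 0)))" by (rule continuous_map_compose)
    then show ?thesis by (simp add: o_def L_def[abs_def])
  qed
  \<comment> \<open>The same choice as in \<open>Ind\<close>, so that in the end the bifurcation
    index is that of \<open>E\<close> and \<open>F\<close> by unfolding.\<close>
  define V where "V = (SOME V. index_subspace \<Lambda> L V)"
  have V: "index_subspace \<Lambda> L V"
    unfolding V_def by (rule someI_ex[OF index_subspace_exists[OF c\<Lambda> cL F]])
  obtain n c d I W K \<rho> N where "index_cover \<Lambda> L V n c d I W K \<rho> N"
    by (rule index_cover_exists[OF c\<Lambda> h\<Lambda> cL F V])
  then interpret index_cover \<Lambda> L V n c d I W K \<rho> N .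
  \<comment> \<open>Properness of the singular set gives a parameter with trivial kernel; index 0
    then makes \<open>L b0\<close> bijective.\<close>
  obtain b0 where b0: "b0 \<in> topspace \<Lambda>" "op_kernel (L b0) = {0}"
    using assms(7) by (auto simp: singular_set_def L_def)
  have bij0: "bij (blinfun_apply (L b0))" using fredholm_injective_bij F[OF b0(1)] b0(2) by blast
  obtain C where C: "C > 0" "\<And>l. l \<in> topspace \<Lambda> \<Longrightarrow> norm (R l) \<le> C"
    using compact_space_norm_bound[OF c\<Lambda> continuous_R] by blast
  \<comment> \<open>\<open>B\<close> expresses a lower bound for \<open>L b0\<close>; adding 1 keeps
    it positive even if the inverse has norm 0.\<close>
  define B where "B = norm (binv (L b0)) + 1"
  have B: "B > 0" "\<And>x. norm x \<le> B * norm (L b0 x)"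
  proof -
    show "B > 0" by (simp add: B_def add_nonneg_pos)
    fix x
    have "norm x = norm (binv (L b0) (L b0 x))" by (simp add: binv(2)[OF bij0])
    also have "\<dots> \<le> norm (binv (L b0)) * norm (L b0 x)" by (rule norm_blinfun)
    also have "\<dots> \<le> B * norm (L b0 x)" by (intro mult_right_mono) (simp_all add: B_def)
    finally show "norm x \<le> B * norm (L b0 x)" .
  qed
  define M where "M = norm (L b0) * C + 1"
  have M: "M > 0" using C(1) by (simp add: M_def add_nonneg_pos)
  \<comment> \<open>The first bound makes the equation for \<open>z\<close> a contraction. The
    second gives \<open>M * (2 * \<kappa>) * B \<le> 1 / 2\<close>, so that at \<open>b0\<close> the
    reduced map differs from \<open>L b0\<close> by less than the size of \<open>L b0\<close>
    itself.\<close>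
  define \<kappa> where "\<kappa> = min (1 / (2 * C)) (1 / (4 * M * B))"
  have \<kappa>: "\<kappa> > 0" using C(1) M B(1) by (simp add: \<kappa>_def)
  have \<kappa>C: "\<kappa> * C \<le> 1 / 2"
  proof -
    have "\<kappa> * C \<le> 1 / (2 * C) * C" using C(1) by (intro mult_right_mono) (auto simp: \<kappa>_def)
    then show ?thesis using C(1) by simp
  qed
  have \<kappa>M: "M * (2 * \<kappa>) * B < 1"
  proof -
    have "M * (2 * \<kappa>) * B \<le> M * (2 * (1 / (4 * M * B))) * B"
      using M B(1) by (intro mult_right_mono mult_left_mono) (auto simp: \<kappa>_def)
    then show ?thesis using M B(1) by simp
  qed
  obtain \<delta>1 where \<delta>1: "\<delta>1 > 0" "\<And>l x. l \<in> topspace \<Lambda> \<Longrightarrow> norm x < \<delta>1 \<Longrightarrow> x \<in> U \<and> (f l x = 0 \<longrightarrow> x = 0)"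
    using no_bifurcation_isolated_zeros[OF c\<Lambda> assms(1,2) nb] by blast
  obtain \<delta>2 where \<delta>2: "\<delta>2 > 0" "\<And>l x. l \<in> topspace \<Lambda> \<Longrightarrow> norm x < \<delta>2 \<Longrightarrow> x \<in> U \<and> norm (fderiv f l x - fderiv f l 0) \<le> \<kappa>"
    using C1_family_uniform_derivative[OF C1 c\<Lambda> assms(1,2) \<kappa>] by blast
  define \<delta> where "\<delta> = min \<delta>1 \<delta>2"
  have \<delta>: "\<delta> > 0" using \<delta>1(1) \<delta>2(1) by (simp add: \<delta>_def)
  have bU: "x \<in> U" if "norm x < \<delta>" for x using \<delta>1(2)[OF b0(1)] that by (simp add: \<delta>_def)
  have cf: "continuous_map (prod_topology \<Lambda> (top_of_set (ball 0 \<delta>))) euclidean (\<lambda>(l, x). f l x)"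
  proof -
    have "continuous_map (prod_topology \<Lambda> (top_of_set (ball (0::'x) \<delta>))) euclidean snd"
      using continuous_map_snd[of \<Lambda> "top_of_set (ball (0::'x) \<delta>)"] by (simp add: continuous_map_in_subtopology)
    then have "continuous_map (prod_topology \<Lambda> (top_of_set (ball (0::'x) \<delta>))) (prod_topology \<Lambda> (top_of_set U)) (\<lambda>p. (fst p, snd p))"
      unfolding continuous_map_paired continuous_map_in_subtopology using bU by (auto simp: continuous_map_fst)
    moreover have "continuous_map (prod_topology \<Lambda> (top_of_set U)) euclidean (\<lambda>(l, x). f l x)"
      using C1 by (simp add: C1_family_def)
    ultimately have "continuous_map (prod_topology \<Lambda> (top_of_set (ball 0 \<delta>))) euclidean ((\<lambda>(l, x). f l x) \<circ> (\<lambda>p. (fst p, snd p)))"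
      by (rule continuous_map_compose)
    then show ?thesis by (simp add: o_def case_prod_unfold)
  qed
  have lip: "norm ((f l x - L l x) - (f l x' - L l x')) \<le> \<kappa> * norm (x - x')"
    if "l \<in> topspace \<Lambda>" "norm x < \<delta>" "norm x' < \<delta>" for l x x'
    unfolding L_def
    by (rule C1_family_remainder_lipschitz[OF C1 assms(1) that(1) _ that(2,3)]) (use \<delta>2(2)[OF that(1)] in \<open>simp add: \<delta>_def\<close>)
  have only0: "x = 0" if "l \<in> topspace \<Lambda>" "norm x < \<delta>" "f l x = 0" for l x
    using \<delta>1(2)[OF that(1)] that(2,3) by (simp add: \<delta>_def)
  have "\<exists>G. continuous_map (prod_topology \<Lambda> (top_of_set (cball 0 (\<delta> / 4)))) euclidean (\<lambda>(l, e). G l e) \<and>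
    (\<forall>l\<in>topspace \<Lambda>. \<forall>e. norm e \<le> \<delta> / 4 \<longrightarrow> (L l e \<in> V \<longrightarrow> G l e \<in> V) \<and> (G l e = 0 \<longrightarrow> e = 0) \<and>
       norm (G l e - L l e) \<le> (norm (L l) * C + 1) * (2 * \<kappa>) * norm e)"
  proof (rule lyapunov_schmidt[where C = C and \<kappa> = \<kappa>, OF cf cL continuous_R sV])
    fix \<Phi>
    assume "continuous_map (prod_topology \<Lambda> (top_of_set (cball 0 (\<delta> / 4)))) euclidean (\<lambda>(l, e). \<Phi> l e)"
      "\<And>l e. l \<in> topspace \<Lambda> \<Longrightarrow> norm e \<le> \<delta> / 4 \<Longrightarrow> L l e \<in> V \<Longrightarrow> \<Phi> l e \<in> V"
      "\<And>l e. l \<in> topspace \<Lambda> \<Longrightarrow> norm e \<le> \<delta> / 4 \<Longrightarrow> \<Phi> l e = 0 \<Longrightarrow> e = 0"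
      "\<And>l e. l \<in> topspace \<Lambda> \<Longrightarrow> norm e \<le> \<delta> / 4 \<Longrightarrow> norm (\<Phi> l e - L l e) \<le> (norm (L l) * C + 1) * (2 * \<kappa>) * norm e"
    then show "\<exists>G. continuous_map (prod_topology \<Lambda> (top_of_set (cball 0 (\<delta> / 4)))) euclidean (\<lambda>(l, e). G l e) \<and>
      (\<forall>l\<in>topspace \<Lambda>. \<forall>e. norm e \<le> \<delta> / 4 \<longrightarrow> (L l e \<in> V \<longrightarrow> G l e \<in> V) \<and> (G l e = 0 \<longrightarrow> e = 0) \<and>
         norm (G l e - L l e) \<le> (norm (L l) * C + 1) * (2 * \<kappa>) * norm e)"
      by (intro exI[of _ \<Phi>]) simp
  qed (use R_right_inverse C \<kappa> \<kappa>C \<delta> lip assms(6) only0 in simp_all)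
  then obtain G where G: "continuous_map (prod_topology \<Lambda> (top_of_set (cball 0 (\<delta> / 4)))) euclidean (\<lambda>(l, e). G l e)"
    and G': "\<forall>l\<in>topspace \<Lambda>. \<forall>e. norm e \<le> \<delta> / 4 \<longrightarrow> (L l e \<in> V \<longrightarrow> G l e \<in> V) \<and> (G l e = 0 \<longrightarrow> e = 0) \<and>
       norm (G l e - L l e) \<le> (norm (L l) * C + 1) * (2 * \<kappa>) * norm e"
    by (elim exE conjE)
  \<comment> \<open>The full radius on which the reduced map was constructed. The map
    \<open>e\<close> below moves points of the \<open>g\<close>-sphere radially to the norm sphere
    of this radius, where \<open>G\<close> has no zeros.\<close>
  define r where "r = \<delta> / 4"
  have r: "r > 0" using \<delta> by (simp add: r_def)
  define e where "e x = (r / norm x) *\<^sub>R x" for x :: 'x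
  have e: "norm (e x) = r" "e x \<noteq> 0" if "x \<noteq> 0" for x using that r by (simp_all add: e_def)
  define \<Phi> where "\<Phi> p = G (fst p) (e (snd p))" for p
  have inP: "fst p \<in> topspace \<Lambda>" "snd p \<noteq> 0" "L (fst p) (e (snd p)) \<in> V" if p: "p \<in> topspace P" for p
    using p P_nonzero[of "fst p" "snd p"] subspace_scale[OF sV] by (auto simp: topspace_P e_def blinfun.scaleR_right)
  have "sphere_map \<Lambda> L V n c d I W K \<rho> N \<Phi> b0 r"
  proof unfold_locales
    have "continuous_on (- {0}) e" unfolding e_def by (intro continuous_intros) auto
    then have "continuous_map P euclidean (\<lambda>p. e (snd p))"
      by (rule continuous_map_of_continuous_on[OF continuous_P_snd]) (use inP(2) in blast)
    then have "continuous_map P (prod_topology \<Lambda> (top_of_set (cball 0 (\<delta> / 4)))) (\<lambda>p. (fst p, e (snd p)))"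
      unfolding continuous_map_paired continuous_map_in_subtopology
      using continuous_P_fst e(1) inP(2) by (auto simp: r_def)
    from continuous_map_compose[OF this G] show "continuous_map P euclidean \<Phi>" by (simp add: o_def \<Phi>_def[abs_def])
    show "\<Phi> p \<in> V \<and> \<Phi> p \<noteq> 0" if p: "p \<in> topspace P" for p
      using G' inP(1)[OF p] e[OF inP(2)[OF p]] inP(3)[OF p] by (auto simp: \<Phi>_def r_def)
    fix x t assume x: "(b0, x) \<in> topspace P" and t: "0 \<le> t" "t \<le> (1::real)"
    have x0: "x \<noteq> 0" using inP(2)[OF x] by simp
    have "norm (\<Phi> (b0, x) - L b0 (e x)) \<le> M * (2 * \<kappa>) * norm (e x)"
      using G' b0(1) e(1)[OF x0] by (simp add: \<Phi>_def M_def r_def)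
    also have "\<dots> \<le> M * (2 * \<kappa>) * (B * norm (L b0 (e x)))" using B(2) M \<kappa> by (intro mult_left_mono) auto
    also have "\<dots> = (M * (2 * \<kappa>) * B) * norm (L b0 (e x))" by simp
    also have "\<dots> < 1 * norm (L b0 (e x))"
    proof (rule mult_strict_right_mono[OF \<kappa>M])
      have "0 < B * norm (L b0 (e x))" using B(2)[of "e x"] e(1)[OF x0] r by linarith
      then show "0 < norm (L b0 (e x))" using B(1) by (simp add: zero_less_mult_iff)
    qed
    finally have near: "norm (\<Phi> (b0, x) - L b0 (e x)) < norm (L b0 (e x))" by simp
    show "(1 - t) *\<^sub>R \<Phi> (b0, x) + t *\<^sub>R L b0 ((r / norm x) *\<^sub>R x) \<noteq> 0"
    proof
      assume "(1 - t) *\<^sub>R \<Phi> (b0, x) + t *\<^sub>R L b0 ((r / norm x) *\<^sub>R x) = 0"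
      then have "L b0 (e x) = - ((1 - t) *\<^sub>R (\<Phi> (b0, x) - L b0 (e x)))" by (simp add: e_def algebra_simps)
      then have "norm (L b0 (e x)) = \<bar>1 - t\<bar> * norm (\<Phi> (b0, x) - L b0 (e x))" by (metis norm_minus_cancel norm_scaleR)
      also have "\<dots> \<le> 1 * norm (\<Phi> (b0, x) - L b0 (e x))" using t by (intro mult_right_mono) auto
      finally show False using near by simp
    qed
  qed (use assms(4) b0(1) bij0 r in auto)
  then interpret sphere_map \<Lambda> L V n c d I W K \<rho> N \<Phi> b0 r .
  have "bifurcation_index \<Lambda> f = J_proj \<Lambda> (ko_diff \<Lambda> E F)"
    unfolding bifurcation_index_def Ind_def Let_def V_def L_def[abs_def] ..
  then show False using J_proj_index_eq_one assms(8) by simp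
qed

end
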